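(* Let $C$ be a canonical configuration of $n$ tokens with pairwise distinct labels, whose bounding box has $a$ columns and $b$ rows, with $a'$ completely full columns and $b'$ completely full rows, and let $a''=a-a'$, $b''=b-b'$. If $n/2\geq a'+b'+1$ and $a''b''>1$, then $G_C$ is the alternating group on the non-core tokens, i.e. $G_C$ consists exactly of the permutations that fix every core token and act as an even permutation on the non-core tokens.
   Context: Tokens occupy distinct cells of $\mathbb{Z}^2$. The bounding box is the smallest axis-parallel rectangle containing all tokens; configurations are identified up to translation. A push in direction "left": translate so that the lower-left corner of the bounding box is $(0,0)$; for columns $i=1,2,\dots$ in increasing order and every row $j$, if $(i,j)$ is full and $(i-1,j)$ is empty, move the token from $(i,j)$ to $(i-1,j)$. Pushes in directions right, up, down are defined symmetrically. A configuration is canonical if applying a push in direction left or a push in direction down leaves the set of occupied cells unchanged (up to translation); it is compact if it can be obtained from a canonical configuration by pushes. For compact $C$, $G_C$ is the group of permutations $\pi$ of the occupied cells of $C$ such that some finite sequence of pushes transforms $C$ into a configuration with the same set of occupied cells in which the token originally at $p$ is at $\pi(p)$ for every occupied $p$. Core: if $a'>a''$ and $b'>b''$, the core of $C$ is the set of cells of the bounding box lying in the central $a'-a''$ columns (excluding the $a''$ leftmost and $a''$ rightmost columns) and in the central $b'-b''$ rows (excluding the $b''$ topmost and $b''$ bottommost rows); otherwise the core is empty. Core tokens are tokens in core cells; the others are non-core tokens. *)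

theory Defs
  imports Complex_Main "HOL-Library.Product_Plus" "HOL-Combinatorics.Permutations"
begin

text \<open>
  A labelled configuration maps each cell (column, row) to the label of the token occupying
  it, if any; its occupied cells are \<open>dom C\<close>. The definitions below are meant for configurations
  with finite nonempty domain on which the labelling is injective, so that a label identifies
  a token.
\<close>

type_synonym cell = "int \<times> int"
type_synonym 'l config = "cell \<Rightarrow> 'l option"

definition labelled_config :: "'l config \<Rightarrow> bool" where
  "labelled_config C \<longleftrightarrow> finite (dom C) \<and> inj_on C (dom C)"


subsection \<open>Bounding box\<close>

definition box_cols :: "'l config \<Rightarrow> int set" where
  "box_cols C = {Min (fst ` dom C) .. Max (fst ` dom C)}"

definition box_rows :: "'l config \<Rightarrow> int set" where
  "box_rows C = {Min (snd ` dom C) .. Max (snd ` dom C)}"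

definition num_cols :: "'l config \<Rightarrow> nat" where
  "num_cols C = card (box_cols C)"

definition num_rows :: "'l config \<Rightarrow> nat" where
  "num_rows C = card (box_rows C)"

definition full_cols :: "'l config \<Rightarrow> nat" where
  "full_cols C = card {x \<in> box_cols C. \<forall>y \<in> box_rows C. (x, y) \<in> dom C}"

definition full_rows :: "'l config \<Rightarrow> nat" where
  "full_rows C = card {y \<in> box_rows C. \<forall>x \<in> box_cols C. (x, y) \<in> dom C}"

definition nonfull_cols :: "'l config \<Rightarrow> nat" where
  "nonfull_cols C = num_cols C - full_cols C"

definition nonfull_rows :: "'l config \<Rightarrow> nat" where
  "nonfull_rows C = num_rows C - full_rows C"


subsection \<open>Pushes\<close>

definition normalize :: "'l config \<Rightarrow> 'l config" where
  "normalize C = (\<lambda>p. C (p + (Min (fst ` dom C), Min (snd ` dom C))))"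

text \<open>Move every token of column \<open>i\<close> whose left neighbour cell is empty one cell to the left.\<close>

definition move_col_left :: "int \<Rightarrow> 'l config \<Rightarrow> 'l config" where
  "move_col_left i C = (\<lambda>(x, y).
     if x = i - 1 \<and> C (i - 1, y) = None then C (i, y)
     else if x = i \<and> C (i - 1, y) = None then None
     else C (x, y))"

text \<open>The columns are processed one after the other, so a token may move into a cell vacated
  earlier within the same push. Columns beyond the bounding box are empty and need no processing.\<close>

definition push_left :: "'l config \<Rightarrow> 'l config" where
  "push_left C = fold move_col_left [1 .. Max (fst ` dom (normalize C))] (normalize C)"

datatype direction = Left | Right | Up | Down

definition mirror :: "cell \<Rightarrow> cell" where
  "mirror = (\<lambda>(x, y). (- x, y))"

text \<open>The involution \<open>mirror\<close> exchanges left and right, \<open>prod.swap\<close> exchanges left and down as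
  well as right and up. Results are only meaningful up to translation.\<close>

definition push_right :: "'l config \<Rightarrow> 'l config" where
  "push_right C = push_left (C \<circ> mirror) \<circ> mirror"

fun push :: "direction \<Rightarrow> 'l config \<Rightarrow> 'l config" where
  "push Left C = push_left C"
| "push Right C = push_right C"
| "push Down C = push_left (C \<circ> prod.swap) \<circ> prod.swap"
| "push Up C = push_right (C \<circ> prod.swap) \<circ> prod.swap"

definition translate :: "cell \<Rightarrow> cell set \<Rightarrow> cell set" where
  "translate v A = (\<lambda>p. p + v) ` A"

definition canonical :: "'l config \<Rightarrow> bool" where
  "canonical C \<longleftrightarrow>
     (\<forall>d \<in> {Left, Down}. \<exists>v. dom (push d C) = translate v (dom C))"


subsection \<open>The group of a configuration\<close>

text \<open>The vector \<open>v\<close> accounts for configurations being identified up to translation; it is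
  determined by \<open>ds\<close>, since a finite nonempty set has no nontrivial translation symmetry.\<close>

definition push_group :: "'l config \<Rightarrow> (cell \<Rightarrow> cell) set" where
  "push_group C = {\<pi>. \<pi> permutes dom C \<and>
     (\<exists>ds v. dom (fold push ds C) = translate v (dom C) \<and>
             (\<forall>p \<in> dom C. fold push ds C (\<pi> p + v) = C p))}"


subsection \<open>Core\<close>

definition core :: "'l config \<Rightarrow> cell set" where
  "core C =
    (if full_cols C > nonfull_cols C \<and> full_rows C > nonfull_rows C
     then {Min (fst ` dom C) + int (nonfull_cols C) .. Max (fst ` dom C) - int (nonfull_cols C)} \<times>
          {Min (snd ` dom C) + int (nonfull_rows C) .. Max (snd ` dom C) - int (nonfull_rows C)}
     else {})"

definition core_tokens :: "'l config \<Rightarrow> cell set" where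
  "core_tokens C = dom C \<inter> core C"

definition noncore_tokens :: "'l config \<Rightarrow> cell set" where
  "noncore_tokens C = dom C - core C"

definition alternating_group_on :: "'a set \<Rightarrow> ('a \<Rightarrow> 'a) set" where
  "alternating_group_on A = {\<pi>. \<pi> permutes A \<and> evenperm \<pi>}"

end

theory Submission
  imports Defs "HOL-Combinatorics.Cycles"
begin

text \<open>
  A canonical configuration is a Young diagram. After any pushes the occupied cells are this
  diagram with some non-full columns \<open>A\<close> moved to the left of the full ones and some non-full rows
  \<open>B\<close> moved below the full ones. Naming each cell by its column and row in the original diagram, a
  horizontal push \<open>A \<rightarrow> A'\<close> permutes the diagram by \<open>inv (row_map A') \<circ> row_map A\<close>, whatever \<open>B\<close> is, and
  likewise for vertical pushes. Hence the sign of the arrangement is the product of the signs of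
  \<open>row_map A\<close> and \<open>col_map B\<close>, which is trivial after a closed sequence of pushes; and core cells
  always lie in full rows and full columns, so their tokens never move.

  Conversely, a right push that moves the last column to the left end rotates all full rows
  cyclically in these coordinates. Its commutator with the corresponding rotation of the full columns
  is a cycle of length \<open>2 (a' + b') - 1\<close> along the boundary of an \<open>(a' + 1) \<times> (b' + 1)\<close> rectangle
  with one corner missing. Suitable words in two (or, if \<open>b' = 1\<close>, up to four) of these cycles are
  three-cycles. A maximal set on which the group alternates is a block of imprimitivity; it contains
  the support of one of these cycles, hence of all of them since their supports overlap and have equal
  size, and together these supports cover all non-core cells.
\<close>

subsection \<open>Groups containing all even permutations of a set\<close>

text \<open>The size hypothesis says that a cycle of length \<open>2 (a' + b') - 1\<close> fixes at
  least three of the \<open>n\<close> cells. This is the bound beyond which a primitive group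
  containing such a cycle is known to contain the alternating group; the explicit three-cycles take
  the place of that theorem. In the combinatorial part the bound matters only for diagrams with two
  rows, one of them full (or two such columns): there \<open>n <= a + a'\<close>, so it forces
  \<open>a'' >= 4\<close> and supplies the rings that the case \<open>b' = 1\<close> consumes.

  The hypothesis \<open>a'' b'' > 1\<close> excludes full rectangles, where nothing moves, and the
  case \<open>a'' = b'' = 1\<close>, where every closed sequence acts as a power of a single ring
  and the group is cyclic.

  The obstacle is that the part of the diagram outside the full rows and columns is arbitrary. It is
  met by searching for three-cycles only among rings that run through full lines and one line with
  as few tokens as possible, and by leaving everything else to an argument that needs no more than
  the sizes of the supports and one common cell of consecutive ones.\<close>

locale perm_closed =
  fixes G :: "('a \<Rightarrow> 'a) set"
  assumes bij_mem: "f \<in> G \<Longrightarrow> bij f"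
    and comp_mem: "f \<in> G \<Longrightarrow> g \<in> G \<Longrightarrow> f \<circ> g \<in> G"
    and inv_mem: "f \<in> G \<Longrightarrow> inv f \<in> G"
    and id_mem: "id \<in> G"
begin

lemma power_mem: "f \<in> G \<Longrightarrow> f ^^ n \<in> G"
  by (induction n) (simp_all add: id_mem comp_mem)

lemma conj_transpose: "f \<circ> transpose a b \<circ> inv f = transpose (f a) (f b)" if "bij f"
proof -
  have "f \<circ> transpose a b = transpose (f a) (f b) \<circ> f"
    using transpose_comp_eq[OF that, of "f a" "f b"] that by (simp add: bij_is_inj)
  then show ?thesis
    using that by (simp add: fun_eq_iff bij_is_surj surj_f_inv_f)
qed

text \<open>Two transpositions are related when they lie in the same coset of \<open>G\<close>. This
  treats three-cycles and double transpositions alike, and alternation on a set becomes the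
  statement that its transpositions form one class.\<close>

definition equi :: "'a \<Rightarrow> 'a \<Rightarrow> 'a \<Rightarrow> 'a \<Rightarrow> bool" where
  "equi a b c d \<longleftrightarrow> transpose a b \<circ> transpose c d \<in> G"

lemma equi_commute: "equi a b c d \<longleftrightarrow> equi b a c d" "equi a b c d \<longleftrightarrow> equi a b d c"
  by (simp_all add: equi_def transpose_commute)

lemma equi_refl: "equi a b a b"
  by (simp add: equi_def id_mem)

lemma equi_sym: "equi a b c d \<Longrightarrow> equi c d a b"
  unfolding equi_def by (drule inv_mem) (simp add: o_inv_distrib)

lemma equi_trans: "equi a b c d \<Longrightarrow> equi c d e f \<Longrightarrow> equi a b e f"
proof -
  assume "equi a b c d" "equi c d e f"
  then have "(transpose a b \<circ> transpose c d) \<circ> (transpose c d \<circ> transpose e f) \<in> G"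
    unfolding equi_def by (rule comp_mem)
  also have "(transpose a b \<circ> transpose c d) \<circ> (transpose c d \<circ> transpose e f) = transpose a b \<circ> transpose e f"
    by (rule ext) simp
  finally show ?thesis by (simp only: equi_def)
qed

lemma equi_conj: "equi (g a) (g b) (g c) (g d)" if "equi a b c d" "g \<in> G"
proof -
  have b: "bij g" using that bij_mem by blast
  have "g \<circ> (transpose a b \<circ> transpose c d) \<circ> inv g \<in> G"
    using that by (auto simp: equi_def intro!: comp_mem inv_mem)
  also have "g \<circ> (transpose a b \<circ> transpose c d) \<circ> inv g = (g \<circ> transpose a b \<circ> inv g) \<circ> (g \<circ> transpose c d \<circ> inv g)"
    using b by (intro ext) (simp add: bij_is_inj)
  finally show ?thesis using b by (simp only: equi_def conj_transpose)
qed

definition alternates_on :: "'a set \<Rightarrow> bool" where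
  "alternates_on K \<longleftrightarrow> (\<forall>a\<in>K. \<forall>b\<in>K. \<forall>c\<in>K. \<forall>d\<in>K. a \<noteq> b \<longrightarrow> c \<noteq> d \<longrightarrow> equi a b c d)"

lemma alternates_onD:
  "alternates_on K \<Longrightarrow> a \<in> K \<Longrightarrow> b \<in> K \<Longrightarrow> c \<in> K \<Longrightarrow> d \<in> K \<Longrightarrow> a \<noteq> b \<Longrightarrow> c \<noteq> d \<Longrightarrow> equi a b c d"
  by (simp add: alternates_on_def)

lemma alternating_group_subset:
  assumes "finite K" "alternates_on K"
  shows "alternating_group_on K \<subseteq> G"
proof -
  \<comment> \<open>Odd permutations are carried along because the induction adds one transposition
    at a time; any further transposition of \<open>K\<close> has to bring them back into
    \<open>G\<close>.\<close>
  have "(evenperm p \<longrightarrow> p \<in> G) \<and>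
    (\<not> evenperm p \<longrightarrow> (\<forall>a\<in>K. \<forall>b\<in>K. a \<noteq> b \<longrightarrow> transpose a b \<circ> p \<in> G))" if "p permutes K" for p
    using that \<open>finite K\<close>
  proof (induction rule: permutes_induct)
    case id
    show ?case using id_mem evenperm_id by metis
  next
    case (swap a b p)
    show ?case
    proof (cases "a = b")
      case True
      then show ?thesis using swap by simp
    next
      case False
      have perm: "permutation p"
        using swap.hyps(4) assms(1) by (meson permutation_permutes)
      have ev: "evenperm (transpose a b \<circ> p) \<longleftrightarrow> \<not> evenperm p"
        using evenperm_comp[OF permutation_swap_id perm] False by (simp add: evenperm_swap)
      show ?thesis
      proof (cases "evenperm p")
        case True
        then have p: "p \<in> G" using swap by blast
        have "transpose c d \<circ> (transpose a b \<circ> p) \<in> G" if "c \<in> K" "d \<in> K" "c \<noteq> d" for c d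
          using comp_mem[OF _ p, of "transpose c d \<circ> transpose a b"] alternates_onD[OF assms(2), of c d a b]
            that False swap.hyps(1,2) by (simp add: equi_def o_assoc)
        then show ?thesis using ev True by blast
      next
        case odd: False
        have "transpose a b \<circ> p \<in> G"
          by (rule swap.IH[THEN conjunct2, rule_format, OF odd swap.hyps(1,2) False])
        then show ?thesis using ev odd by blast
      qed
    qed
  qed
  then show ?thesis by (auto simp: alternating_group_on_def)
qed

lemma alternates_on_image: "alternates_on (g ` K)" if "alternates_on K" "g \<in> G"
  unfolding alternates_on_def
proof (intro ballI impI)
  fix a b c d
  assume "a \<in> g ` K" "b \<in> g ` K" "c \<in> g ` K" "d \<in> g ` K" "a \<noteq> b" "c \<noteq> d"
  then obtain a' b' c' d' where *: "a = g a'" "b = g b'" "c = g c'" "d = g d'"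
    "a' \<in> K" "b' \<in> K" "c' \<in> K" "d' \<in> K" "a' \<noteq> b'" "c' \<noteq> d'"
    by blast
  then show "equi a b c d"
    using equi_conj[OF alternates_onD[OF that(1)] that(2), of a' b' c' d'] by simp
qed

text \<open>One common point is enough once both sets have three elements. Every pair is compared
  with the reference pair \<open>o1\<close>, \<open>q\<close> of \<open>K\<close>; the real work is
  a pair with one end outside \<open>K\<close>, which is obtained from known pairs by conjugating
  with three-cycles of \<open>K\<close> or \<open>K'\<close>.\<close>

lemma alternates_on_Un:
  assumes K: "alternates_on K" and K': "alternates_on K'"
    and o: "o1 \<in> K" "o1 \<in> K'" and fin: "finite K" "finite K'"
    and card: "card K \<ge> 3" "card K' \<ge> 3"
  shows "alternates_on (K \<union> K')"
proof -
  have ex2: "\<exists>u\<in>M. u \<noteq> v \<and> u \<noteq> w" if "card M \<ge> 3" "finite M" for M :: "'a set" and v w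
  proof (rule ccontr)
    assume "\<not> ?thesis"
    then have "M \<subseteq> {v, w}" by blast
    then have "card M \<le> card {v, w}" by (rule card_mono[rotated]) simp
    also have "\<dots> \<le> 2" by (simp add: card_insert_if)
    finally show False using that by simp
  qed
  obtain q where q: "q \<in> K" "q \<noteq> o1" using ex2[OF card(1) fin(1)] by blast
  have mixed: "equi w x o1 q" if w: "w \<in> K" and x: "x \<in> K'" "x \<notin> K" for w x
  proof (cases "\<exists>o2 \<in> K \<inter> K'. o2 \<noteq> o1")
    case True
    then obtain o2 where o2: "o2 \<in> K" "o2 \<in> K'" "o2 \<noteq> o1" by blast
    have "x \<noteq> o1" "x \<noteq> o2" using x o o2 by auto
    show ?thesis
    proof (cases "w \<in> K'")
      case True
      have "equi w x o1 o2" using alternates_onD[OF K'] True x o o2 w by blast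
      moreover have "equi o1 o2 o1 q" using alternates_onD[OF K] o o2 q by blast
      ultimately show ?thesis by (rule equi_trans)
    next
      case False
      \<comment> \<open>A three-cycle inside \<open>K'\<close> that carries \<open>o2\<close> to
        \<open>x\<close> and leaves \<open>w\<close> alone: it turns a pair of \<open>K\<close> into
        a mixed one.\<close>
      define s where "s = transpose o1 x \<circ> transpose o1 o2"
      have "equi o1 x o1 o2"
        using alternates_onD[OF K'] x o o2 \<open>x \<noteq> o1\<close> by blast
      then have s: "s \<in> G" by (simp add: s_def equi_def)
      have sv: "s o2 = x" "s o1 = o2" "s w = w"
        using o2 False o x w \<open>x \<noteq> o1\<close> \<open>x \<noteq> o2\<close> by (auto simp: s_def transpose_def)
      have "equi w o2 o1 o2" using alternates_onD[OF K] w o o2 False by blast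
      from equi_conj[OF this s] have "equi w x o2 x" by (simp add: sv)
      moreover have "equi o2 x o1 o2" using alternates_onD[OF K'] x o o2 \<open>x \<noteq> o2\<close> by blast
      moreover have "equi o1 o2 o1 q" using alternates_onD[OF K] o o2 q by blast
      ultimately show ?thesis by (blast intro: equi_trans)
    qed
  next
    case False
    have xo: "x \<noteq> o1" using x o by auto
    obtain y where y: "y \<in> K'" "y \<noteq> o1" "y \<noteq> x" using ex2[OF card(2) fin(2)] by blast
    have yK: "y \<notin> K" using False y by blast
    \<comment> \<open>This three-cycle of \<open>K'\<close> meets \<open>K\<close> only in
      \<open>o1\<close>, so conjugation replaces \<open>o1\<close> by \<open>x\<close> and keeps the
      rest of \<open>K\<close>.\<close>
    have c': "transpose o1 x \<circ> transpose x y \<in> G"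
      using alternates_onD[OF K', of o1 x x y] x y o xo by (auto simp: equi_def)
    have away: "equi w' x w' u" if "w' \<in> K" "w' \<noteq> o1" "u \<in> K" "u \<noteq> o1" "u \<noteq> w'" for w' u
    proof -
      have *: "equi w' o1 w' u" using alternates_onD[OF K] that o by blast
      have "(transpose o1 x \<circ> transpose x y) w' = w'" "(transpose o1 x \<circ> transpose x y) u = u"
        "(transpose o1 x \<circ> transpose x y) o1 = x"
        using that x yK xo y by (auto simp: transpose_def)
      then show ?thesis using equi_conj[OF * c'] by metis
    qed
    show ?thesis
    proof (cases "w = o1")
      case False
      obtain u where u: "u \<in> K" "u \<noteq> o1" "u \<noteq> w" using ex2[OF card(1) fin(1)] by blast
      have "equi w x w u" by (rule away) (use w False u in auto)
      moreover have "equi w u o1 q" using alternates_onD[OF K] w u o q by blast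
      ultimately show ?thesis by (rule equi_trans)
    next
      case True
      \<comment> \<open>That conjugation moves \<open>o1\<close> itself, so the mixed pair is first
        produced at \<open>q\<close> and then rotated to \<open>o1\<close> inside
        \<open>K\<close>.\<close>
      obtain u where u: "u \<in> K" "u \<noteq> o1" "u \<noteq> q" using ex2[OF card(1) fin(1)] by blast
      have *: "equi q x q u" by (rule away) (use u q in auto)
      have c: "transpose q o1 \<circ> transpose o1 u \<in> G"
        using alternates_onD[OF K, of q o1 o1 u] u q o by (auto simp: equi_def)
      have "(transpose q o1 \<circ> transpose o1 u) q = o1" "(transpose q o1 \<circ> transpose o1 u) u = q"
        "(transpose q o1 \<circ> transpose o1 u) x = x"
        using u q x xo by (auto simp: transpose_def)
      then have "equi o1 x o1 q" using equi_conj[OF * c] by metis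
      then show ?thesis using True by simp
    qed
  qed
  have link: "equi x x' o1 q" if "x \<in> K'" "x' \<in> K'" "x \<noteq> x'" for x x'
  proof (cases "x \<in> K \<and> x' \<in> K")
    case True
    then show ?thesis using alternates_onD[OF K] that o q by blast
  next
    case False
    then have "\<exists>z. z \<in> K' \<and> z \<notin> K" using that by blast
    then obtain z where z: "z \<in> K'" "z \<notin> K" by blast
    then have "equi x x' o1 z" using alternates_onD[OF K'] that o by blast
    moreover have "equi o1 z o1 q" using mixed o z by blast
    ultimately show ?thesis by (rule equi_trans)
  qed
  have all: "equi a b o1 q" if "a \<in> K \<union> K'" "b \<in> K \<union> K'" "a \<noteq> b" for a b
  proof -
    have ab: "a \<in> K \<or> a \<in> K'" "b \<in> K \<or> b \<in> K'" using that by auto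
    consider "a \<in> K" "b \<in> K" | "a \<in> K'" "b \<in> K'" | "a \<in> K" "b \<in> K'" "b \<notin> K"
      | "b \<in> K" "a \<in> K'" "a \<notin> K" using ab by metis
    then show ?thesis
    proof cases
      case 1
      then show ?thesis using alternates_onD[OF K _ _ o(1) q(1)] that q by metis
    next
      case 2
      then show ?thesis using link that by metis
    next
      case 3
      then show ?thesis using mixed by metis
    next
      case 4
      then show ?thesis using mixed equi_commute(1) by metis
    qed
  qed
  show ?thesis unfolding alternates_on_def
  proof (intro ballI impI)
    fix a b c d
    assume "a \<in> K \<union> K'" "b \<in> K \<union> K'" "c \<in> K \<union> K'" "d \<in> K \<union> K'" "a \<noteq> b" "c \<noteq> d"
    then show "equi a b c d"
      using equi_trans[OF all equi_sym[OF all]] by metis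
  qed
qed

text \<open>A maximal set on which \<open>G\<close> alternates is a block of imprimitivity.\<close>

definition alternating_block :: "'a set \<Rightarrow> bool" where
  "alternating_block K \<longleftrightarrow> alternates_on K \<and> (\<forall>g \<in> G. g ` K \<inter> K \<noteq> {} \<longrightarrow> g ` K = K)"

lemma ex_alternating_block:
  assumes "finite S" and S: "\<And>g. g \<in> G \<Longrightarrow> g ` S \<subseteq> S"
    and "K \<subseteq> S" "alternates_on K" "card K \<ge> 3"
  obtains K' where "K \<subseteq> K'" "K' \<subseteq> S" "alternating_block K'"
proof -
  let ?P = "\<lambda>K'. K \<subseteq> K' \<and> K' \<subseteq> S \<and> alternates_on K'"
  have "?P K" using assms by blast
  moreover have "\<forall>K'. ?P K' \<longrightarrow> card K' < Suc (card S)"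
    using assms(1) by (simp add: card_mono less_Suc_eq_le)
  ultimately have "\<exists>M. ?P M \<and> (\<forall>K'. ?P K' \<longrightarrow> card K' \<le> card M)"
    by (rule ex_has_greatest_nat)
  then obtain M where M: "?P M" "\<And>K'. ?P K' \<Longrightarrow> card K' \<le> card M"
    by (elim exE conjE) simp
  have fin: "finite M" using M(1) assms(1) finite_subset by metis
  have "g ` M = M" if g: "g \<in> G" "g ` M \<inter> M \<noteq> {}" for g
  proof -
    obtain z where z: "z \<in> M" "z \<in> g ` M" using g by blast
    have inj: "inj g" using bij_mem[OF g(1)] by (rule bij_is_inj)
    have c3: "card M \<ge> 3"
      using M(1) assms(5) card_mono[OF fin, of K] by simp
    have cg: "card (g ` M) = card M" using inj by (simp add: card_image inj_on_subset)
    \<comment> \<open>The two sets meet, so their union alternates as well, and the choice of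
      \<open>M\<close> with the largest cardinality forbids it to grow.\<close>
    have "alternates_on (M \<union> g ` M)"
      by (rule alternates_on_Un[where ?o1.0 = z])
        (use M(1) g z fin c3 cg in \<open>simp_all add: alternates_on_image\<close>)
    moreover have "M \<union> g ` M \<subseteq> S" using M(1) S[OF g(1)] by blast
    moreover have "K \<subseteq> M \<union> g ` M" using M(1) by blast
    ultimately have "card (M \<union> g ` M) \<le> card M" by (intro M(2) conjI)
    then have "M \<union> g ` M = M" using card_seteq[of "M \<union> g ` M" M] fin by simp
    then have "g ` M \<subseteq> M" by blast
    then show ?thesis using card_subset_eq[OF fin] cg by blast
  qed
  then have "alternating_block M" using M(1) by (simp add: alternating_block_def)
  then show ?thesis using that[of M] M(1) by simp
qed

lemma block_closed:
  assumes "alternating_block K" "c \<in> G" "p \<in> K" "c p = p" "x \<in> K"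
  shows "c x \<in> K"
proof -
  have "c ` K \<inter> K \<noteq> {}" using assms(3,4) by force
  then show ?thesis using assms by (auto simp: alternating_block_def)
qed

end

subsection \<open>Ring-shaped cycles\<close>

text \<open>The cycle moves up column \<open>k\<close>, right along row \<open>y\<close>, down column \<open>k + a\<close> and left along row \<open>0\<close>.
  Row \<open>y\<close> is not shifted along with \<open>k\<close> and contributes only \<open>a\<close> cells.\<close>

definition ring :: "int \<Rightarrow> int \<Rightarrow> int \<Rightarrow> int \<Rightarrow> cell \<Rightarrow> cell" where
  "ring a b y k = (\<lambda>(i, j).
     if i = k \<and> 0 \<le> j \<and> j < b - 1 then (k, j + 1)
     else if i = k \<and> j = b - 1 then (0, y)
     else if j = y \<and> 0 \<le> i \<and> i < a - 1 then (i + 1, y)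
     else if j = y \<and> i = a - 1 then (k + a, b - 1)
     else if i = k + a \<and> 0 < j \<and> j < b then (i, j - 1)
     else if j = 0 \<and> k < i \<and> i \<le> k + a then (i - 1, 0)
     else (i, j))"

text \<open>Lists the ring in the order of the cycle from the left end of row \<open>y\<close>:
  \<open>a\<close> cells there, \<open>b\<close> down the right column, \<open>a\<close> along row
  \<open>0\<close>, and the remaining \<open>b - 1\<close> up the left column.\<close>

definition ring_cell :: "int \<Rightarrow> int \<Rightarrow> int \<Rightarrow> int \<Rightarrow> int \<Rightarrow> cell" where
  "ring_cell a b y k i =
    (if i < a then (i, y)
     else if i < a + b then (k + a, a + b - 1 - i)
     else if i < 2 * a + b then (k + 2 * a + b - 1 - i, 0)
     else (k, i - (2 * a + b - 1)))"

lemma ring_ring_cell: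
  assumes "1 \<le> a" "1 \<le> b" "b \<le> y" "0 \<le> i" "i < 2 * (a + b) - 1"
  shows "ring a b y k (ring_cell a b y k i)
    = ring_cell a b y k (if i = 2 * (a + b) - 2 then 0 else i + 1)"
proof -
  consider "i < a" | "a \<le> i" "i < a + b" | "a + b \<le> i" "i < 2 * a + b" | "2 * a + b \<le> i"
    by linarith
  then show ?thesis
    by cases (use assms in \<open>auto simp: ring_def ring_cell_def\<close>)
qed

lemma ring_cell_eq_iff:
  assumes "1 \<le> a" "1 \<le> b" "b \<le> y" "0 \<le> i" "i < 2 * (a + b) - 1" "0 \<le> j" "j < 2 * (a + b) - 1"
  shows "ring_cell a b y k i = ring_cell a b y k j \<longleftrightarrow> i = j"
  using assms by (auto simp: ring_cell_def split: if_splits)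

lemma ring_power_ring_cell:
  assumes "1 \<le> a" "1 \<le> b" "b \<le> y" "0 \<le> i" "i < 2 * (a + b) - 1" "int n < 2 * (a + b) - 1"
  shows "(ring a b y k ^^ n) (ring_cell a b y k i)
    = ring_cell a b y k (if i + int n < 2 * (a + b) - 1 then i + int n
        else i + int n - (2 * (a + b) - 1))"
  using assms(6)
proof (induction n)
  case 0
  then show ?case using assms by simp
next
  case (Suc n)
  define m where "m = (if i + int n < 2 * (a + b) - 1 then i + int n else i + int n - (2 * (a + b) - 1))"
  have m: "0 \<le> m" "m < 2 * (a + b) - 1" using assms Suc.prems by (auto simp: m_def)
  have "(ring a b y k ^^ Suc n) (ring_cell a b y k i) = ring a b y k (ring_cell a b y k m)"
    using Suc by (simp add: m_def)
  also have "\<dots> = ring_cell a b y k (if m = 2 * (a + b) - 2 then 0 else m + 1)"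
    by (rule ring_ring_cell) (use assms m in auto)
  also have "(if m = 2 * (a + b) - 2 then 0 else m + 1) =
      (if i + int (Suc n) < 2 * (a + b) - 1 then i + int (Suc n) else i + int (Suc n) - (2 * (a + b) - 1))"
    using assms Suc.prems by (auto simp: m_def)
  finally show ?case .
qed

lemma ring_power_fixed: "(ring a b y k ^^ n) z = z" if "ring a b y k z = z"
  using that by (induction n) auto

text \<open>Shifting a ring by one changes it only at its columns, so the commutator is a product of
  four transpositions whatever the size; \<open>2 \<le> a\<close> and \<open>2 \<le> b\<close> keep
  them disjoint. The identity is written without inverses so that it can be checked cell by
  cell.\<close>

lemma ring_commutator:
  assumes "2 \<le> a" "2 \<le> b" "b \<le> y"
  shows "ring a b y 0 \<circ> ring a b y 1 = ring a b y 1 \<circ>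
    (transpose (a + 1, 0) (a, 0) \<circ> transpose (a - 1, y) (a, b - 1) \<circ>
     transpose (1, b - 1) (0, y) \<circ> transpose (1, 0) (0, 0)) \<circ> ring a b y 0" (is "?L = ?R")
proof (rule ext, clarify)
  fix i j :: int
  consider "j = y" | "j \<noteq> y" "i = 0" | "j \<noteq> y" "i = 1" | "j \<noteq> y" "i = a" "a \<noteq> 1" | "j \<noteq> y" "i = a + 1"
    | "j \<noteq> y" "j = 0" "i \<noteq> 0" "i \<noteq> 1" "i \<noteq> a" "i \<noteq> a + 1"
    | "j \<noteq> y" "j \<noteq> 0" "i \<noteq> 0" "i \<noteq> 1" "i \<noteq> a" "i \<noteq> a + 1" by metis
  then show "?L (i, j) = ?R (i, j)"
    by cases (use assms in \<open>auto simp: ring_def transpose_def\<close>)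
qed

text \<open>For \<open>a = 1\<close> the column shared by the two rings is traversed in opposite
  directions, and only two transpositions survive.\<close>

lemma ring_commutator_width_1:
  assumes "2 \<le> b" "b \<le> y"
  shows "ring 1 b y 1 \<circ> ring 1 b y 0 =
    (transpose (0, y) (2, b - 1) \<circ> transpose (1, 0) (0, 0)) \<circ> ring 1 b y 0 \<circ> ring 1 b y 1" (is "?L = ?R")
proof (rule ext, clarify)
  fix i j :: int
  consider "j = y" | "j \<noteq> y" "i = 0" | "j \<noteq> y" "i = 1" | "j \<noteq> y" "i = 2"
    | "j \<noteq> y" "i \<noteq> 0" "i \<noteq> 1" "i \<noteq> 2" by metis
  then show "?L (i, j) = ?R (i, j)"
    by cases (use assms in \<open>auto simp: ring_def transpose_def\<close>)
qed

text \<open>For \<open>b = 1\<close> the columns shrink to single cells of row \<open>0\<close>, and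
  already the quotient of neighbouring rings, rather than a commutator, is a product of two
  transpositions.\<close>

lemma ring_step_height_1:
  assumes "2 \<le> a" "1 \<le> y"
  shows "ring a 1 y (k + 1) = ring a 1 y k \<circ>
    (transpose (a - 1, y) (k + a + 1, 0) \<circ> transpose (k + 1, 0) (k, 0))" (is "?L = ?R")
proof (rule ext, clarify)
  fix i j :: int
  consider "j = y" | "j \<noteq> y" "j \<noteq> 0" | "j \<noteq> y" "j = 0" by metis
  then show "?L (i, j) = ?R (i, j)"
    by cases (use assms in \<open>auto simp: ring_def transpose_def\<close>)
qed

section \<open>Powers of products of transpositions\<close>

lemma funpow_eqI:
  assumes "\<And>z. z \<notin> P \<Longrightarrow> w z = z" "\<And>z. z \<notin> P \<Longrightarrow> c z = z" "\<And>z. z \<in> P \<Longrightarrow> (w ^^ n) z = c z"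
  shows "w ^^ n = c"
proof
  fix z
  have "(w ^^ n) z = z" if "z \<notin> P" using assms(1)[OF that] by (induction n) auto
  then show "(w ^^ n) z = c z" using assms(2,3) by (cases "z \<in> P") auto
qed

text \<open>The factor \<open>transpose bk y1\<close> occurs twice and cancels. A five-cycle and a
  three-cycle remain, and the fifth power keeps the three-cycle, inverted.\<close>

lemma transpositions_power_5:
  fixes u :: 'a
  assumes "distinct [u, v, b1, x1, tk, tk', t1, bk, y1, yl]"
  shows "((transpose u b1 \<circ> transpose tk x1 \<circ> transpose v t1 \<circ> transpose bk y1) \<circ>
    (transpose u yl \<circ> transpose bk y1 \<circ> transpose v b1 \<circ> transpose tk' tk)) ^^ 5 =
    transpose tk' tk \<circ> transpose tk x1" (is "?w ^^ 5 = _")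
proof -
  have rev: "distinct (rev [u, v, b1, x1, tk, tk', t1, bk, y1, yl])"
    using assms by (simp only: distinct_rev)
  define w where "w = ?w"
  have w: "w u = yl" "w yl = b1" "w b1 = t1" "w t1 = v" "w v = u" "w tk' = x1" "w x1 = tk" "w tk = tk'"
    "w bk = bk" "w y1 = y1"
    using assms rev by (simp_all add: w_def)
  have w0: "w z = z" if "z \<notin> {u, v, b1, x1, tk, tk', t1, bk, y1, yl}" for z
    using that by (simp add: w_def)
  have "w ^^ 5 = transpose tk' tk \<circ> transpose tk x1"
  proof (rule funpow_eqI)
    show "(w ^^ 5) z = (transpose tk' tk \<circ> transpose tk x1) z" if "z \<in> {u, v, b1, x1, tk, tk', t1, bk, y1, yl}" for z
      using that by (elim insertE emptyE) (use assms rev in \<open>simp_all add: w eval_nat_numeral\<close>)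
  qed (use w0 in auto)
  then show ?thesis by (simp only: w_def)
qed

text \<open>The two involutions overlap in \<open>u\<close> and \<open>e2\<close>, which yields a
  four-cycle, and in \<open>v\<close>, which yields a three-cycle; the other factors stay
  transpositions. The fourth power leaves exactly the three-cycle.\<close>

lemma transpositions_power_4:
  fixes u :: 'a
  assumes "distinct [u, v, t1, e1, e2, e3, e4, b1, c1, c2, c3, c4, c5]"
  shows "((transpose u b1 \<circ> transpose e1 e2 \<circ> transpose v t1 \<circ> transpose c1 c2) \<circ>
    (transpose u e2 \<circ> transpose c4 c5 \<circ> transpose v c3 \<circ> transpose e3 e4)) ^^ 4 =
    transpose c3 t1 \<circ> transpose t1 v" (is "?w ^^ 4 = _")
proof -
  have rev: "distinct (rev [u, v, t1, e1, e2, e3, e4, b1, c1, c2, c3, c4, c5])"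
    using assms by (simp only: distinct_rev)
  define w where "w = ?w"
  have w: "w u = e1" "w e1 = e2" "w e2 = b1" "w b1 = u" "w v = c3" "w c3 = t1" "w t1 = v"
    "w c1 = c2" "w c2 = c1" "w c4 = c5" "w c5 = c4" "w e3 = e4" "w e4 = e3"
    using assms rev by (simp_all add: w_def)
  have w0: "w z = z" if "z \<notin> {u, v, t1, e1, e2, e3, e4, b1, c1, c2, c3, c4, c5}" for z
    using that by (simp add: w_def)
  have "w ^^ 4 = transpose c3 t1 \<circ> transpose t1 v"
  proof (rule funpow_eqI)
    show "(w ^^ 4) z = (transpose c3 t1 \<circ> transpose t1 v) z" if "z \<in> {u, v, t1, e1, e2, e3, e4, b1, c1, c2, c3, c4, c5}" for z
      using that by (elim insertE emptyE) (use assms rev in \<open>simp_all add: w eval_nat_numeral\<close>)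
  qed (use w0 in auto)
  then show ?thesis by (simp only: w_def)
qed

text \<open>Overlapping only in \<open>u\<close>, the two involutions multiply to a three-cycle and
  two transpositions, so squaring isolates the three-cycle up to inversion.\<close>

lemma transpositions_power_2:
  fixes u :: 'a
  assumes "distinct [u, c1, c2, d1, d2, d3, d4]"
  shows "((transpose u c1 \<circ> transpose d1 d2) \<circ> (transpose u c2 \<circ> transpose d3 d4)) ^^ 2 =
    transpose c2 u \<circ> transpose u c1"
proof -
  have rev: "distinct (rev [u, c1, c2, d1, d2, d3, d4])"
    using assms by (simp only: distinct_rev)
  define w where "w = ((transpose u c1 \<circ> transpose d1 d2) \<circ> (transpose u c2 \<circ> transpose d3 d4))"
  have w: "w u = c2" "w c2 = c1" "w c1 = u" "w d1 = d2" "w d2 = d1" "w d3 = d4" "w d4 = d3"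
    using assms rev by (simp_all add: w_def)
  have w0: "w z = z" if "z \<notin> {u, c1, c2, d1, d2, d3, d4}" for z
    using that by (simp add: w_def)
  have "w ^^ 2 = transpose c2 u \<circ> transpose u c1"
  proof (rule funpow_eqI)
    show "(w ^^ 2) z = (transpose c2 u \<circ> transpose u c1) z" if "z \<in> {u, c1, c2, d1, d2, d3, d4}" for z
      using that by (elim insertE emptyE) (use assms rev in \<open>simp_all add: w eval_nat_numeral\<close>)
  qed (use w0 in auto)
  then show ?thesis by (simp only: w_def)
qed

context perm_closed
begin

lemma equi_sameI:
  assumes "w \<in> G" "w ^^ n = transpose p q \<circ> transpose q r"
  shows "equi p q q r"
  using power_mem[OF assms(1), of n] assms(2) by (simp add: equi_def)

lemma mem_of_comp_eq:
  assumes "h \<circ> f \<circ> g = k" "h \<in> G" "g \<in> G" "k \<in> G"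
  shows "f \<in> G"
proof -
  have "f = inv h \<circ> (h \<circ> f \<circ> g) \<circ> inv g"
    using bij_mem[OF assms(2)] bij_mem[OF assms(3)]
    by (intro ext) (simp add: bij_is_inj bij_is_surj surj_f_inv_f)
  also have "\<dots> \<in> G" unfolding assms(1) using assms by (intro comp_mem inv_mem)
  finally show ?thesis .
qed

lemma conj_mem: "f \<in> G \<Longrightarrow> g \<in> G \<Longrightarrow> f \<circ> g \<circ> inv f \<in> G"
  by (intro comp_mem inv_mem)

lemma conj_comp: "bij f \<Longrightarrow> f \<circ> (g \<circ> h) \<circ> inv f = (f \<circ> g \<circ> inv f) \<circ> (f \<circ> h \<circ> inv f)"
  by (intro ext) (simp add: bij_is_inj)

end

section \<open>Three-cycles from neighbouring rings\<close>

locale cell_group = perm_closed G for G :: "(cell \<Rightarrow> cell) set"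
begin

lemma ring_commutator_mem:
  assumes "2 \<le> a" "2 \<le> b" "b \<le> y" "ring a b y 0 \<in> G" "ring a b y 1 \<in> G"
  shows "transpose (a + 1, 0) (a, 0) \<circ> transpose (a - 1, y) (a, b - 1) \<circ>
     transpose (1, b - 1) (0, y) \<circ> transpose (1, 0) (0, 0) \<in> G"
  by (rule mem_of_comp_eq[OF ring_commutator[symmetric]]) (use assms comp_mem in auto)

lemma ring_commutator_width_1_mem:
  assumes "2 \<le> b" "b \<le> y" "ring 1 b y 0 \<in> G" "ring 1 b y 1 \<in> G"
  shows "transpose (0, y) (2, b - 1) \<circ> transpose (1, 0) (0, 0) \<in> G"
  by (rule mem_of_comp_eq[of id _ "ring 1 b y 0 \<circ> ring 1 b y 1" "ring 1 b y 1 \<circ> ring 1 b y 0"])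
    (simp_all only: assms id_mem comp_mem id_comp o_assoc
      ring_commutator_width_1[OF assms(1,2), symmetric])

lemma ring_step_height_1_mem:
  assumes "2 \<le> a" "1 \<le> y" "ring a 1 y k \<in> G" "ring a 1 y (k + 1) \<in> G"
  shows "transpose (a - 1, y) (k + a + 1, 0) \<circ> transpose (k + 1, 0) (k, 0) \<in> G"
  by (rule mem_of_comp_eq[where g = id, OF _ assms(3) id_mem assms(4)])
    (simp add: ring_step_height_1[OF assms(1,2)])

lemma three_cycle_large:
  assumes a: "3 \<le> a" and b: "2 \<le> b" "b \<le> y" and G: "ring a b y 0 \<in> G" "ring a b y 1 \<in> G"
  shows "equi (a - 2, y) (a - 1, y) (a - 1, y) (a, b - 1)"
proof -
  let ?g = "ring a b y 0" and ?e = "ring_cell a b y 0"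
  \<comment> \<open>Half a turn of the ring of length \<open>2 (a + b) - 1\<close>. It carries the
    pair \<open>(a - 1, y)\<close>, \<open>(a, b - 1)\<close> of \<open>f\<close> onto the pair
    \<open>(1, 0)\<close>, \<open>(0, 0)\<close>, which is another factor of \<open>f\<close>; this
    is the overlap whose fifth power is a three-cycle. For \<open>a = 2\<close> the cells
    \<open>(a - 2, y)\<close> and \<open>(0, y)\<close> would coincide.\<close>
  define n where "n = nat (a + b - 1)"
  define f :: "cell \<Rightarrow> cell" where "f = transpose (a + 1, 0) (a, 0) \<circ> transpose (a - 1, y) (a, b - 1) \<circ>
     transpose (1, b - 1) (0, y) \<circ> transpose (1, 0) (0, 0)"
  have f: "f \<in> G" unfolding f_def by (rule ring_commutator_mem) (use assms in auto)
  have pw: "?g ^^ n \<in> G" using G by (intro power_mem)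
  have bp: "bij (?g ^^ n)" using pw bij_mem by blast
  have nn: "int n = a + b - 1" using a b by (simp add: n_def)
  have e: "(?g ^^ n) (?e i) = ?e (if i + int n < 2 * (a + b) - 1 then i + int n
        else i + int n - (2 * (a + b) - 1))" if "0 \<le> i" "i < 2 * (a + b) - 1" for i
    by (rule ring_power_ring_cell) (use a b that nn in auto)
  have im: "(?g ^^ n) (a, 0) = (0, b - 1)" "(?g ^^ n) (a - 1, y) = (1, 0)"
     "(?g ^^ n) (a, b - 1) = (0, 0)" "(?g ^^ n) (0, y) = (a, 0)" "(?g ^^ n) (1, 0) = (a - 2, y)"
     "(?g ^^ n) (0, 0) = (a - 1, y)"
    using e[of "a + b - 1"] e[of "a - 1"] e[of a] e[of 0] e[of "2 * a + b - 2"] e[of "2 * a + b - 1"] a b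
    by (auto simp: ring_cell_def nn)
  have fx: "(?g ^^ n) (a + 1, 0) = (a + 1, 0)" "(?g ^^ n) (1, b - 1) = (1, b - 1)"
    by (rule ring_power_fixed, use a b in \<open>simp add: ring_def\<close>)+
  have "?g ^^ n \<circ> f \<circ> inv (?g ^^ n) = transpose (a + 1, 0) (0, b - 1) \<circ> transpose (1, 0) (0, 0) \<circ>
     transpose (1, b - 1) (a, 0) \<circ> transpose (a - 2, y) (a - 1, y)"
    unfolding f_def by (simp only: conj_comp[OF bp] conj_transpose[OF bp] im fx)
  then have *: "f \<circ> (transpose (a + 1, 0) (0, b - 1) \<circ> transpose (1, 0) (0, 0) \<circ>
     transpose (1, b - 1) (a, 0) \<circ> transpose (a - 2, y) (a - 1, y)) \<in> G"
    using comp_mem[OF f conj_mem[OF pw f]] by simp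
  show ?thesis
    by (rule equi_sameI[OF *[unfolded f_def], OF transpositions_power_5]) (use a b in auto)
qed

lemma three_cycle_width_2:
  assumes b: "4 \<le> b" "b \<le> y" and G: "ring 2 b y 0 \<in> G" "ring 2 b y 1 \<in> G"
  shows "equi (0, 1) (0, y) (0, y) (1, b - 1)"
proof -
  let ?g = "ring 2 b y 0" and ?e = "ring_cell 2 b y 0"
  \<comment> \<open>This rotation takes \<open>(2, 0)\<close> to \<open>(2, b - 1)\<close>, which
    links \<open>(3, 0)\<close> with another factor of \<open>f\<close>, and sends the other cells
    of the support that lie on the ring outside the support. The cells \<open>(0, 3)\<close> and
    \<open>(2, b - 3)\<close> need \<open>4 \<le> b\<close> for this.\<close>
  define n where "n = nat (b + 4)"
  define f :: "cell \<Rightarrow> cell" where "f = transpose (2 + 1, 0) (2, 0) \<circ> transpose (2 - 1, y) (2, b - 1) \<circ>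
     transpose (1, b - 1) (0, y) \<circ> transpose (1, 0) (0, 0)"
  have f: "f \<in> G" unfolding f_def by (rule ring_commutator_mem) (use assms in auto)
  have pw: "?g ^^ n \<in> G" using G by (intro power_mem)
  have bp: "bij (?g ^^ n)" using pw bij_mem by blast
  have nn: "int n = b + 4" using b by (simp add: n_def)
  have e: "(?g ^^ n) (?e i) = ?e (if i + int n < 2 * (2 + b) - 1 then i + int n
        else i + int n - (2 * (2 + b) - 1))" if "0 \<le> i" "i < 2 * (2 + b) - 1" for i
    by (rule ring_power_ring_cell) (use b that nn in auto)
  have im: "(?g ^^ n) (2, 0) = (2, b - 1)" "(?g ^^ n) (1, y) = (0, 2)"
     "(?g ^^ n) (2, b - 1) = (0, 3)" "(?g ^^ n) (0, y) = (0, 1)" "(?g ^^ n) (1, 0) = (2, b - 2)"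
     "(?g ^^ n) (0, 0) = (2, b - 3)"
    using e[of "b + 1"] e[of 1] e[of 2] e[of 0] e[of "b + 2"] e[of "b + 3"] b
    by (auto simp: ring_cell_def nn)
  have fx: "(?g ^^ n) (3, 0) = (3, 0)" "(?g ^^ n) (1, b - 1) = (1, b - 1)"
    by (rule ring_power_fixed, use b in \<open>simp add: ring_def\<close>)+
  have "?g ^^ n \<circ> f \<circ> inv (?g ^^ n) = transpose (3, 0) (2, b - 1) \<circ> transpose (0, 2) (0, 3) \<circ>
     transpose (1, b - 1) (0, 1) \<circ> transpose (2, b - 2) (2, b - 3)"
    unfolding f_def by (simp add: conj_comp[OF bp] conj_transpose[OF bp] im fx del: o_assoc)
  then have *: "f \<circ> (transpose (3, 0) (2, b - 1) \<circ> transpose (0, 2) (0, 3) \<circ>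
     transpose (1, b - 1) (0, 1) \<circ> transpose (2, b - 2) (2, b - 3)) \<in> G"
    using comp_mem[OF f conj_mem[OF pw f]] by simp
  have f': "f = transpose (3, 0) (2, 0) \<circ> transpose (1, y) (2, b - 1) \<circ>
     transpose (1, b - 1) (0, y) \<circ> transpose (1, 0) (0, 0)"
    by (simp add: f_def)
  show ?thesis
    by (rule equi_sameI[OF *[unfolded f'], OF transpositions_power_4]) (use b in auto)
qed

lemma three_cycle_width_1:
  assumes b: "3 \<le> b" "b \<le> y" and G: "ring 1 b y 0 \<in> G" "ring 1 b y 1 \<in> G"
  shows "equi (1, b - 2) (2, b - 1) (2, b - 1) (0, y)"
proof -
  let ?g = "ring 1 b y 0"
  define f :: "cell \<Rightarrow> cell" where "f = transpose (2, b - 1) (0, y) \<circ> transpose (1, 0) (0, 0)"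
  have f: "f \<in> G" unfolding f_def
    using ring_commutator_width_1_mem[of b y] assms by (simp add: transpose_commute)
  \<comment> \<open>Rotating by two fixes \<open>(2, b - 1)\<close> and moves the other three cells
    of \<open>f\<close> off its support, so the conjugate overlaps \<open>f\<close> in a single
    point.\<close>
  have pw: "?g ^^ 2 \<in> G" using G by (intro power_mem)
  have bp: "bij (?g ^^ 2)" using pw bij_mem by blast
  have im: "(?g ^^ 2) (0, y) = (1, b - 2)" "(?g ^^ 2) (2, b - 1) = (2, b - 1)"
     "(?g ^^ 2) (1, 0) = (0, 1)" "(?g ^^ 2) (0, 0) = (0, 2)"
    using b by (auto simp: eval_nat_numeral ring_def)
  have "?g ^^ 2 \<circ> f \<circ> inv (?g ^^ 2) = transpose (2, b - 1) (1, b - 2) \<circ> transpose (0, 1) (0, 2)"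
    unfolding f_def by (simp only: conj_comp[OF bp] conj_transpose[OF bp] im)
  then have *: "f \<circ> (transpose (2, b - 1) (1, b - 2) \<circ> transpose (0, 1) (0, 2)) \<in> G"
    using comp_mem[OF f conj_mem[OF pw f]] by simp
  show ?thesis
    by (rule equi_sameI[OF *[unfolded f_def], OF transpositions_power_2]) (use b in auto)
qed

text \<open>The quotient of rings \<open>0\<close> and \<open>1\<close> and that of rings
  \<open>2\<close> and \<open>3\<close> share just the cell \<open>(a - 1, y)\<close>. The quotient
  of rings \<open>1\<close> and \<open>2\<close> would share a further cell with the first; this is
  why four rings are used.\<close>

lemma three_cycle_height_1:
  assumes a: "3 \<le> a" "1 \<le> y" and G: "\<And>k. 0 \<le> k \<Longrightarrow> k < 4 \<Longrightarrow> ring a 1 y k \<in> G"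
  shows "equi (a + 3, 0) (a - 1, y) (a - 1, y) (a + 1, 0)"
proof -
  have "transpose (a - 1, y) (a + 1, 0) \<circ> transpose (1, 0) (0, 0) \<in> G"
    using ring_step_height_1_mem[of a y 0] a G[of 0] G[of 1] by simp
  moreover have "transpose (a - 1, y) (a + 3, 0) \<circ> transpose (3, 0) (2, 0) \<in> G"
    using ring_step_height_1_mem[of a y 2] a G[of 2] G[of 3] by (simp add: add.commute)
  ultimately have *: "(transpose (a - 1, y) (a + 1, 0) \<circ> transpose (1, 0) (0, 0)) \<circ>
    (transpose (a - 1, y) (a + 3, 0) \<circ> transpose (3, 0) (2, 0)) \<in> G" by (rule comp_mem)
  show ?thesis
    by (rule equi_sameI[OF *, OF transpositions_power_2]) (use a in auto)
qed

end

section \<open>Three-cycles for small rings\<close>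

context cell_group
begin

lemma three_cycle_1_2:
  assumes y: "2 \<le> y" and G: "ring 1 2 y 0 \<in> G" "ring 1 2 y 1 \<in> G"
  shows "equi (1, 0) (2, 1) (2, 1) (2, 0)"
proof -
  \<comment> \<open>The word has cycle type 3 + 2 + 2, so its square is a three-cycle.\<close>
  define w where "w = ring 1 2 y 0 \<circ> ring 1 2 y 0 \<circ> ring 1 2 y 1 ^^ 4"
  define P :: "cell set" where "P = {(0, y), (0, 0), (1, 1), (0, 1), (1, 0), (2, 0), (2, 1 :: int)}"
  have w: "w (0, y) = (0, 0)" "w (0, 0) = (0, y)" "w (1, 1) = (0, 1)" "w (0, 1) = (1, 1)"
    "w (1, 0) = (2, 0)" "w (2, 0) = (2, 1)" "w (2, 1) = (1, 0)"
    using y by (simp_all add: w_def ring_def eval_nat_numeral)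
  have w0: "w z = z" if "z \<notin> P" for z
  proof -
    have "ring 1 2 y 0 z = z" "ring 1 2 y 1 z = z"
      using that y by (cases z; simp add: ring_def P_def; smt (verit))+
    then show ?thesis by (simp add: w_def ring_power_fixed)
  qed
  have "w ^^ 2 = transpose (1, 0) (2, 1) \<circ> transpose (2, 1) (2, 0)"
  proof (rule funpow_eqI)
    show "(w ^^ 2) z = (transpose (1, 0) (2, 1) \<circ> transpose (2, 1) (2, 0)) z" if "z \<in> P" for z
      using that unfolding P_def
      by (elim insertE emptyE) (use y in \<open>simp_all add: w eval_nat_numeral\<close>)
  qed (use w0 in \<open>auto simp: P_def\<close>)
  moreover have "w \<in> G" using G by (auto simp: w_def intro!: comp_mem power_mem)
  ultimately show ?thesis by (intro equi_sameI[of w 2])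
qed

lemma three_cycle_2_2:
  assumes y: "2 \<le> y" and G: "ring 2 2 y 0 \<in> G" "ring 2 2 y 1 \<in> G"
  shows "equi (2, 1) (1, 0) (1, 0) (1, 1)"
proof -
  \<comment> \<open>The word has cycle type 7 + 3, which explains the seventh power.\<close>
  define w where "w = ring 2 2 y 0 \<circ> ring 2 2 y 0 \<circ> ring 2 2 y 1"
  define P :: "cell set" where "P = {(0, 1), (1, y), (3, 1), (3, 0), (0, 0), (0, y), (2, 0), (2, 1), (1, 0), (1, 1 :: int)}"
  have w: "w (0, 1) = (1, y)" "w (1, y) = (3, 1)" "w (3, 1) = (3, 0)" "w (3, 0) = (0, 0)"
    "w (0, 0) = (0, y)" "w (0, y) = (2, 0)" "w (2, 0) = (0, 1)"
    "w (2, 1) = (1, 0)" "w (1, 0) = (1, 1)" "w (1, 1) = (2, 1)"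
    using y by (simp_all add: w_def ring_def)
  have w0: "w z = z" if "z \<notin> P" for z
  proof -
    have "ring 2 2 y 0 z = z" "ring 2 2 y 1 z = z"
      using that y by (cases z; simp add: ring_def P_def; smt (verit))+
    then show ?thesis by (simp add: w_def)
  qed
  have "w ^^ 7 = transpose (2, 1) (1, 0) \<circ> transpose (1, 0) (1, 1)"
  proof (rule funpow_eqI)
    show "(w ^^ 7) z = (transpose (2, 1) (1, 0) \<circ> transpose (1, 0) (1, 1)) z" if "z \<in> P" for z
      using that unfolding P_def
      by (elim insertE emptyE) (use y in \<open>simp_all add: w eval_nat_numeral\<close>)
  qed (use w0 in \<open>auto simp: P_def\<close>)
  moreover have "w \<in> G" using G by (auto simp: w_def intro!: comp_mem power_mem)
  ultimately show ?thesis by (intro equi_sameI[of w 7])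
qed

lemma three_cycle_2_3:
  assumes y: "3 \<le> y" and G: "ring 2 3 y 0 \<in> G" "ring 2 3 y 1 \<in> G"
  shows "equi (1, y) (0, 2) (0, 2) (0, 0)"
proof -
  \<comment> \<open>The word has cycle type 7 + 3 + 2 + 2; the exponent 14 kills everything but the
    three-cycle.\<close>
  define w where "w = ring 2 3 y 0 \<circ> ring 2 3 y 0 \<circ> ring 2 3 y 1 ^^ 4"
  define P :: "cell set" where "P = {(0, 1), (0, y), (3, 0), (1, 2), (3, 1), (1, 1), (3, 2), (2, 1), (1, 0),
    (1, y), (0, 0), (0, 2), (2, 0), (2, 2 :: int)}"
  have w: "w (0, 1) = (0, y)" "w (0, y) = (3, 0)" "w (3, 0) = (1, 2)" "w (1, 2) = (3, 1)"
    "w (3, 1) = (1, 1)" "w (1, 1) = (3, 2)" "w (3, 2) = (0, 1)" "w (2, 1) = (1, 0)" "w (1, 0) = (2, 1)"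
    "w (1, y) = (0, 0)" "w (0, 0) = (0, 2)" "w (0, 2) = (1, y)" "w (2, 0) = (2, 2)" "w (2, 2) = (2, 0)"
    using y by (simp_all add: w_def ring_def eval_nat_numeral)
  have w0: "w z = z" if "z \<notin> P" for z
  proof -
    have "ring 2 3 y 0 z = z" "ring 2 3 y 1 z = z"
      using that y by (cases z; simp add: ring_def P_def; smt (verit))+
    then show ?thesis by (simp add: w_def ring_power_fixed)
  qed
  have "w ^^ 14 = transpose (1, y) (0, 2) \<circ> transpose (0, 2) (0, 0)"
  proof (rule funpow_eqI)
    show "(w ^^ 14) z = (transpose (1, y) (0, 2) \<circ> transpose (0, 2) (0, 0)) z" if "z \<in> P" for z
      using that unfolding P_def
      by (elim insertE emptyE) (use y in \<open>simp_all add: w eval_nat_numeral\<close>)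
  qed (use w0 in \<open>auto simp: P_def\<close>)
  moreover have "w \<in> G" using G by (auto simp: w_def intro!: comp_mem power_mem)
  ultimately show ?thesis by (intro equi_sameI[of w 14])
qed

text \<open>Three rings suffice here. The quotient of rings \<open>1\<close> and \<open>2\<close>,
  conjugated by ring \<open>1\<close>, is a double transposition whose product with the five-cycle
  ring \<open>0\<close> has cycle type 3 + 2 + 2.\<close>

lemma three_cycle_2_1:
  assumes y: "1 \<le> y" and G: "ring 2 1 y 0 \<in> G" "ring 2 1 y 1 \<in> G" "ring 2 1 y 2 \<in> G"
  shows "equi (1, 0) (2, 0) (2, 0) (1, y)"
proof -
  have d: "transpose (1, y) (4, 0) \<circ> transpose (2, 0) (1, 0) \<in> G"
    using ring_step_height_1_mem[of 2 y 1] assms by simp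
  have b: "bij (ring 2 1 y 1)" using G bij_mem by blast
  have "ring 2 1 y 1 (1, y) = (3, 0)" "ring 2 1 y 1 (4, 0) = (4, 0)" "ring 2 1 y 1 (2, 0) = (1, 0)"
    "ring 2 1 y 1 (1, 0) = (0, y)" using y by (simp_all add: ring_def)
  then have "ring 2 1 y 1 \<circ> (transpose (1, y) (4, 0) \<circ> transpose (2, 0) (1, 0)) \<circ> inv (ring 2 1 y 1)
    = transpose (3, 0) (4, 0) \<circ> transpose (1, 0) (0, y)"
    by (simp only: conj_comp[OF b] conj_transpose[OF b])
  then have d': "transpose (3, 0) (4, 0) \<circ> transpose (1, 0) (0, y) \<in> G"
    using conj_mem[OF G(2) d] by simp
  define w where "w = ring 2 1 y 0 \<circ> (transpose (3, 0) (4, 0) \<circ> transpose (1, 0) (0, y))"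
  define P :: "cell set" where "P = {(0, y), (0, 0), (1, 0), (1, y), (2, 0), (3, 0), (4, 0 :: int)}"
  have w: "w (0, y) = (0, 0)" "w (0, 0) = (0, y)" "w (1, 0) = (1, y)" "w (1, y) = (2, 0)"
    "w (2, 0) = (1, 0)" "w (3, 0) = (4, 0)" "w (4, 0) = (3, 0)"
    using y by (simp_all add: w_def ring_def)
  have w0: "w z = z" if "z \<notin> P" for z
  proof -
    have "ring 2 1 y 0 z = z" using that y by (cases z; simp add: ring_def P_def; smt (verit))+
    then show ?thesis using that by (auto simp: w_def P_def)
  qed
  have "w ^^ 2 = transpose (1, 0) (2, 0) \<circ> transpose (2, 0) (1, y)"
  proof (rule funpow_eqI)
    show "(w ^^ 2) z = (transpose (1, 0) (2, 0) \<circ> transpose (2, 0) (1, y)) z" if "z \<in> P" for z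
      using that unfolding P_def
      by (elim insertE emptyE) (use y in \<open>simp_all add: w eval_nat_numeral\<close>)
  qed (use w0 in \<open>auto simp: P_def\<close>)
  moreover have "w \<in> G" using G d' by (auto simp: w_def intro!: comp_mem)
  ultimately show ?thesis by (intro equi_sameI[of w 2])
qed

lemma three_cycle_1_1:
  assumes y: "1 \<le> y" and G: "ring 1 1 y 0 \<in> G"
  shows "equi (0, 0) (0, y) (0, y) (1, 0)"
proof -
  have "ring 1 1 y 0 = transpose (0, 0) (0, y) \<circ> transpose (0, y) (1, 0)"
    (is "?L = ?R")
  proof (rule ext, clarify)
    fix i j :: int
    consider "j = y" "i = 0" | "j = y" "i \<noteq> 0" | "j = 0" "i = 0" | "j = 0" "i = 1"
      | "j = 0" "i \<noteq> 0" "i \<noteq> 1" | "j \<noteq> y" "j \<noteq> 0" by metis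
    then show "?L (i, j) = ?R (i, j)"
      by cases (use y in \<open>simp_all add: ring_def\<close>)
  qed
  then show ?thesis using G by (simp add: equi_def)
qed

text \<open>The number \<open>c\<close> counts the available rings. The last two conclusions serve
  the block argument: a point of the three-cycle fixed by ring \<open>k\<close> makes a block
  containing the three-cycle invariant under that ring, and a point moved by it then brings the
  whole ring into the block.\<close>

lemma ex_three_cycle:
  assumes ab: "1 \<le> a" "1 \<le> b" "b \<le> y" "2 \<le> c" and abc: "2 \<le> b \<or> a = 1 \<or> 4 \<le> c"
    and G: "\<And>k. 0 \<le> k \<Longrightarrow> k < c \<Longrightarrow> ring a b y k \<in> G"
  obtains p q r k where "distinct [p, q, r]" "equi p q q r" "0 \<le> k" "k < c"
    "\<exists>s\<in>{p, q, r}. ring a b y k s \<noteq> s" "\<exists>s\<in>{p, q, r}. ring a b y k s = s"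
proof -
  have G01: "ring a b y 0 \<in> G" "ring a b y 1 \<in> G" using G ab by auto
  consider "a = 1" "b = 1" | "a = 1" "b = 2" | "a = 1" "3 \<le> b" | "a = 2" "b = 2" | "a = 2" "b = 3"
    | "a = 2" "4 \<le> b" | "3 \<le> a" "2 \<le> b" | "a = 2" "b = 1" "4 \<le> c" | "3 \<le> a" "b = 1" "4 \<le> c"
    using ab abc by (smt (verit))
  then show ?thesis
  proof cases
    case 1
    then show ?thesis
      using that[of "(0, 0)" "(0, y)" "(1, 0)" 1] three_cycle_1_1[of y] G01 ab by (simp add: ring_def)
  next
    case 2
    then show ?thesis
      using that[of "(1, 0)" "(2, 1)" "(2, 0)" 0] three_cycle_1_2[of y] G01 ab by (simp add: ring_def)
  next
    case 3
    then show ?thesis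
      using that[of "(1, b - 2)" "(2, b - 1)" "(0, y)" 0] three_cycle_width_1[of b y] G01 ab by (simp add: ring_def)
  next
    case 4
    then show ?thesis
      using that[of "(2, 1)" "(1, 0)" "(1, 1)" 0] three_cycle_2_2[of y] G01 ab by (simp add: ring_def)
  next
    case 5
    then show ?thesis
      using that[of "(1, y)" "(0, 2)" "(0, 0)" 1] three_cycle_2_3[of y] G01 ab by (simp add: ring_def)
  next
    case 6
    then show ?thesis
      using that[of "(0, 1)" "(0, y)" "(1, b - 1)" 0] three_cycle_width_2[of b y] G01 ab by (simp add: ring_def)
  next
    case 7
    then show ?thesis
      using that[of "(a - 2, y)" "(a - 1, y)" "(a, b - 1)" 1] three_cycle_large[of a b y] G01 ab by (simp add: ring_def)
  next
    case 8
    then show ?thesis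
      using that[of "(1, 0)" "(2, 0)" "(1, y)" 3] three_cycle_2_1[of y] G01 G[of 2] ab by (simp add: ring_def)
  next
    case 9
    then show ?thesis
      using that[of "(a + 3, 0)" "(a - 1, y)" "(a + 1, 0)" 0] three_cycle_height_1[of a y] G ab by (simp add: ring_def)
  qed
qed

lemma alternates_on_triple:
  assumes "distinct [p, q, r]" "equi p q q r"
  shows "alternates_on {p, q, r}"
proof -
  define s where "s = transpose p q \<circ> transpose q r"
  have s: "s \<in> G" using assms by (simp add: s_def equi_def)
  have "s p = q" "s q = r" "s r = p" using assms by (auto simp: s_def transpose_def)
  then have 2: "equi q r r p" using equi_conj[OF assms(2) s] by simp
  have *: "equi a b p q" if "a \<in> {p, q, r}" "b \<in> {p, q, r}" "a \<noteq> b" for a b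
    using that assms(2) 2 equi_refl[of p q] equi_sym equi_trans equi_commute by (metis insert_iff singletonD)
  show ?thesis unfolding alternates_on_def
    by (intro ballI impI) (rule equi_trans[OF * equi_sym[OF *]])
qed

end

subsection \<open>Pushes as row shifts\<close>

text \<open>A whole push in closed form: in each row the unbroken run from column \<open>0\<close>
  stays, and everything beyond the first gap moves by one cell.\<close>

definition shift_left :: "'l config \<Rightarrow> 'l config" where
  "shift_left E = (\<lambda>(x, y). if \<forall>i\<in>{0..x}. E (i, y) \<noteq> None then E (x, y) else E (x + 1, y))"

text \<open>The run that stays is anchored at the right side of the bounding box, hence the
  parameter \<open>a\<close>.\<close>

definition shift_right :: "int \<Rightarrow> 'l config \<Rightarrow> 'l config" where
  "shift_right a E = (\<lambda>(x, y). if \<forall>i\<in>{x..a - 1}. E (i, y) \<noteq> None then E (x, y) else E (x - 1, y))"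

definition shifted :: "cell \<Rightarrow> 'l config \<Rightarrow> 'l config" where
  "shifted v E = (\<lambda>p. E (p - v))"

definition boxed :: "int \<Rightarrow> int \<Rightarrow> 'l config \<Rightarrow> bool" where
  "boxed a b E \<longleftrightarrow> dom E \<subseteq> {0..<a} \<times> {0..<b} \<and> (\<exists>y. (0, y) \<in> dom E) \<and> (\<exists>y. (a - 1, y) \<in> dom E)
    \<and> (\<exists>x. (x, 0) \<in> dom E) \<and> (\<exists>x. (x, b - 1) \<in> dom E)"

text \<open>Loop invariant after columns up to \<open>n\<close>: those left of \<open>n\<close> are
  final, column \<open>n\<close> keeps only tokens with no gap to their left, and later columns are
  untouched.\<close>

lemma fold_move_col_left:
  assumes "\<And>x y. x < 0 \<Longrightarrow> E (x, y) = None"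
  shows "fold move_col_left [1..int n] E = (\<lambda>(x, y).
    if x < int n then shift_left E (x, y)
    else if x = int n \<and> \<not> (\<forall>i\<in>{0..x}. E (i, y) \<noteq> None) then None else E (x, y))"
proof (induction n)
  case 0
  show ?case
    using assms by (auto simp: fun_eq_iff shift_left_def)
next
  case (Suc n)
  have split: "(\<forall>i\<in>{0..int n + 1}. E (i, y) \<noteq> None) \<longleftrightarrow> (\<forall>i\<in>{0..int n}. E (i, y) \<noteq> None) \<and> E (int n + 1, y) \<noteq> None" for y
  proof -
    have "{0..int n + 1} = insert (int n + 1) {0..int n}" by auto
    then show ?thesis by auto
  qed
  have "[1..int (Suc n)] = [1..int n] @ [int n + 1]"
    using upto_rec2[of 1 "int (Suc n)"] by simp
  then have *: "fold move_col_left [1..int (Suc n)] E = move_col_left (int n + 1) (fold move_col_left [1..int n] E)"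
    by simp
  show ?case unfolding * Suc.IH
  proof (rule ext, clarify)
    fix x y :: int
    consider "x < int n" | "x = int n" | "x = int n + 1" | "x > int n + 1" by linarith
    then show "move_col_left (int n + 1) (\<lambda>(x, y). if x < int n then shift_left E (x, y)
       else if x = int n \<and> \<not> (\<forall>i\<in>{0..x}. E (i, y) \<noteq> None) then None else E (x, y)) (x, y) =
      (if x < int (Suc n) then shift_left E (x, y)
       else if x = int (Suc n) \<and> \<not> (\<forall>i\<in>{0..x}. E (i, y) \<noteq> None) then None else E (x, y))"
    proof cases
      case 2
      then show ?thesis
      proof (cases "\<forall>i\<in>{0..int n}. E (i, y) \<noteq> None")
        case True
        then obtain l where "E (int n, y) = Some l" by force
        then show ?thesis using True 2 by (auto simp: move_col_left_def shift_left_def)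
      qed (auto simp: move_col_left_def shift_left_def)
    next
      case 3
      show ?thesis
      proof (cases "\<forall>i\<in>{0..int n}. E (i, y) \<noteq> None")
        case True
        then obtain l where "E (int n, y) = Some l" by force
        then show ?thesis
          using True 3 by (auto simp: move_col_left_def split[simplified])
      next
        case False
        then show ?thesis
          using 3 by (simp add: move_col_left_def split[simplified])
      qed
    qed (auto simp: move_col_left_def shift_left_def)
  qed
qed

lemma boxed_out: "boxed a b E \<Longrightarrow> \<not> (0 \<le> x \<and> x < a \<and> 0 \<le> y \<and> y < b) \<Longrightarrow> E (x, y) = None"
  by (force simp: boxed_def)

lemma boxed_finite: "boxed a b E \<Longrightarrow> finite (dom E)"
  by (auto simp: boxed_def intro: finite_subset)

lemma dom_shifted: "dom (shifted v E) = translate v (dom E)"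
proof -
  have "p \<in> translate v (dom E)" if "E (p - v) = Some l" for p l
    using that by (auto simp: translate_def intro!: image_eqI[of _ _ "p - v"])
  then show ?thesis by (auto simp: shifted_def translate_def)
qed

lemma normalize_shifted:
  assumes "boxed a b E"
  shows "normalize (shifted v E) = E"
proof -
  have fin: "finite (dom (shifted v E))"
    using boxed_finite[OF assms] by (simp add: dom_shifted translate_def)
  have 1: "Min (fst ` dom (shifted v E)) = fst v"
  proof (rule Min_eqI)
    show "fst v \<in> fst ` dom (shifted v E)"
      using assms unfolding boxed_def dom_shifted translate_def by (force intro: rev_image_eqI)
  qed (use fin assms in \<open>auto simp: dom_shifted translate_def boxed_def\<close>)
  have 2: "Min (snd ` dom (shifted v E)) = snd v"
  proof (rule Min_eqI)
    show "snd v \<in> snd ` dom (shifted v E)"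
      using assms unfolding boxed_def dom_shifted translate_def by (force intro: rev_image_eqI)
  qed (use fin assms in \<open>auto simp: dom_shifted translate_def boxed_def\<close>)
  show ?thesis unfolding normalize_def 1 2 by (auto simp: shifted_def)
qed

lemma shifted_0 [simp]: "shifted 0 E = E"
  by (simp add: shifted_def)

lemma push_left_shifted:
  assumes "boxed a b E"
  shows "push_left (shifted v E) = shift_left E"
proof -
  have fin: "finite (dom E)" using assms by (rule boxed_finite)
  have max: "Max (fst ` dom E) = a - 1"
  proof (rule Max_eqI)
    show "a - 1 \<in> fst ` dom E" using assms unfolding boxed_def by force
  qed (use fin assms in \<open>auto simp: boxed_def\<close>)
  have a: "1 \<le> a" using assms by (auto simp: boxed_def)
  have "push_left (shifted v E) = fold move_col_left [1..int (nat (a - 1))] E"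
    using a by (simp add: push_left_def normalize_shifted[OF assms] max)
  also have "\<dots> = shift_left E"
  proof (subst fold_move_col_left)
    show "E (x, y) = None" if "x < 0" for x y using boxed_out[OF assms] that by simp
    have "E (x, y) = None" if "a - 1 < x" for x y using boxed_out[OF assms] that by simp
    then show "(\<lambda>(x, y). if x < int (nat (a - 1)) then shift_left E (x, y)
       else if x = int (nat (a - 1)) \<and> \<not> (\<forall>i\<in>{0..x}. E (i, y) \<noteq> None) then None else E (x, y)) = shift_left E"
      using a by (auto simp: fun_eq_iff shift_left_def)
  qed
  finally show ?thesis .
qed

lemma boxed_mirror: "boxed a b E \<Longrightarrow> boxed a b (\<lambda>(x, y). E (a - 1 - x, y))"
proof -
  assume E: "boxed a b E"
  obtain y0 y1 x0 x1 where *: "(0, y0) \<in> dom E" "(a - 1, y1) \<in> dom E" "(x0, 0) \<in> dom E" "(x1, b - 1) \<in> dom E"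
    using E unfolding boxed_def by blast
  have "\<exists>x. E (a - 1 - x, y) \<noteq> None" if "(x', y) \<in> dom E" for x' y
    using that by (intro exI[of _ "a - 1 - x'"]) (auto simp: dom_def)
  then show ?thesis using E * unfolding boxed_def
    by (auto simp: dom_def split: prod.splits)
qed

lemma push_right_shifted:
  assumes "boxed a b E"
  shows "\<exists>v'. push_right (shifted v E) = shifted v' (shift_right a E)"
proof -
  let ?E = "\<lambda>(x, y). E (a - 1 - x, y)"
  have "shifted v E \<circ> mirror = shifted (1 - a - fst v, snd v) ?E"
    by (cases v) (auto simp: shifted_def mirror_def fun_eq_iff intro!: arg_cong[of _ _ E])
  then have "push_right (shifted v E) = shift_left ?E \<circ> mirror"
    by (simp add: push_right_def push_left_shifted[OF boxed_mirror[OF assms]])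
  also have "\<dots> = shifted (1 - a, 0) (shift_right a E)"
  proof (rule ext, clarify)
    fix x y :: int
    have "(\<forall>i\<in>{0..- x}. E (a - 1 - i, y) \<noteq> None) \<longleftrightarrow> (\<forall>i\<in>{x + a - 1..a - 1}. E (i, y) \<noteq> None)"
    proof
      assume L: "\<forall>i\<in>{0..- x}. E (a - 1 - i, y) \<noteq> None"
      show "\<forall>i\<in>{x + a - 1..a - 1}. E (i, y) \<noteq> None"
      proof
        fix i assume "i \<in> {x + a - 1..a - 1}"
        then show "E (i, y) \<noteq> None" using L[rule_format, of "a - 1 - i"] by simp
      qed
    next
      assume R: "\<forall>i\<in>{x + a - 1..a - 1}. E (i, y) \<noteq> None"
      show "\<forall>i\<in>{0..- x}. E (a - 1 - i, y) \<noteq> None" using R by auto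
    qed
    then show "(shift_left ?E \<circ> mirror) (x, y) = shifted (1 - a, 0) (shift_right a E) (x, y)"
      by (auto simp: shift_left_def mirror_def shifted_def shift_right_def algebra_simps)
  qed
  finally show ?thesis by blast
qed

subsection \<open>Configurations reachable from a diagram\<close>

text \<open>Moving the columns in \<open>A\<close> to the left, later columns outermost, puts column \<open>x\<close> at \<open>pos A x\<close>;
  the tokens of row \<open>y\<close> then start at \<open>off S A y\<close>.\<close>

definition pos :: "int set \<Rightarrow> int \<Rightarrow> int" where
  "pos A x = (if x \<in> A then 0 else x) + int (card {z \<in> A. x < z})"

definition off :: "cell set \<Rightarrow> int set \<Rightarrow> int \<Rightarrow> int" where
  "off S A y = int (card {x \<in> A. (x, y) \<notin> S})"

definition len :: "cell set \<Rightarrow> int \<Rightarrow> int" where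
  "len S y = int (card {x. (x, y) \<in> S})"

text \<open>Rows move rigidly, so \<open>row_map\<close> sends the column in which a token of row \<open>y\<close> lies to the
  rank of that token within its row.\<close>

definition row_map :: "cell set \<Rightarrow> int set \<Rightarrow> cell \<Rightarrow> cell" where
  "row_map S A = (\<lambda>(x, y). if (x, y) \<in> S then (pos A x - off S A y, y) else (x, y))"

text \<open>The labels \<open>f\<close> are indexed by original columns and rows; the inverse
  positions translate an actual cell into these names.\<close>

definition place :: "int \<Rightarrow> int \<Rightarrow> int set \<Rightarrow> int set \<Rightarrow> 'l config \<Rightarrow> 'l config" where
  "place a b A B f = (\<lambda>(p, q). if p \<in> {0..<a} \<and> q \<in> {0..<b}
     then f (inv_into {0..<a} (pos A) p, inv_into {0..<b} (pos B) q) else None)"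

text \<open>The largest moved column lies outermost and is the first to return under a left push.
  The empty set stays empty whatever \<open>Max\<close> yields on it.\<close>

definition drop_max :: "int set \<Rightarrow> int set" where
  "drop_max A = A - {Max A}"

text \<open>The largest column not yet moved is the next one that a right push brings to the left
  end.\<close>

definition add_max :: "int set \<Rightarrow> int set \<Rightarrow> int set" where
  "add_max J A = (if J - A = {} then A else insert (Max (J - A)) A)"

section \<open>Positions of moved columns\<close>

lemma pos_less:
  assumes "finite A" "0 \<le> x" "0 \<le> x'"
    and "x \<in> A \<and> x' \<notin> A \<or> x' < x \<and> x \<in> A \<and> x' \<in> A \<or> x < x' \<and> x \<notin> A \<and> x' \<notin> A"
  shows "pos A x < pos A x'"
proof -
  have fin: "finite {z \<in> A. P z}" for P using assms(1) by simp
  consider "x' < x" "x \<in> A" | "x < x'" "x' \<notin> A" using assms by force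
  then show ?thesis
  proof cases
    case 1
    have "{z \<in> A. x < z} \<subset> {z \<in> A. x' < z}" using 1 by force
    then have "card {z \<in> A. x < z} < card {z \<in> A. x' < z}"
      by (intro psubset_card_mono fin)
    then show ?thesis using 1 assms by (auto simp: pos_def)
  next
    case 2
    have "{z \<in> A. x < z} \<subseteq> {x<..<x'} \<union> {z \<in> A. x' < z}" using 2 by (auto simp: not_less order_le_less)
    then have "card {z \<in> A. x < z} \<le> card ({x<..<x'} \<union> {z \<in> A. x' < z})"
      by (intro card_mono) (auto simp: fin)
    also have "\<dots> \<le> card {x<..<x'} + card {z \<in> A. x' < z}" by (rule card_Un_le)
    finally have "int (card {z \<in> A. x < z}) \<le> x' - x - 1 + int (card {z \<in> A. x' < z})" using 2 by simp
    then show ?thesis using 2 assms by (auto simp: pos_def)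
  qed
qed

lemma pos_eq_iff:
  assumes "finite A" "0 \<le> x" "0 \<le> x'"
  shows "pos A x = pos A x' \<longleftrightarrow> x = x'"
  using pos_less[OF assms] pos_less[OF assms(1,3,2)] by (metis linorder_neq_iff less_irrefl)

text \<open>This keeps rows contiguous: the cells of a row of length \<open>l\<close> land in
  \<open>l\<close> consecutive places, and they start at the number of moved columns that the row
  does not reach.\<close>

lemma pos_interval:
  assumes "finite A" "0 \<le> x" "x < l"
  shows "pos A x - int (card {z \<in> A. l \<le> z}) \<in> {0..<l}"
proof -
  have "{z \<in> A. x < z} = (A \<inter> {x<..<l}) \<union> {z \<in> A. l \<le> z}" using assms by auto
  also have "card \<dots> = card (A \<inter> {x<..<l}) + card {z \<in> A. l \<le> z}"
    by (rule card_Un_disjoint) (use assms in auto)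
  finally have 1: "card {z \<in> A. x < z} = card (A \<inter> {x<..<l}) + card {z \<in> A. l \<le> z}" .
  have "card (A \<inter> {x<..<l}) \<le> card {x<..<l}" by (rule card_mono) auto
  then have "int (card (A \<inter> {x<..<l})) < l - x" using assms by simp
  then show ?thesis using assms(2) by (simp add: pos_def 1)
qed

lemma pos_empty [simp]: "pos {} x = x"
  by (simp add: pos_def)

lemma bij_betw_pos:
  assumes "A \<subseteq> {0..<a}"
  shows "bij_betw (pos A) {0..<a} {0..<a}"
proof -
  have fin: "finite A" using assms finite_subset by blast
  have "inj_on (pos A) {0..<a}" using pos_eq_iff[OF fin] by (auto simp: inj_on_def)
  moreover have "pos A ` {0..<a} \<subseteq> {0..<a}"
  proof -
    have e: "{z \<in> A. a \<le> z} = {}" using assms by auto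
    show ?thesis
    proof
      fix p assume "p \<in> pos A ` {0..<a}"
      then obtain x where "0 \<le> x" "x < a" "p = pos A x" by auto
      then show "p \<in> {0..<a}" using pos_interval[OF fin, of x a] unfolding e by simp
    qed
  qed
  ultimately show ?thesis
    by (simp add: bij_betw_def endo_inj_surj)
qed

lemma ex_pos_eq:
  assumes "A \<subseteq> {0..<a}" "p \<in> {0..<a}"
  obtains x where "x \<in> {0..<a}" "p = pos A x"
proof -
  have "p \<in> pos A ` {0..<a}" using bij_betw_pos[OF assms(1)] assms(2) by (simp add: bij_betw_def)
  then show ?thesis using that by blast
qed

lemma place_pos:
  assumes "A \<subseteq> {0..<a}" "B \<subseteq> {0..<b}" "x \<in> {0..<a}" "y \<in> {0..<b}"
  shows "place a b A B f (pos A x, pos B y) = f (x, y)"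
proof -
  have "pos A x \<in> {0..<a}" "pos B y \<in> {0..<b}"
    using bij_betw_pos[OF assms(1)] bij_betw_pos[OF assms(2)] assms(3,4) by (auto simp: bij_betw_def)
  then show ?thesis
    using bij_betw_pos[OF assms(1)] bij_betw_pos[OF assms(2)] assms(3,4)
    by (simp add: place_def bij_betw_def)
qed

lemma place_outside: "\<not> (p \<in> {0..<a} \<and> q \<in> {0..<b}) \<Longrightarrow> place a b A B f (p, q) = None"
  by (auto simp: place_def)

lemma place_swap: "place a b A B f \<circ> prod.swap = place b a B A (f \<circ> prod.swap)"
  by (auto simp: fun_eq_iff place_def)

lemma swap_image_iff: "(x, y) \<in> prod.swap ` S \<longleftrightarrow> (y, x) \<in> S"
  by force

text \<open>Here \<open>a'\<close> is the length of the top row and \<open>b'\<close> the height of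
  the last column: in a set closed to the left and downwards, a column is full as soon as it reaches
  row \<open>b - 1\<close>.\<close>

locale diagram =
  fixes S :: "cell set" and a b a' b' :: int
  assumes S_subset: "S \<subseteq> {0..<a} \<times> {0..<b}"
    and S_closed: "(x, y) \<in> S \<Longrightarrow> 0 \<le> x' \<Longrightarrow> x' \<le> x \<Longrightarrow> 0 \<le> y' \<Longrightarrow> y' \<le> y \<Longrightarrow> (x', y') \<in> S"
    and S_corner: "(a - 1, 0) \<in> S" "(0, b - 1) \<in> S"
    and S_full_col: "0 \<le> x \<Longrightarrow> (x, b - 1) \<in> S \<longleftrightarrow> x < a'"
    and S_full_row: "0 \<le> y \<Longrightarrow> (a - 1, y) \<in> S \<longleftrightarrow> y < b'"
begin

abbreviation "J \<equiv> {a'..<a}"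

abbreviation "J' \<equiv> {b'..<b}"

text \<open>Through this transposition every result on rows yields the one on columns.\<close>

lemma swap_diagram: "diagram (prod.swap ` S) b a b' a'"
proof
  show "prod.swap ` S \<subseteq> {0..<b} \<times> {0..<a}" using S_subset by auto
  show "(x, y) \<in> prod.swap ` S \<Longrightarrow> 0 \<le> x' \<Longrightarrow> x' \<le> x \<Longrightarrow> 0 \<le> y' \<Longrightarrow> y' \<le> y \<Longrightarrow> (x', y') \<in> prod.swap ` S" for x y x' y'
    using S_closed[of y x y' x'] by (simp add: swap_image_iff)
  show "(b - 1, 0) \<in> prod.swap ` S" "(0, a - 1) \<in> prod.swap ` S" using S_corner by (simp_all add: swap_image_iff)
  show "0 \<le> x \<Longrightarrow> (x, a - 1) \<in> prod.swap ` S \<longleftrightarrow> x < b'" for x using S_full_row[of x] by (simp add: swap_image_iff)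
  show "0 \<le> y \<Longrightarrow> (b - 1, y) \<in> prod.swap ` S \<longleftrightarrow> y < a'" for y using S_full_col[of y] by (simp add: swap_image_iff)
qed

lemma finite_S: "finite S"
  using S_subset by (rule finite_subset) auto

lemma S_bounds: "(x, y) \<in> S \<Longrightarrow> 0 \<le> x \<and> x < a \<and> 0 \<le> y \<and> y < b"
  using S_subset by auto

lemma params: "1 \<le> a'" "1 \<le> b'" "a' \<le> a" "b' \<le> b"
proof -
  show "1 \<le> a'" "1 \<le> b'" using S_full_col[of 0] S_full_row[of 0] S_corner by auto
  show "a' \<le> a"
  proof (rule ccontr)
    assume "\<not> a' \<le> a"
    then have "(a, b - 1) \<in> S" using S_full_col[of a] S_bounds[OF S_corner(1)] by auto
    then show False using S_bounds by auto
  qed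
  show "b' \<le> b"
  proof (rule ccontr)
    assume "\<not> b' \<le> b"
    then have "(a - 1, b) \<in> S" using S_full_row[of b] S_bounds[OF S_corner(2)] by auto
    then show False using S_bounds by auto
  qed
qed

lemma full_col: "0 \<le> x \<Longrightarrow> x < a' \<Longrightarrow> 0 \<le> y \<Longrightarrow> y < b \<Longrightarrow> (x, y) \<in> S"
  using S_full_col[of x] S_closed[of x "b - 1" x y] by simp

lemma full_row: "0 \<le> x \<Longrightarrow> x < a \<Longrightarrow> 0 \<le> y \<Longrightarrow> y < b' \<Longrightarrow> (x, y) \<in> S"
  using S_full_row[of y] S_closed[of "a - 1" y x y] by simp

lemma S_iff: "(x, y) \<in> S \<longleftrightarrow> 0 \<le> x \<and> x < len S y" if "0 \<le> y"
proof -
  have fin: "finite {x. (x, y) \<in> S}"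
    by (rule finite_subset[of _ "{0..<a}"]) (use S_bounds in auto)
  have eq: "{x. (x, y) \<in> S} = {0..<len S y}"
  proof (cases "{x. (x, y) \<in> S} = {}")
    case True
    then show ?thesis by (simp add: len_def)
  next
    case False
    define m where "m = Max {x. (x, y) \<in> S}"
    have m: "m \<in> {x. (x, y) \<in> S}" unfolding m_def by (rule Max_in[OF fin False])
    have e: "{x. (x, y) \<in> S} = {0..m}"
    proof (intro equalityI subsetI)
      fix x assume x: "x \<in> {x. (x, y) \<in> S}"
      then show "x \<in> {0..m}" using Max_ge[OF fin x] S_bounds[of x y] by (simp add: m_def)
    next
      fix x assume "x \<in> {0..m}"
      then show "x \<in> {x. (x, y) \<in> S}" using S_closed[of m y x y] m that by simp
    qed
    have "0 \<le> m" using S_bounds[of m y] m by simp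
    then have l: "len S y = m + 1" unfolding len_def e by simp
    show ?thesis unfolding e l by auto
  qed
  have "(x, y) \<in> S \<longleftrightarrow> x \<in> {x. (x, y) \<in> S}" by simp
  also have "\<dots> \<longleftrightarrow> 0 \<le> x \<and> x < len S y" by (simp only: eq atLeastLessThan_iff)
  finally show ?thesis .
qed

lemma len_bounds: "a' \<le> len S y" "len S y \<le> a" if "0 \<le> y" "y < b"
proof -
  show "a' \<le> len S y" using full_col[of "a' - 1" y] S_iff[of y "a' - 1"] that params by auto
  show "len S y \<le> a" using S_iff[of y "len S y - 1"] S_bounds[of "len S y - 1" y] params
    \<open>a' \<le> len S y\<close> that by auto
qed

lemma off_eq: "off S A y = int (card {z \<in> A. len S y \<le> z})" if "0 \<le> y" "A \<subseteq> J"
proof -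
  have "{x \<in> A. (x, y) \<notin> S} = {z \<in> A. len S y \<le> z}"
    using S_iff[OF that(1)] that(2) params by auto
  then show ?thesis by (simp add: off_def)
qed

lemma off_le: "off S A y \<le> a - len S y" if "0 \<le> y" "y < b" "A \<subseteq> J"
proof -
  have "{z \<in> A. len S y \<le> z} \<subseteq> {len S y..<a}" using that by auto
  then have "card {z \<in> A. len S y \<le> z} \<le> card {len S y..<a}" by (intro card_mono) auto
  then show ?thesis using that off_eq[OF that(1,3)] len_bounds[of y] by simp
qed

lemma row_map_permutes: "row_map S A permutes S" if A: "A \<subseteq> J"
proof -
  have fin: "finite A" using A finite_subset by blast
  have into: "row_map S A c \<in> S" if "c \<in> S" for c
  proof -
    obtain x y where c: "c = (x, y)" by fastforce
    have "0 \<le> y" using S_bounds[of x y] that c by simp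
    moreover from this have "0 \<le> x" "x < len S y" using S_iff[of y x] that c by simp_all
    ultimately show ?thesis using pos_interval[OF fin, of x "len S y"] that c off_eq[OF _ A, of y] S_iff[of y]
      by (auto simp: row_map_def)
  qed
  have "inj_on (row_map S A) S"
    using S_bounds pos_eq_iff[OF fin] by (fastforce simp: inj_on_def row_map_def)
  then have "bij_betw (row_map S A) S S"
    using into endo_inj_surj[OF finite_S, of "row_map S A"] by (simp add: bij_betw_def image_subset_iff)
  then show ?thesis by (rule bij_imp_permutes) (auto simp: row_map_def)
qed

lemma row_map_empty [simp]: "row_map S {} = id"
  by (auto simp: row_map_def off_def fun_eq_iff)

lemma place_row:
  assumes A: "A \<subseteq> J" and B: "B \<subseteq> J'" and f: "dom f = S" and y: "0 \<le> y" "y < b"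
  shows "place a b A B f (p, pos B y) =
    (if 0 \<le> p - off S A y \<and> p - off S A y < len S y then f (inv (row_map S A) (p - off S A y, y)) else None)"
proof -
  have A0: "A \<subseteq> {0..<a}" and B0: "B \<subseteq> {0..<b}" using A B params by auto
  note perm = row_map_permutes[OF A]
  show ?thesis
  proof (cases "0 \<le> p - off S A y \<and> p - off S A y < len S y")
    case True
    then have "(p - off S A y, y) \<in> S" using S_iff[OF y(1)] by simp
    then have "inv (row_map S A) (p - off S A y, y) \<in> S"
      using permutes_in_image[OF permutes_inv[OF perm]] by blast
    then obtain x y' where x: "inv (row_map S A) (p - off S A y, y) = (x, y')" "(x, y') \<in> S"
      by (metis surj_pair)
    then have "(p - off S A y, y) = row_map S A (x, y')"
      using permutes_inverses(1)[OF perm] by metis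
    then have "y' = y" "p = pos A x" using x(2) by (auto simp: row_map_def)
    then show ?thesis using True x place_pos[OF A0 B0, of x y f] S_bounds[OF x(2)] by auto
  next
    case False
    have "place a b A B f (p, pos B y) = None"
    proof (cases "p \<in> {0..<a}")
      case True
      then obtain x where x: "x \<in> {0..<a}" "p = pos A x"
        by (rule ex_pos_eq[OF A0])
      have "(x, y) \<notin> S"
      proof
        assume s: "(x, y) \<in> S"
        then have "row_map S A (x, y) \<in> S" using permutes_in_image[OF perm] by blast
        then show False using s x False S_iff[OF y(1)] by (auto simp: row_map_def)
      qed
      then have "f (x, y) = None" using f by auto
      then show ?thesis using x place_pos[OF A0 B0, of x y f] y by auto
    next
      case False
      then show ?thesis by (intro place_outside) blast
    qed
    then show ?thesis using False by auto
  qed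
qed

lemma place_row_occupied:
  assumes "A \<subseteq> J" "B \<subseteq> J'" "dom f = S" "0 \<le> y" "y < b"
  shows "place a b A B f (p, pos B y) \<noteq> None \<longleftrightarrow> off S A y \<le> p \<and> p < off S A y + len S y"
proof -
  have "f (inv (row_map S A) (p - off S A y, y)) \<noteq> None" if "0 \<le> p - off S A y" "p - off S A y < len S y"
    using assms(3) permutes_in_image[OF permutes_inv[OF row_map_permutes[OF assms(1)]]] S_iff[OF assms(4)] that
    by blast
  then show ?thesis unfolding place_row[OF assms] by auto
qed

lemma pos_surj: "q \<in> {0..<b} \<Longrightarrow> B \<subseteq> J' \<Longrightarrow> \<exists>y. 0 \<le> y \<and> y < b \<and> q = pos B y"
  using params by (elim ex_pos_eq[of B b q, rotated]) auto

lemma dom_comp_permutes: "dom (f \<circ> g) = S" if "dom f = S" "g permutes S" for f :: "'l config"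
proof -
  have "dom (f \<circ> g) = g -` S" using that(1) by (auto simp: dom_def)
  then show ?thesis using permutes_vimage[OF that(2)] by simp
qed

text \<open>The relabelling is chosen so that each token keeps its rank within its row. Old and new
  row then differ by a translation, namely the change of the starting place
  \<open>off\<close>.\<close>

lemma place_change_rows:
  assumes A: "A \<subseteq> J" and A': "A' \<subseteq> J" and B: "B \<subseteq> J'" and f: "dom f = S"
    and y: "0 \<le> y" "y < b"
  shows "place a b A' B (f \<circ> inv (row_map S A) \<circ> row_map S A') (p, pos B y) =
    place a b A B f (p + off S A y - off S A' y, pos B y)"
proof -
  have d: "dom (f \<circ> inv (row_map S A) \<circ> row_map S A') = S"
    using A A' f by (intro dom_comp_permutes row_map_permutes permutes_inv) auto
  have "row_map S A' (inv (row_map S A') c) = c" for c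
    using permutes_inverses(1)[OF row_map_permutes[OF A']] .
  then show ?thesis
    by (simp add: place_row[OF A' B d y] place_row[OF A B f y])
qed

text \<open>The columns missing in a row are closed to the right. So if any column of
  \<open>A\<close> is missing there, \<open>Max A\<close> is: the rows that move are exactly those
  that begin with a gap.\<close>

lemma off_drop_max:
  assumes A: "A \<subseteq> J" and y: "0 \<le> y"
  shows "off S (drop_max A) y = (if off S A y = 0 then 0 else off S A y - 1)"
proof -
  have fin: "finite A" using A finite_subset by blast
  show ?thesis
  proof (cases "{x \<in> A. (x, y) \<notin> S} = {}")
    case True
    then have e: "{x \<in> drop_max A. (x, y) \<notin> S} = {}" by (auto simp: drop_max_def)
    show ?thesis unfolding off_def True e by simp
  next
    case False
    then obtain x where x: "x \<in> A" "(x, y) \<notin> S" by blast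
    have m: "Max A \<in> A" "x \<le> Max A" using fin x by (auto intro: Max_in)
    then have "(Max A, y) \<notin> S" using S_closed[of "Max A" y x y] x A y params by auto
    then have "{x \<in> drop_max A. (x, y) \<notin> S} = {x \<in> A. (x, y) \<notin> S} - {Max A}" "Max A \<in> {x \<in> A. (x, y) \<notin> S}"
      using m by (auto simp: drop_max_def)
    moreover have "card {x \<in> A. (x, y) \<notin> S} > 0" using False fin by (simp add: card_gt_0_iff)
    moreover have "card ({x \<in> A. (x, y) \<notin> S} - {Max A}) = card {x \<in> A. (x, y) \<notin> S} - 1"
      by (rule card_Diff_singleton) fact
    ultimately show ?thesis unfolding off_def by auto
  qed
qed

text \<open>Dually, the largest column outside \<open>A\<close> is missing in the row as soon as
  some column outside \<open>A\<close> is, which means that the row stops short of the right side of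
  the box.\<close>

lemma off_add_max:
  assumes A: "A \<subseteq> J" and y: "0 \<le> y" "y < b"
  shows "off S (add_max J A) y = (if off S A y + len S y < a then off S A y + 1 else off S A y)"
proof -
  have fin: "finite A" using A finite_subset by blast
  let ?J = "J - A"
  show ?thesis
  proof (cases "\<exists>x. len S y \<le> x \<and> x < a \<and> x \<notin> A")
    case True
    then obtain x where x: "len S y \<le> x" "x < a" "x \<notin> A" by blast
    then have xJ: "x \<in> ?J" using len_bounds[OF y] by auto
    have m: "Max ?J \<in> ?J" "x \<le> Max ?J"
      using xJ by (intro Max_in Max_ge; auto)+
    then have "(Max ?J, y) \<notin> S" using S_iff[OF y(1)] x by auto
    then have e: "{x \<in> add_max J A. (x, y) \<notin> S} = insert (Max ?J) {x \<in> A. (x, y) \<notin> S}"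
      using xJ by (auto simp: add_max_def)
    have "card {x \<in> add_max J A. (x, y) \<notin> S} = Suc (card {x \<in> A. (x, y) \<notin> S})"
      unfolding e using m fin by (intro card_insert_disjoint) auto
    moreover have "off S A y + len S y < a"
    proof -
      have "{z \<in> A. len S y \<le> z} \<subset> {len S y..<a}" using x A by auto
      then have "card {z \<in> A. len S y \<le> z} < card {len S y..<a}" by (intro psubset_card_mono) auto
      then show ?thesis using off_eq[OF y(1) A] x by simp
    qed
    ultimately show ?thesis by (simp add: off_def)
  next
    case False
    have "{z \<in> A. len S y \<le> z} = {len S y..<a}" using False A by auto
    then have eq: "off S A y + len S y = a" using off_eq[OF y(1) A] len_bounds[OF y] by simp
    have "{x \<in> add_max J A. (x, y) \<notin> S} = {x \<in> A. (x, y) \<notin> S}"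
    proof (cases "?J = {}")
      case True
      then show ?thesis by (simp add: add_max_def)
    next
      case ne: False
      then have "Max ?J \<in> ?J" by (intro Max_in) auto
      then have "Max ?J < len S y" "a' \<le> Max ?J" using False by (auto simp: not_le[symmetric])
      then have "(Max ?J, y) \<in> S" using S_iff[OF y(1)] params by auto
      then show ?thesis using ne by (auto simp: add_max_def)
    qed
    then show ?thesis using eq by (simp add: off_def)
  qed
qed

lemma drop_max_subset: "A \<subseteq> X \<Longrightarrow> drop_max A \<subseteq> X"
  by (auto simp: drop_max_def)

lemma add_max_subset: "A \<subseteq> J \<Longrightarrow> add_max J A \<subseteq> J"
proof -
  assume A: "A \<subseteq> J"
  show ?thesis
  proof (cases "J - A = {}")
    case False
    then have "Max (J - A) \<in> J - A" by (intro Max_in) auto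
    then show ?thesis using A by (auto simp: add_max_def)
  qed (use A in \<open>simp add: add_max_def\<close>)
qed

lemma shift_left_place:
  assumes A: "A \<subseteq> J" and B: "B \<subseteq> J'" and f: "dom f = S"
  shows "shift_left (place a b A B f) =
    place a b (drop_max A) B (f \<circ> inv (row_map S A) \<circ> row_map S (drop_max A))"
proof (rule ext, clarify)
  fix p q :: int
  let ?E = "place a b A B f"
  show "shift_left ?E (p, q) =
    place a b (drop_max A) B (f \<circ> inv (row_map S A) \<circ> row_map S (drop_max A)) (p, q)"
  proof (cases "q \<in> {0..<b}")
    case True
    then obtain y where y: "0 \<le> y" "y < b" "q = pos B y" using pos_surj B by blast
    have R: "place a b (drop_max A) B (f \<circ> inv (row_map S A) \<circ> row_map S (drop_max A)) (p, q) =
      ?E (p + off S A y - off S (drop_max A) y, q)"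
      unfolding y by (rule place_change_rows) (use A B f y drop_max_subset in auto)
    have row: "?E (r, q) \<noteq> None \<longleftrightarrow> off S A y \<le> r \<and> r < off S A y + len S y" for r
      unfolding y(3) by (rule place_row_occupied[OF A B f y(1,2)])
    have o: "off S A y \<ge> 0" by (simp add: off_def)
    have "shift_left ?E (p, q) = ?E (if off S A y = 0 then p else p + 1, q)"
    proof (cases "off S A y = 0")
      case True
      show ?thesis
      proof (cases "p < len S y")
        case t: True
        then have "\<forall>i\<in>{0..p}. ?E (i, q) \<noteq> None" using row True by auto
        then show ?thesis using True by (simp add: shift_left_def)
      next
        case False
        then have "?E (p, q) = None" "?E (p + 1, q) = None" using row[of p] row[of "p + 1"] True by auto
        then show ?thesis using True by (simp add: shift_left_def)
      qed
    next
      case False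
      then have 0: "?E (0, q) = None" using row[of 0] o by auto
      show ?thesis
      proof (cases "0 \<le> p")
        case True
        then have "\<not> (\<forall>i\<in>{0..p}. ?E (i, q) \<noteq> None)" using 0 by force
        then show ?thesis using False unfolding shift_left_def prod.case by (simp only: if_False if_True simp_thms)
      next
        case p: False
        then have "?E (p, q) = None" "?E (p + 1, q) = None" using row[of p] row[of "p + 1"] o False by auto
        then show ?thesis using False by (simp add: shift_left_def)
      qed
    qed
    then show ?thesis unfolding R off_drop_max[OF A y(1)] by auto
  next
    case False
    then show ?thesis by (simp add: shift_left_def place_outside)
  qed
qed

lemma shift_right_place:
  assumes A: "A \<subseteq> J" and B: "B \<subseteq> J'" and f: "dom f = S"
  defines "A' \<equiv> add_max J A"
  shows "shift_right a (place a b A B f) =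
    place a b A' B (f \<circ> inv (row_map S A) \<circ> row_map S A')"
proof (rule ext, clarify)
  fix p q :: int
  let ?E = "place a b A B f"
  have A': "A' \<subseteq> J" unfolding A'_def by (rule add_max_subset[OF A])
  show "shift_right a ?E (p, q) =
    place a b A' B (f \<circ> inv (row_map S A) \<circ> row_map S A') (p, q)"
  proof (cases "q \<in> {0..<b}")
    case True
    then obtain y where y: "0 \<le> y" "y < b" "q = pos B y" using pos_surj B by blast
    have R: "place a b A' B (f \<circ> inv (row_map S A) \<circ> row_map S A') (p, q) =
      ?E (p + off S A y - off S A' y, q)"
      unfolding y by (rule place_change_rows) (use A A' B f y in auto)
    have row: "?E (r, q) \<noteq> None \<longleftrightarrow> off S A y \<le> r \<and> r < off S A y + len S y" for r
      unfolding y(3) by (rule place_row_occupied[OF A B f y(1,2)])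
    have o: "off S A y + len S y \<le> a" using off_le[OF y(1,2) A] by simp
    have "shift_right a ?E (p, q) = ?E (if off S A y + len S y < a then p - 1 else p, q)"
    proof (cases "off S A y + len S y < a")
      case False
      show ?thesis
      proof (cases "off S A y \<le> p")
        case t: True
        then have "\<forall>i\<in>{p..a - 1}. ?E (i, q) \<noteq> None" using row False o by auto
        then show ?thesis using False by (simp add: shift_right_def)
      next
        case f: False
        then have "?E (p, q) = None" "?E (p - 1, q) = None" using row[of p] row[of "p - 1"] by auto
        then show ?thesis using False by (simp add: shift_right_def)
      qed
    next
      case True
      then have 0: "?E (a - 1, q) = None" using row[of "a - 1"] by auto
      show ?thesis
      proof (cases "p \<le> a - 1")
        case p: True
        then have "\<not> (\<forall>i\<in>{p..a - 1}. ?E (i, q) \<noteq> None)" using 0 by force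
        then show ?thesis using True unfolding shift_right_def prod.case by (simp only: if_False if_True simp_thms)
      next
        case p: False
        then have "?E (p, q) = None" "?E (p - 1, q) = None" using row[of p] row[of "p - 1"] True by auto
        then show ?thesis using True by (simp add: shift_right_def)
      qed
    qed
    then show ?thesis unfolding R unfolding A'_def off_add_max[OF A y(1,2)] by auto
  next
    case False
    then show ?thesis by (simp add: shift_right_def place_outside)
  qed
qed

lemma boxed_place:
  assumes A: "A \<subseteq> J" and B: "B \<subseteq> J'" and f: "dom f = S"
  shows "boxed a b (place a b A B f)"
proof -
  have A0: "A \<subseteq> {0..<a}" and B0: "B \<subseteq> {0..<b}" using A B params by auto
  have ab: "0 < a" "0 < b" using S_bounds[OF S_corner(1)] by auto
  have d: "(pos A x, pos B y) \<in> dom (place a b A B f)" if "(x, y) \<in> S" for x y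
    using place_pos[OF A0 B0, of x y f] that S_bounds[OF that] f by (auto simp: dom_def)
  have X: "\<exists>x. 0 \<le> x \<and> x < a \<and> p = pos A x" if "0 \<le> p" "p < a" for p
    by (rule ex_pos_eq[OF A0, of p]) (use that in auto)
  have Y: "\<exists>x. 0 \<le> x \<and> x < b \<and> p = pos B x" if "0 \<le> p" "p < b" for p
    using pos_surj[OF _ B, of p] that by simp
  have col: "\<exists>q. (p, q) \<in> dom (place a b A B f)" if p: "0 \<le> p" "p < a" for p
  proof -
    obtain x where x: "0 \<le> x" "x < a" "p = pos A x" using X[OF p] by blast
    then show ?thesis using d[OF full_row[of x 0]] params by auto
  qed
  have row: "\<exists>p. (p, q) \<in> dom (place a b A B f)" if q: "0 \<le> q" "q < b" for q
  proof -
    obtain y where y: "0 \<le> y" "y < b" "q = pos B y" using Y[OF q] by blast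
    then show ?thesis using d[OF full_col[of 0 y]] params by auto
  qed
  have "dom (place a b A B f) \<subseteq> {0..<a} \<times> {0..<b}"
    by (auto simp: place_def split: if_splits)
  then show ?thesis using col[of 0] col[of "a - 1"] row[of 0] row[of "b - 1"] ab
    unfolding boxed_def by auto
qed

end

section \<open>Pushes as transitions between states\<close>

context diagram
begin

definition col_map :: "int set \<Rightarrow> cell \<Rightarrow> cell" where
  "col_map B = prod.swap \<circ> row_map (prod.swap ` S) B \<circ> prod.swap"

lemma swap_comp_swap: "prod.swap \<circ> (prod.swap \<circ> f) = f" "f \<circ> prod.swap \<circ> prod.swap = f"
  by (simp_all add: fun_eq_iff)

lemma permutes_swap: "prod.swap \<circ> f \<circ> prod.swap permutes S" if "f permutes prod.swap ` S"
  unfolding permutes_def bij_iff[symmetric]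
proof (intro conjI allI impI)
  show "bij (prod.swap \<circ> f \<circ> prod.swap)"
    by (intro bij_comp permutes_bij[OF that] bij_swap)
  fix c assume "c \<notin> S"
  then show "(prod.swap \<circ> f \<circ> prod.swap) c = c"
    using permutes_not_in[OF that, of "prod.swap c"] by (cases c) (simp add: swap_image_iff)
qed

lemma col_map_permutes: "col_map B permutes S" if "B \<subseteq> J'"
  unfolding col_map_def by (intro permutes_swap diagram.row_map_permutes[OF swap_diagram] that)

lemma inv_col_map: "inv (col_map B) = prod.swap \<circ> inv (row_map (prod.swap ` S) B) \<circ> prod.swap" if "B \<subseteq> J'"
proof (rule inv_unique_comp)
  have *: "bij (row_map (prod.swap ` S) B)"
    using diagram.row_map_permutes[OF swap_diagram that] permutes_bij by blast
  show "col_map B \<circ> (prod.swap \<circ> inv (row_map (prod.swap ` S) B) \<circ> prod.swap) = id"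
    "prod.swap \<circ> inv (row_map (prod.swap ` S) B) \<circ> prod.swap \<circ> col_map B = id"
    using * by (auto simp: col_map_def fun_eq_iff bij_is_surj surj_f_inv_f bij_is_inj)
qed

lemma col_map_empty [simp]: "col_map {} = id"
  unfolding col_map_def by (simp add: diagram.row_map_empty[OF swap_diagram] fun_eq_iff)

text \<open>In a state \<open>(A, B, \<pi>)\<close>, the token that started at cell \<open>p\<close> has row and column names \<open>\<pi> p\<close>.\<close>

fun step :: "direction \<Rightarrow> int set \<times> int set \<times> (cell \<Rightarrow> cell) \<Rightarrow> int set \<times> int set \<times> (cell \<Rightarrow> cell)" where
  "step Left (A, B, \<pi>) = (drop_max A, B, inv (row_map S (drop_max A)) \<circ> row_map S A \<circ> \<pi>)"
| "step Right (A, B, \<pi>) =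
    (add_max J A, B, inv (row_map S (add_max J A)) \<circ> row_map S A \<circ> \<pi>)"
| "step Down (A, B, \<pi>) = (A, drop_max B, inv (col_map (drop_max B)) \<circ> col_map B \<circ> \<pi>)"
| "step Up (A, B, \<pi>) =
    (A, add_max J' B, inv (col_map (add_max J' B)) \<circ> col_map B \<circ> \<pi>)"

fun valid :: "int set \<times> int set \<times> (cell \<Rightarrow> cell) \<Rightarrow> bool" where
  "valid (A, B, \<pi>) \<longleftrightarrow> A \<subseteq> J \<and> B \<subseteq> J' \<and> \<pi> permutes S"

lemma add_max_subset': "B \<subseteq> J' \<Longrightarrow> add_max J' B \<subseteq> J'"
  by (rule diagram.add_max_subset[OF swap_diagram])

lemma valid_step: "valid s \<Longrightarrow> valid (step d s)"
  by (cases s; cases d)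
    (auto simp: o_assoc[symmetric] intro!: permutes_compose permutes_inv row_map_permutes col_map_permutes
      drop_max_subset add_max_subset add_max_subset' dest: subsetD[OF drop_max_subset] subsetD[OF add_max_subset]
        subsetD[OF add_max_subset'])

lemma valid_fold_step: "valid s \<Longrightarrow> valid (fold step ds s)"
  by (induction ds arbitrary: s) (auto simp: valid_step simp del: valid.simps)

text \<open>The inverse appears because \<open>f\<close> is looked up at the cell where a token
  started, whereas \<open>\<pi>\<close> sends starting cells to present names.\<close>

fun realize :: "'l config \<Rightarrow> int set \<times> int set \<times> (cell \<Rightarrow> cell) \<Rightarrow> 'l config" where
  "realize f (A, B, \<pi>) = place a b A B (f \<circ> inv \<pi>)"

lemma inv_comp3: "f \<circ> inv (inv h' \<circ> h \<circ> \<pi>) = f \<circ> inv \<pi> \<circ> inv h \<circ> h'" if "bij h" "bij h'" "bij \<pi>"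
  using that by (simp add: o_inv_distrib bij_imp_bij_inv bij_comp inv_inv_eq o_assoc)

lemma shifted_swap: "shifted v E \<circ> prod.swap = shifted (prod.swap v) (E \<circ> prod.swap)"
  by (cases v) (auto simp: shifted_def fun_eq_iff)

text \<open>The state ignores where in the plane the box lies, which the existential vector absorbs:
  pushes to the right or upwards do not leave the corner of the box at the origin. Vertical pushes
  are horizontal ones in the transposed diagram.\<close>

lemma push_realize:
  assumes f: "dom f = S" and s: "valid s"
  shows "\<exists>v'. push d (shifted v (realize f s)) = shifted v' (realize f (step d s))"
proof -
  obtain A B \<pi> where s_eq: "s = (A, B, \<pi>)" by (cases s)
  have v: "A \<subseteq> J" "B \<subseteq> J'" "\<pi> permutes S" using s s_eq by auto
  define g where "g = f \<circ> inv \<pi>"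
  have g: "dom g = S" unfolding g_def by (intro dom_comp_permutes f permutes_inv v)
  have bx: "boxed a b (place a b A B g)" by (rule boxed_place[OF v(1,2) g])
  have gs: "dom (g \<circ> prod.swap) = prod.swap ` S" using g by (auto simp: dom_def swap_image_iff set_eq_iff)
  have bx': "boxed b a (place b a B A (g \<circ> prod.swap))"
    by (rule diagram.boxed_place[OF swap_diagram v(2,1) gs])
  have bij: "bij \<pi>" "bij (row_map S A)" "bij (col_map B)"
    using v row_map_permutes col_map_permutes permutes_bij by blast+
  have vert: "realize f (A, B', inv (col_map B') \<circ> col_map B \<circ> \<pi>) = place b a B' A
      (g \<circ> prod.swap \<circ> inv (row_map (prod.swap ` S) B) \<circ> row_map (prod.swap ` S) B') \<circ> prod.swap"
    if "B' \<subseteq> J'" for B'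
  proof -
    have "bij (col_map B')" using col_map_permutes[OF that] permutes_bij by blast
    then have "realize f (A, B', inv (col_map B') \<circ> col_map B \<circ> \<pi>) =
        place a b A B' (g \<circ> inv (col_map B) \<circ> col_map B')"
      by (simp add: inv_comp3 bij g_def)
    also have "g \<circ> inv (col_map B) \<circ> col_map B' =
      g \<circ> prod.swap \<circ> inv (row_map (prod.swap ` S) B) \<circ> row_map (prod.swap ` S) B' \<circ> prod.swap"
      unfolding inv_col_map[OF v(2)] by (simp add: col_map_def fun_eq_iff)
    finally show ?thesis by (simp only: place_swap realize.simps swap_comp_swap)
  qed
  show ?thesis
  proof (cases d)
    case Left
    have "bij (row_map S (drop_max A))"
      using row_map_permutes[OF drop_max_subset[OF v(1)]] permutes_bij by blast
    then have "push d (shifted v (realize f s)) = shifted 0 (realize f (step d s))"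
      unfolding s_eq Left push.simps step.simps realize.simps g_def[symmetric] push_left_shifted[OF bx]
        shift_left_place[OF v(1,2) g]
      by (simp add: inv_comp3 bij g_def)
    then show ?thesis by blast
  next
    case Right
    obtain v' where "push_right (shifted v (place a b A B g)) = shifted v' (shift_right a (place a b A B g))"
      using push_right_shifted[OF bx] by blast
    moreover have "bij (row_map S (add_max J A))"
      using row_map_permutes[OF add_max_subset[OF v(1)]] permutes_bij by blast
    ultimately have "push d (shifted v (realize f s)) = shifted v' (realize f (step d s))"
      unfolding s_eq Right push.simps step.simps realize.simps g_def[symmetric]
        shift_right_place[OF v(1,2) g]
      by (simp add: inv_comp3 bij g_def)
    then show ?thesis by blast
  next
    case Down
    have "push d (shifted v (realize f s)) = shifted 0 (realize f (step d s))"
      unfolding s_eq Down push.simps step.simps realize.simps(1)[of f A B] g_def[symmetric] shifted_swap place_swap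
        push_left_shifted[OF bx'] vert[OF drop_max_subset[OF v(2)]]
      by (simp only: shifted_0 place_swap diagram.shift_left_place[OF swap_diagram v(2,1) gs])
    then show ?thesis by blast
  next
    case Up
    obtain v' where "push_right (shifted (prod.swap v) (place b a B A (g \<circ> prod.swap))) =
      shifted v' (shift_right b (place b a B A (g \<circ> prod.swap)))"
      using push_right_shifted[OF bx'] by blast
    then have "push d (shifted v (realize f s)) = shifted (prod.swap v') (realize f (step d s))"
      unfolding s_eq Up push.simps step.simps realize.simps(1)[of f A B] g_def[symmetric] shifted_swap place_swap
        vert[OF add_max_subset'[OF v(2)]]
      by (simp only: shifted_swap place_swap diagram.shift_right_place[OF swap_diagram v(2,1) gs])
    then show ?thesis by blast
  qed
qed

lemma fold_push_realize:
  assumes f: "dom f = S" and s: "valid s"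
  shows "\<exists>v'. fold push ds (shifted v (realize f s)) = shifted v' (realize f (fold step ds s))"
  using s
proof (induction ds arbitrary: s v)
  case (Cons d ds)
  obtain v' where "push d (shifted v (realize f s)) = shifted v' (realize f (step d s))"
    using push_realize[OF f Cons.prems] by blast
  then show ?case using Cons.IH[OF valid_step[OF Cons.prems]] by simp
qed auto

end

subsection \<open>The group of closed push sequences\<close>

definition moves :: "int set \<Rightarrow> (int set \<times> int set) set" where
  "moves J = {(A, A'). A \<subseteq> J \<and> (A' = drop_max A \<or> A' = add_max J A)}"

text \<open>In a sequence of pushes along one axis the factors \<open>inv (h A') \<circ> h A\<close>
  telescope, so the result depends on the end points only. The relation \<open>Q\<close> is abstract
  so that rows and columns can share the proof.\<close>

lemma moves_telescope:
  assumes m: "(A, A') \<in> (moves J)\<^sup>*" "A \<subseteq> J"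
    and refl: "\<And>A. Q A A id" and trans: "\<And>A B C f g. Q A B f \<Longrightarrow> Q B C g \<Longrightarrow> Q A C (g \<circ> f)"
    and bij: "\<And>A. A \<subseteq> J \<Longrightarrow> bij (h A)"
    and move: "\<And>A A'. (A, A') \<in> moves J \<Longrightarrow> Q A A' (inv (h A') \<circ> h A) \<and> A' \<subseteq> J"
  shows "Q A A' (inv (h A') \<circ> h A) \<and> A' \<subseteq> J"
  using m
proof (induction rule: rtrancl_induct)
  case base
  then have "inv (h A) \<circ> h A = id" using bij by (simp add: bij_is_inj)
  then show ?case using refl base by (simp only:)
next
  case (step A1 A2)
  then have "Q A A2 (inv (h A2) \<circ> h A1 \<circ> (inv (h A1) \<circ> h A))" using trans move by blast
  also have "inv (h A2) \<circ> h A1 \<circ> (inv (h A1) \<circ> h A) = inv (h A2) \<circ> h A"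
    using bij[of A1] step by (simp add: fun_eq_iff bij_is_surj surj_f_inv_f)
  finally show ?case using move step.hyps(2) by blast
qed

context diagram
begin

lemma step_comp: "step d (A, B, \<sigma> \<circ> \<pi>) = (case step d (A, B, \<sigma>) of (A', B', \<tau>) \<Rightarrow> (A', B', \<tau> \<circ> \<pi>))"
  by (cases d) (simp_all add: o_assoc)

lemma fold_step_comp:
  "fold step ds (A, B, \<sigma> \<circ> \<pi>) = (case fold step ds (A, B, \<sigma>) of (A', B', \<tau>) \<Rightarrow> (A', B', \<tau> \<circ> \<pi>))"
proof (induction ds arbitrary: A B \<sigma>)
  case (Cons d ds)
  obtain A' B' \<tau> where "step d (A, B, \<sigma>) = (A', B', \<tau>)" by (metis prod_cases3)
  then show ?case using Cons.IH[of A' B' \<tau>] step_comp[of d A B \<sigma> \<pi>]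
    by (simp only: fold_simps prod.case)
qed simp

definition path :: "int set \<Rightarrow> int set \<Rightarrow> int set \<Rightarrow> int set \<Rightarrow> (cell \<Rightarrow> cell) \<Rightarrow> bool" where
  "path A B A' B' \<mu> \<longleftrightarrow> (\<exists>ds. fold step ds (A, B, id) = (A', B', \<mu>))"

lemma path_refl: "path A B A B id"
  unfolding path_def by (rule exI[of _ "[]"]) simp

lemma path_trans:
  assumes "path A B A1 B1 \<mu>" "path A1 B1 A2 B2 \<nu>"
  shows "path A B A2 B2 (\<nu> \<circ> \<mu>)"
proof -
  obtain ds es where "fold step ds (A, B, id) = (A1, B1, \<mu>)" "fold step es (A1, B1, id) = (A2, B2, \<nu>)"
    using assms unfolding path_def by blast
  then have "fold step (ds @ es) (A, B, id) = (A2, B2, \<nu> \<circ> \<mu>)"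
    using fold_step_comp[of es A1 B1 id \<mu>] by simp
  then show ?thesis unfolding path_def by blast
qed

lemma path_valid:
  assumes "path A B A' B' \<mu>" "A \<subseteq> J" "B \<subseteq> J'"
  shows "A' \<subseteq> J" "B' \<subseteq> J'" "\<mu> permutes S"
proof -
  obtain ds where ds: "fold step ds (A, B, id) = (A', B', \<mu>)"
    using assms unfolding path_def by blast
  have "valid (A, B, id)" using assms by (simp add: permutes_id)
  from valid_fold_step[OF this, of ds] show "A' \<subseteq> J" "B' \<subseteq> J'" "\<mu> permutes S"
    by (auto simp: ds)
qed

lemma path_row_moves:
  assumes "(A, A') \<in> (moves J)\<^sup>*" "A \<subseteq> J"
  shows "path A B A' B (inv (row_map S A') \<circ> row_map S A) \<and> A' \<subseteq> J"
proof (rule moves_telescope[OF assms])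
  fix A1 A2 assume m: "(A1, A2) \<in> moves J"
  then have "fold step [Left] (A1, B, id) = (A2, B, inv (row_map S A2) \<circ> row_map S A1) \<or>
    fold step [Right] (A1, B, id) = (A2, B, inv (row_map S A2) \<circ> row_map S A1)"
    by (auto simp: moves_def)
  moreover have "A2 \<subseteq> J"
    using m by (auto simp: moves_def dest: subsetD[OF drop_max_subset] subsetD[OF add_max_subset])
  ultimately show "path A1 B A2 B (inv (row_map S A2) \<circ> row_map S A1) \<and> A2 \<subseteq> J"
    unfolding path_def by blast
qed (use path_refl path_trans row_map_permutes permutes_bij in blast)+

lemma path_col_moves:
  assumes "(B, B') \<in> (moves J')\<^sup>*" "B \<subseteq> J'"
  shows "path A B A B' (inv (col_map B') \<circ> col_map B) \<and> B' \<subseteq> J'"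
proof (rule moves_telescope[OF assms])
  fix B1 B2 assume m: "(B1, B2) \<in> moves J'"
  then have "fold step [Down] (A, B1, id) = (A, B2, inv (col_map B2) \<circ> col_map B1) \<or>
    fold step [Up] (A, B1, id) = (A, B2, inv (col_map B2) \<circ> col_map B1)"
    by (auto simp: moves_def)
  moreover have "B2 \<subseteq> J'"
    using m by (auto simp: moves_def dest: subsetD[OF drop_max_subset] subsetD[OF add_max_subset'])
  ultimately show "path A B1 A B2 (inv (col_map B2) \<circ> col_map B1) \<and> B2 \<subseteq> J'"
    unfolding path_def by blast
qed (use path_refl path_trans col_map_permutes permutes_bij in blast)+

definition loops :: "(cell \<Rightarrow> cell) set" where
  "loops = {\<pi>. path {} {} {} {} \<pi>}"

lemma loops_permutes: "\<pi> \<in> loops \<Longrightarrow> \<pi> permutes S"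
  using path_valid(3) by (auto simp: loops_def)

text \<open>Inverses of loops are obtained from finite order, so no sequence of pushes has to be run
  backwards.\<close>

lemma inv_eq_power:
  assumes "\<pi> permutes S"
  obtains n where "inv \<pi> = \<pi> ^^ n"
proof -
  have "permutation \<pi>" using assms finite_S by (meson permutation_permutes)
  then obtain n where n: "\<pi> ^^ n = id" "n > 0" using permutation_is_nilpotent by blast
  then have "\<pi> ^^ (n - 1) \<circ> \<pi> = id" "\<pi> \<circ> \<pi> ^^ (n - 1) = id"
    by (metis Suc_diff_1 funpow_Suc_right, metis Suc_diff_1 funpow.simps(2))
  then have "inv \<pi> = \<pi> ^^ (n - 1)" by (intro inv_unique_comp)
  then show ?thesis using that by blast
qed

lemma cell_group_loops: "cell_group loops"
proof
  show bij: "f \<in> loops \<Longrightarrow> bij f" for f using loops_permutes permutes_bij by blast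
  show comp: "f \<in> loops \<Longrightarrow> g \<in> loops \<Longrightarrow> f \<circ> g \<in> loops" for f g
    unfolding loops_def using path_trans by blast
  show id: "id \<in> loops" unfolding loops_def using path_refl by blast
  show "inv f \<in> loops" if f: "f \<in> loops" for f
  proof -
    obtain n where "inv f = f ^^ n" using inv_eq_power[OF loops_permutes[OF f]] by blast
    moreover have "f ^^ n \<in> loops" by (induction n) (simp_all only: funpow.simps id f comp)
    ultimately show ?thesis by simp
  qed
qed

text \<open>The core in coordinates with the corner at the origin. When the full lines are not the
  majority, one of the intervals is empty, so the case distinction in \<open>core\<close> is built
  in.\<close>

definition core0 :: "cell set" where
  "core0 = {a - a'..<a'} \<times> {b - b'..<b'}"

lemma row_map_full:
  assumes "A \<subseteq> J" "0 \<le> x" "x < a'" "0 \<le> y" "y < b'"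
  shows "row_map S A (x, y) = (x + int (card A), y)"
proof -
  have s: "(x, y) \<in> S" using full_row assms params by auto
  have "{z \<in> A. x < z} = A" "{z \<in> A. (z, y) \<notin> S} = {}" using assms full_row params by auto
  then have c: "card {z \<in> A. x < z} = card A" "card {z \<in> A. (z, y) \<notin> S} = 0"
    by (simp_all only: card.empty)
  have "x \<notin> A" using assms by auto
  then show ?thesis using s c by (simp only: row_map_def pos_def off_def prod.case if_True if_False) simp
qed

lemma col_map_full:
  assumes "B \<subseteq> J'" "0 \<le> x" "x < a'" "0 \<le> y" "y < b'"
  shows "col_map B (x, y) = (x, y + int (card B))"
  using diagram.row_map_full[OF swap_diagram assms(1,4,5,2,3)] by (simp add: col_map_def)

lemma card_le_nonfull: "A \<subseteq> J \<Longrightarrow> int (card A) \<le> a - a'"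
  using card_mono[of "J" A] params by simp

lemma card_le_nonfull': "B \<subseteq> J' \<Longrightarrow> int (card B) \<le> b - b'"
  using card_mono[of "J'" B] params by simp

text \<open>An invariant of all reachable states, not only of closed sequences. A core token stays
  at place \<open>i\<close> while its column name slides: the full column at place \<open>i\<close>
  is the one named \<open>i - card A\<close>.\<close>

fun tracked :: "int set \<times> int set \<times> (cell \<Rightarrow> cell) \<Rightarrow> bool" where
  "tracked (A, B, \<pi>) \<longleftrightarrow> (evenperm \<pi> \<longleftrightarrow> (evenperm (row_map S A) \<longleftrightarrow> evenperm (col_map B))) \<and>
    (\<forall>(i, q) \<in> core0. \<pi> (i, q) = (i - int (card A), q - int (card B)))"

lemma evenperm_change:
  assumes "f permutes S" "g permutes S" "\<pi> permutes S"
  shows "evenperm (inv g \<circ> f \<circ> \<pi>) \<longleftrightarrow> (evenperm g \<longleftrightarrow> evenperm f) = evenperm \<pi>"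
proof -
  have "permutation f" "permutation g" "permutation \<pi>"
    using assms finite_S by (meson permutation_permutes)+
  then show ?thesis by (simp add: evenperm_comp evenperm_inv permutation_compose permutation_inverse)
qed

lemma tracked_row:
  assumes v: "A \<subseteq> J" "A' \<subseteq> J" "B \<subseteq> J'" "\<pi> permutes S"
    and t: "tracked (A, B, \<pi>)"
  shows "tracked (A', B, inv (row_map S A') \<circ> row_map S A \<circ> \<pi>)"
proof -
  note p = row_map_permutes[OF v(1)] row_map_permutes[OF v(2)]
  have "evenperm (inv (row_map S A') \<circ> row_map S A \<circ> \<pi>) \<longleftrightarrow>
    (evenperm (row_map S A') \<longleftrightarrow> evenperm (row_map S A)) = evenperm \<pi>"
    by (rule evenperm_change) (use v p in blast)+
  moreover have "(inv (row_map S A') \<circ> row_map S A \<circ> \<pi>) (i, q) = (i - int (card A'), q - int (card B))"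
    if iq: "(i, q) \<in> core0" for i q
  proof -
    have iq': "a - a' \<le> i" "i < a'" "b - b' \<le> q" "q < b'" using iq by (auto simp: core0_def)
    note c = card_le_nonfull[OF v(1)] card_le_nonfull[OF v(2)] card_le_nonfull'[OF v(3)]
    have "\<pi> (i, q) = (i - int (card A), q - int (card B))" using t iq by auto
    then have "(row_map S A \<circ> \<pi>) (i, q) = (i, q - int (card B))"
      using row_map_full[OF v(1), of "i - int (card A)" "q - int (card B)"] iq' c by simp
    also have "\<dots> = row_map S A' (i - int (card A'), q - int (card B))"
      using row_map_full[OF v(2), of "i - int (card A')" "q - int (card B)"] iq' c by simp
    finally show ?thesis using permutes_inverses(2)[OF p(2)] by simp
  qed
  ultimately show ?thesis using t by auto
qed

lemma tracked_col:
  assumes v: "A \<subseteq> J" "B' \<subseteq> J'" "B \<subseteq> J'" "\<pi> permutes S"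
    and t: "tracked (A, B, \<pi>)"
  shows "tracked (A, B', inv (col_map B') \<circ> col_map B \<circ> \<pi>)"
proof -
  note p = col_map_permutes[OF v(3)] col_map_permutes[OF v(2)]
  have "evenperm (inv (col_map B') \<circ> col_map B \<circ> \<pi>) \<longleftrightarrow>
    (evenperm (col_map B') \<longleftrightarrow> evenperm (col_map B)) = evenperm \<pi>"
    by (rule evenperm_change) (use v p in blast)+
  moreover have "(inv (col_map B') \<circ> col_map B \<circ> \<pi>) (i, q) = (i - int (card A), q - int (card B'))"
    if iq: "(i, q) \<in> core0" for i q
  proof -
    have iq': "a - a' \<le> i" "i < a'" "b - b' \<le> q" "q < b'" using iq by (auto simp: core0_def)
    note c = card_le_nonfull[OF v(1)] card_le_nonfull'[OF v(2)] card_le_nonfull'[OF v(3)]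
    have "\<pi> (i, q) = (i - int (card A), q - int (card B))" using t iq by auto
    then have "(col_map B \<circ> \<pi>) (i, q) = (i - int (card A), q)"
      using col_map_full[OF v(3), of "i - int (card A)" "q - int (card B)"] iq' c by simp
    also have "\<dots> = col_map B' (i - int (card A), q - int (card B'))"
      using col_map_full[OF v(2), of "i - int (card A)" "q - int (card B')"] iq' c by simp
    finally show ?thesis using permutes_inverses(2)[OF p(2)] by simp
  qed
  ultimately show ?thesis using t by auto
qed

lemma tracked_step: "valid s \<Longrightarrow> tracked s \<Longrightarrow> tracked (step d s)"
proof -
  assume v: "valid s" and t: "tracked s"
  obtain A B \<pi> where s: "s = (A, B, \<pi>)" by (cases s)
  have v': "A \<subseteq> J" "B \<subseteq> J'" "\<pi> permutes S" using v s by auto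
  show ?thesis
    using tracked_row[OF v'(1) drop_max_subset[OF v'(1)] v'(2,3)]
      tracked_row[OF v'(1) add_max_subset[OF v'(1)] v'(2,3)]
      tracked_col[OF v'(1) drop_max_subset[OF v'(2)] v'(2,3)]
      tracked_col[OF v'(1) add_max_subset'[OF v'(2)] v'(2,3)] t unfolding s
    by (cases d) (simp_all only: step.simps)
qed

lemma tracked_fold_step: "valid s \<Longrightarrow> tracked s \<Longrightarrow> tracked (fold step ds s)"
  by (induction ds arbitrary: s) (auto simp: tracked_step valid_step simp del: tracked.simps valid.simps)

lemma loops_subset: "loops \<subseteq> alternating_group_on (S - core0)"
proof
  fix \<pi> assume \<pi>: "\<pi> \<in> loops"
  then obtain ds where ds: "fold step ds ({}, {}, id) = ({}, {}, \<pi>)"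
    unfolding loops_def path_def by blast
  have "valid ({}, {}, id)" "tracked ({}, {}, id)" by (auto simp: permutes_id)
  then have "tracked ({}, {}, \<pi>)" using tracked_fold_step[of "({}, {}, id)" ds] ds by simp
  then have e: "evenperm \<pi>" and c: "\<And>z. z \<in> core0 \<Longrightarrow> \<pi> z = z" by auto
  have "\<pi> permutes (S - core0)"
    by (rule permutes_superset[OF loops_permutes[OF \<pi>]]) (use c in auto)
  then show "\<pi> \<in> alternating_group_on (S - core0)" using e by (simp add: alternating_group_on_def)
qed

end

subsection \<open>Cycles as commutators of rotations\<close>

definition moved_set :: "('a \<Rightarrow> 'a) \<Rightarrow> 'a set" where
  "moved_set f = {z. f z \<noteq> z}"

text \<open>For a permutation of finite support this says that it is a single cycle. The form
  through invariant sets fits the use made of it, where \<open>f\<close> is known to map a block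
  into itself.\<close>

definition single_orbit :: "('a \<Rightarrow> 'a) \<Rightarrow> bool" where
  "single_orbit f \<longleftrightarrow> (\<forall>M z. f ` M \<subseteq> M \<longrightarrow> z \<in> M \<longrightarrow> z \<in> moved_set f \<longrightarrow> moved_set f \<subseteq> M)"

lemma moved_set_conj: "moved_set (h \<circ> f \<circ> inv h) = h ` moved_set f" if "bij h"
proof (intro equalityI subsetI)
  fix z assume "z \<in> moved_set (h \<circ> f \<circ> inv h)"
  then have "f (inv h z) \<noteq> inv h z"
    using that by (auto simp: moved_set_def bij_is_surj surj_f_inv_f)
  then show "z \<in> h ` moved_set f"
    using that by (intro image_eqI[of _ h "inv h z"]) (simp_all add: moved_set_def bij_is_surj surj_f_inv_f)
next
  fix z assume "z \<in> h ` moved_set f"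
  then obtain w where "z = h w" "f w \<noteq> w" by (auto simp: moved_set_def)
  then show "z \<in> moved_set (h \<circ> f \<circ> inv h)"
    using that by (simp add: moved_set_def bij_is_inj inj_eq)
qed

lemma single_orbit_conj: "single_orbit (h \<circ> f \<circ> inv h)" if h: "bij h" and f: "single_orbit f"
  unfolding single_orbit_def
proof (intro allI impI)
  fix M z
  assume M: "(h \<circ> f \<circ> inv h) ` M \<subseteq> M" "z \<in> M" "z \<in> moved_set (h \<circ> f \<circ> inv h)"
  have "f ` (h -` M) \<subseteq> h -` M"
  proof clarify
    fix w assume "h w \<in> M"
    then have "(h \<circ> f \<circ> inv h) (h w) \<in> M" using M(1) by blast
    then show "f w \<in> h -` M" using h by (simp add: bij_is_inj)
  qed
  moreover have "inv h z \<in> h -` M" using h M(2) by (simp add: bij_is_surj surj_f_inv_f)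
  moreover have "inv h z \<in> moved_set f" using M(3) h by (auto simp: moved_set_conj bij_is_inj)
  ultimately have "moved_set f \<subseteq> h -` M" using f unfolding single_orbit_def by blast
  then show "moved_set (h \<circ> f \<circ> inv h) \<subseteq> M" using h by (auto simp: moved_set_conj)
qed

lemma moved_set_ring:
  assumes "1 \<le> a" "1 \<le> b" "b \<le> y"
  shows "moved_set (ring a b y k) = ring_cell a b y k ` {0..<2 * (a + b) - 1}"
proof (intro equalityI subsetI)
  fix z assume "z \<in> moved_set (ring a b y k)"
  then obtain i j where z: "z = (i, j)" "ring a b y k (i, j) \<noteq> (i, j)" by (cases z) (auto simp: moved_set_def)
  have "\<exists>m\<in>{0..<2 * (a + b) - 1}. (i, j) = ring_cell a b y k m"
  proof -
    consider "i = k" "0 \<le> j" "j < b" | "j = y" "0 \<le> i" "i < a" | "i = k + a" "0 < j" "j < b"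
      | "j = 0" "k < i" "i \<le> k + a"
      using z(2) assms by (auto simp: ring_def split: if_splits)
    then show ?thesis
    proof cases
      case 1
      then show ?thesis using assms by (intro bexI[of _ "2 * a + b - 1 + j"]) (auto simp: ring_cell_def)
    next
      case 2
      then show ?thesis using assms by (intro bexI[of _ i]) (auto simp: ring_cell_def)
    next
      case 3
      then show ?thesis using assms by (intro bexI[of _ "a + b - 1 - j"]) (auto simp: ring_cell_def)
    next
      case 4
      then show ?thesis using assms by (intro bexI[of _ "k + 2 * a + b - 1 - i"]) (auto simp: ring_cell_def)
    qed
  qed
  then show "z \<in> ring_cell a b y k ` {0..<2 * (a + b) - 1}" using z by blast
next
  fix z assume "z \<in> ring_cell a b y k ` {0..<2 * (a + b) - 1}"
  then obtain m where m: "0 \<le> m" "m < 2 * (a + b) - 1" "z = ring_cell a b y k m" by auto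
  have "ring_cell a b y k (if m = 2 * (a + b) - 2 then 0 else m + 1) \<noteq> ring_cell a b y k m"
    using assms m by (subst ring_cell_eq_iff) (auto split: if_splits)
  then show "z \<in> moved_set (ring a b y k)"
    using ring_ring_cell[OF assms m(1,2), of k] m(3) by (simp add: moved_set_def)
qed

lemma card_moved_set_ring:
  assumes "1 \<le> a" "1 \<le> b" "b \<le> y"
  shows "card (moved_set (ring a b y k)) = nat (2 * (a + b) - 1)"
proof -
  have "inj_on (ring_cell a b y k) {0..<2 * (a + b) - 1}"
    using ring_cell_eq_iff[OF assms] by (auto simp: inj_on_def)
  then show ?thesis by (simp add: moved_set_ring[OF assms] card_image)
qed

lemma single_orbit_ring:
  assumes "1 \<le> a" "1 \<le> b" "b \<le> y"
  shows "single_orbit (ring a b y k)"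
  unfolding single_orbit_def
proof (intro allI impI subsetI)
  fix M z w
  assume M: "ring a b y k ` M \<subseteq> M" and z: "z \<in> M" "z \<in> moved_set (ring a b y k)"
    and w: "w \<in> moved_set (ring a b y k)"
  let ?l = "2 * (a + b) - 1"
  obtain i where i: "0 \<le> i" "i < ?l" "z = ring_cell a b y k i" using z(2) by (auto simp: moved_set_ring[OF assms])
  obtain j where j: "0 \<le> j" "j < ?l" "w = ring_cell a b y k j" using w by (auto simp: moved_set_ring[OF assms])
  define n where "n = nat (if i \<le> j then j - i else j - i + ?l)"
  have "w = (ring a b y k ^^ n) z"
    unfolding i(3) j(3) by (subst ring_power_ring_cell[OF assms i(1,2)]) (use i j in \<open>auto simp: n_def\<close>)
  moreover have "(ring a b y k ^^ n) z \<in> M" by (induction n) (use M z in auto)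
  ultimately show "w \<in> M" by simp
qed

text \<open>The ring through the full part of the diagram closed off by column \<open>x\<close> and row \<open>y\<close>.\<close>

definition kappa :: "int \<Rightarrow> int \<Rightarrow> int \<Rightarrow> int \<Rightarrow> cell \<Rightarrow> cell" where
  "kappa a b x y = (\<lambda>(i, j).
     if i = 0 \<and> 0 \<le> j \<and> j < b - 1 then (0, j + 1)
     else if i = 0 \<and> j = b - 1 then (0, y)
     else if j = y \<and> 0 \<le> i \<and> i < a - 1 then (i + 1, y)
     else if j = y \<and> i = a - 1 then (x, b - 1)
     else if i = x \<and> 0 < j \<and> j < b then (x, j - 1)
     else if j = 0 \<and> i = x then (a - 1, 0)
     else if j = 0 \<and> 0 < i \<and> i < a then (i - 1, 0)
     else (i, j))"

text \<open>A mere conjugator of the plane: it carries the cycle structure of \<open>ring\<close>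
  with \<open>k = 0\<close> over to \<open>kappa\<close>.\<close>

definition exchange_cols :: "int \<Rightarrow> int \<Rightarrow> cell \<Rightarrow> cell" where
  "exchange_cols a x = (\<lambda>(i, j). (transpose a x i, j))"

lemma exchange_cols_involutory: "exchange_cols a x (exchange_cols a x z) = z"
  by (cases z) (simp add: exchange_cols_def)

lemma bij_exchange_cols: "bij (exchange_cols a x)"
  by (rule involuntory_imp_bij) (rule exchange_cols_involutory)

lemma inv_exchange_cols: "inv (exchange_cols a x) = exchange_cols a x"
  by (rule inv_unique_comp) (auto simp: fun_eq_iff exchange_cols_involutory)

lemma kappa_eq_ring:
  assumes "1 \<le> a" "1 \<le> b" "b \<le> y" "a \<le> x"
  shows "kappa a b x y = exchange_cols a x \<circ> ring a b y 0 \<circ> inv (exchange_cols a x)" (is "?L = ?R")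
proof (rule ext, clarify)
  fix i j :: int
  consider "j = y" "i = a" | "j = y" "i = x" | "j = y" "i \<noteq> a" "i \<noteq> x"
    | "j \<noteq> y" "i = x" | "j \<noteq> y" "i = a" "i \<noteq> x" | "j \<noteq> y" "i = 0" "i \<noteq> x" "i \<noteq> a"
    | "j \<noteq> y" "i \<noteq> x" "i \<noteq> a" "i \<noteq> 0" by metis
  then show "?L (i, j) = ?R (i, j)"
    unfolding inv_exchange_cols
    by cases (use assms in \<open>auto simp: kappa_def ring_def exchange_cols_def transpose_def\<close>)
qed

lemma kappa_facts:
  assumes "1 \<le> a" "1 \<le> b" "b \<le> y" "a \<le> x"
  shows "single_orbit (kappa a b x y)" "card (moved_set (kappa a b x y)) = nat (2 * (a + b) - 1)"
proof -
  show "single_orbit (kappa a b x y)"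
    unfolding kappa_eq_ring[OF assms] by (intro single_orbit_conj bij_exchange_cols single_orbit_ring assms)
  show "card (moved_set (kappa a b x y)) = nat (2 * (a + b) - 1)"
    unfolding kappa_eq_ring[OF assms] moved_set_conj[OF bij_exchange_cols]
    by (subst card_image) (use card_moved_set_ring[OF assms(1-3)] bij_exchange_cols[of a x] in
      \<open>auto intro: inj_on_subset[OF bij_is_inj]\<close>)
qed

text \<open>Here \<open>p\<close> stands for the rotation of the full rows and \<open>r\<close> for
  that of the full columns. Outside the ring a cell meets only one of them or is moved by both in
  the same way in either order. The assumptions \<open>p4\<close> and \<open>r4\<close> leave the
  exact image open, since it only matters that the other rotation fixes it.\<close>

lemma kappa_commutator:
  fixes p r :: "cell \<Rightarrow> cell" and S :: "cell set"
  assumes ab: "1 \<le> a" "1 \<le> b" "a \<le> x" "b \<le> y"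
    and S: "\<And>i j. (i, j) \<in> S \<Longrightarrow> 0 \<le> i \<and> 0 \<le> j"
    and full: "\<And>j. 0 \<le> j \<Longrightarrow> j < b \<Longrightarrow> (x, j) \<in> S" "\<And>i. 0 \<le> i \<Longrightarrow> i < a \<Longrightarrow> (i, y) \<in> S"
      "\<And>i j. 0 \<le> i \<Longrightarrow> i < a \<Longrightarrow> 0 \<le> j \<Longrightarrow> j < b \<Longrightarrow> (i, j) \<in> S"
    and p0: "\<And>z. z \<notin> S \<Longrightarrow> p z = z" and r0: "\<And>z. z \<notin> S \<Longrightarrow> r z = z"
    and p1: "\<And>i j. b \<le> j \<Longrightarrow> p (i, j) = (i, j)"
    and p2: "\<And>j. 0 \<le> j \<Longrightarrow> j < b \<Longrightarrow> p (x, j) = (a - 1, j)"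
    and p3: "\<And>i j. 0 \<le> j \<Longrightarrow> j < b \<Longrightarrow> 1 \<le> i \<Longrightarrow> i < a \<Longrightarrow> p (i, j) = (i - 1, j)"
    and p4: "\<And>i j. 0 \<le> j \<Longrightarrow> j < b \<Longrightarrow> (i, j) \<in> S \<Longrightarrow> i \<noteq> x \<Longrightarrow> i = 0 \<or> a \<le> i \<Longrightarrow> \<exists>i'\<ge>a. p (i, j) = (i', j)"
    and r1: "\<And>i j. a \<le> i \<Longrightarrow> r (i, j) = (i, j)"
    and r2: "\<And>i. 0 \<le> i \<Longrightarrow> i < a \<Longrightarrow> r (i, y) = (i, b - 1)"
    and r3: "\<And>i j. 0 \<le> i \<Longrightarrow> i < a \<Longrightarrow> 1 \<le> j \<Longrightarrow> j < b \<Longrightarrow> r (i, j) = (i, j - 1)"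
    and r4: "\<And>i j. 0 \<le> i \<Longrightarrow> i < a \<Longrightarrow> (i, j) \<in> S \<Longrightarrow> j \<noteq> y \<Longrightarrow> j = 0 \<or> b \<le> j \<Longrightarrow> \<exists>j'\<ge>b. r (i, j) = (i, j')"
  shows "r \<circ> p = p \<circ> r \<circ> kappa a b x y"
proof (rule ext, clarify)
  fix i j :: int
  let ?k = "kappa a b x y"
  have k: "?k (i, j) = (i, j)"
    if "\<not> (0 \<le> i \<and> i < a \<and> (j = 0 \<or> j = y) \<or> (i = x \<or> i = 0) \<and> 0 \<le> j \<and> j < b)"
    using that ab unfolding kappa_def prod.case by (smt (verit))
  show "(r \<circ> p) (i, j) = (p \<circ> r \<circ> ?k) (i, j)"
  proof (cases "(i, j) \<in> S")
    case False
    then have "?k (i, j) = (i, j)" using full ab False by (intro k) (smt (verit))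
    then show ?thesis using False p0 r0 by simp
  next
    case True
    have ij: "0 \<le> i" "0 \<le> j" using S[OF True] by auto
    consider "a \<le> i" "b \<le> j" | "a \<le> i" "i \<noteq> x" "j < b" | "i = x" "1 \<le> j" "j < b" | "i = x" "j = 0"
      | "i = 0" "j < b - 1" | "i = 0" "j = b - 1" | "1 \<le> i" "i < a" "1 \<le> j" "j < b"
      | "1 \<le> i" "i < a" "j = 0" | "i < a" "b \<le> j" "j \<noteq> y" | "i < a - 1" "j = y" | "i = a - 1" "j = y"
      using ij ab by (smt (verit))
    then show ?thesis
    proof cases
      case 1
      then have "?k (i, j) = (i, j)" using ab by (intro k) auto
      then show ?thesis using 1 by (simp add: p1 r1)
    next
      case 2
      then have "?k (i, j) = (i, j)" using ab ij by (intro k) auto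
      moreover obtain i' where "i' \<ge> a" "p (i, j) = (i', j)" using p4[OF ij(2) 2(3) True] 2 by blast
      ultimately show ?thesis using 2 by (simp add: r1)
    next
      case 3
      then have "?k (i, j) = (x, j - 1)" using ab by (auto simp: kappa_def)
      then show ?thesis using 3 ab by (simp add: p2 r1 r3)
    next
      case 4
      have "?k (i, j) = (a - 1, 0)" using 4 ab by (auto simp: kappa_def)
      moreover obtain j' where "j' \<ge> b" "r (a - 1, 0) = (a - 1, j')"
        using r4[of "a - 1" 0] full(3)[of "a - 1" 0] ab by auto
      ultimately show ?thesis using 4 ab by (simp add: p2 p1)
    next
      case 5
      have "?k (i, j) = (0, j + 1)" using 5 ab ij by (auto simp: kappa_def)
      moreover obtain i' where "i' \<ge> a" "p (0, j) = (i', j)" using p4[of j 0] 5 ij ab full(3)[of 0 j] by auto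
      ultimately show ?thesis using 5 ab ij by (simp add: r1 r3)
    next
      case 6
      have "?k (i, j) = (0, y)" using 6 ab ij by (auto simp: kappa_def)
      moreover obtain i' where "i' \<ge> a" "p (0, j) = (i', j)" using p4[of j 0] 6 ij ab full(3)[of 0 j] by auto
      ultimately show ?thesis using 6 ab ij by (simp add: r1 r2)
    next
      case 7
      then have "?k (i, j) = (i, j)" using ab by (intro k) auto
      then show ?thesis using 7 ab ij by (simp add: p3 r3)
    next
      case 8
      have "?k (i, j) = (i - 1, 0)" using 8 ab by (auto simp: kappa_def)
      moreover obtain j' where "j' \<ge> b" "r (i - 1, 0) = (i - 1, j')"
        using r4[of "i - 1" 0] full(3)[of "i - 1" 0] 8 ab by auto
      ultimately show ?thesis using 8 ab by (simp add: p3 p1)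
    next
      case 9
      then have "?k (i, j) = (i, j)" using ab by (intro k) auto
      moreover obtain j' where "j' \<ge> b" "r (i, j) = (i, j')" using r4[OF ij(1) 9(1) True] 9 by blast
      ultimately show ?thesis using 9 by (simp add: p1)
    next
      case 10
      then have "?k (i, j) = (i + 1, y)" using ab ij by (auto simp: kappa_def)
      then show ?thesis using 10 ab ij by (simp add: p1 p3 r2)
    next
      case 11
      then have "?k (i, j) = (x, b - 1)" using ab ij by (auto simp: kappa_def)
      then show ?thesis using 11 ab ij by (simp add: p1 p2 r1 r2)
    qed
  qed
qed

text \<open>Right pushes add columns from the largest down, and left pushes return the largest
  first. An initial interval of the non-full columns is therefore reached by moving all of them and
  then returning those from \<open>x\<close> on.\<close>

lemma moves_to_interval: "({}, {m..<x}) \<in> (moves {m..<n})\<^sup>*" "({m..<x}, {}) \<in> (moves {m..<n})\<^sup>*"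
  "({m..<x}, insert (n - 1) {m..<x}) \<in> (moves {m..<n})\<^sup>*" "(insert (n - 1) {m..<x}, {m..<x}) \<in> (moves {m..<n})\<^sup>*"
  if x: "m \<le> x" "x < n"
proof -
  have drop: "({m..<x + 1}, {m..<x}) \<in> moves {m..<n}" if "m \<le> x" "x < n" for x
  proof -
    have e: "{m..<x + 1} = insert x {m..<x}" using that by auto
    have "Max {m..<x + 1} = x" using that by (intro Max_eqI) auto
    then have "drop_max {m..<x + 1} = {m..<x}" by (simp add: drop_max_def e)
    then show ?thesis using that by (auto simp: moves_def)
  qed
  have drops: "({m..<x + int k}, {m..<x}) \<in> (moves {m..<n})\<^sup>*" if "m \<le> x" "x + int k \<le> n" for x k
    using that
  proof (induction k)
    case (Suc k)
    then have "({m..<x + int k + 1}, {m..<x + int k}) \<in> moves {m..<n}" by (intro drop) auto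
    then show ?case using Suc by (simp add: add.commute add.left_commute converse_rtrancl_into_rtrancl)
  qed simp
  have adds: "({}, {n - int k..<n}) \<in> (moves {m..<n})\<^sup>*" if "m \<le> n - int k" for k
    using that
  proof (induction k)
    case (Suc k)
    have J: "{m..<n} - {n - int k..<n} = {m..<n - int k}" using Suc.prems by auto
    have "Max {m..<n - int k} = n - int k - 1" using Suc.prems by (intro Max_eqI) auto
    moreover have "{m..<n - int k} \<noteq> {}" using Suc.prems by auto
    ultimately have "add_max {m..<n} {n - int k..<n} = insert (n - int k - 1) {n - int k..<n}"
      by (simp add: add_max_def J)
    also have "\<dots> = {n - int (Suc k)..<n}" by auto
    finally have "({n - int k..<n}, {n - int (Suc k)..<n}) \<in> moves {m..<n}"
      using Suc.prems by (auto simp: moves_def)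
    then show ?case using Suc by (auto intro: rtrancl_into_rtrancl)
  qed simp
  have 1: "({}, {m..<n}) \<in> (moves {m..<n})\<^sup>*" using adds[of "nat (n - m)"] x by simp
  have 2: "({m..<n}, {m..<x}) \<in> (moves {m..<n})\<^sup>*" using drops[of x "nat (n - x)"] x by simp
  show "({}, {m..<x}) \<in> (moves {m..<n})\<^sup>*" using 1 2 by (rule rtrancl_trans)
  show "({m..<x}, {}) \<in> (moves {m..<n})\<^sup>*" using drops[of m "nat (x - m)"] x by simp
  have "Max ({m..<n} - {m..<x}) = n - 1" using x by (intro Max_eqI) auto
  moreover have "n - 1 \<in> {m..<n} - {m..<x}" using x by auto
  ultimately have "add_max {m..<n} {m..<x} = insert (n - 1) {m..<x}" by (auto simp: add_max_def)
  then have "({m..<x}, insert (n - 1) {m..<x}) \<in> moves {m..<n}" using x by (auto simp: moves_def)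
  then show "({m..<x}, insert (n - 1) {m..<x}) \<in> (moves {m..<n})\<^sup>*" by blast
  have "Max (insert (n - 1) {m..<x}) = n - 1" using x by (intro Max_eqI) auto
  then have "drop_max (insert (n - 1) {m..<x}) = {m..<x}" using x by (auto simp: drop_max_def)
  then have "(insert (n - 1) {m..<x}, {m..<x}) \<in> moves {m..<n}" using x by (auto simp: moves_def)
  then show "(insert (n - 1) {m..<x}, {m..<x}) \<in> (moves {m..<n})\<^sup>*" by blast
qed

section \<open>Rotations of the full rows and columns\<close>

context diagram
begin

lemma pos_interval_set:
  assumes "a' \<le> x" "x < a"
  shows "0 \<le> i \<Longrightarrow> i < a' \<Longrightarrow> pos {a'..<x} i = i + (x - a')" "x \<le> i \<Longrightarrow> pos {a'..<x} i = i"
    "a' \<le> i \<Longrightarrow> i < x \<Longrightarrow> pos {a'..<x} i = x - 1 - i"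
proof -
  show "pos {a'..<x} i = i + (x - a')" if "0 \<le> i" "i < a'"
  proof -
    have "{z \<in> {a'..<x}. i < z} = {a'..<x}" using that by auto
    then show ?thesis using that assms by (simp add: pos_def)
  qed
  show "pos {a'..<x} i = i" if "x \<le> i"
  proof -
    have "{z \<in> {a'..<x}. i < z} = {}" using that by auto
    then have "card {z \<in> {a'..<x}. i < z} = 0" by (simp only: card.empty)
    then show ?thesis using that assms by (simp add: pos_def)
  qed
  show "pos {a'..<x} i = x - 1 - i" if "a' \<le> i" "i < x"
  proof -
    have "{z \<in> {a'..<x}. i < z} = {i + 1..<x}" using that by auto
    then show ?thesis using that assms by (simp add: pos_def)
  qed
qed

text \<open>In the abstract coordinates, pushing once more to the right rotates the full rows and fixes
  everything else.\<close>

lemma row_rotation: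
  assumes x: "a' \<le> x" "x < a"
  defines "A \<equiv> {a'..<x}"
  defines "p \<equiv> inv (row_map S (insert (a - 1) A)) \<circ> row_map S A"
  shows "z \<notin> S \<Longrightarrow> p z = z"
    "b' \<le> j \<Longrightarrow> p (i, j) = (i, j)"
    "0 \<le> j \<Longrightarrow> j < b' \<Longrightarrow> p (x, j) = (a' - 1, j)"
    "0 \<le> j \<Longrightarrow> j < b' \<Longrightarrow> 1 \<le> i \<Longrightarrow> i < a' \<Longrightarrow> p (i, j) = (i - 1, j)"
    "0 \<le> j \<Longrightarrow> j < b' \<Longrightarrow> (i, j) \<in> S \<Longrightarrow> i \<noteq> x \<Longrightarrow> i = 0 \<or> a' \<le> i \<Longrightarrow> \<exists>i'\<ge>a'. p (i, j) = (i', j)"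
proof -
  let ?A = "insert (a - 1) A"
  have A: "A \<subseteq> J" "?A \<subseteq> J" using x by (auto simp: A_def)
  have fin: "finite A" and nA: "a - 1 \<notin> A" using x by (auto simp: A_def)
  note perm = row_map_permutes[OF A(1)] row_map_permutes[OF A(2)]
  have pI: "p z = w" if "row_map S ?A w = row_map S A z" for z w
    using that permutes_inverses(2)[OF perm(2)] by (metis comp_apply p_def)
  have posA: "pos ?A i = pos A i + 1" if "i < a - 1" for i
  proof -
    have "{z \<in> ?A. i < z} = insert (a - 1) {z \<in> A. i < z}" using that by auto
    moreover have "card (insert (a - 1) {z \<in> A. i < z}) = Suc (card {z \<in> A. i < z})"
      using fin nA by (intro card_insert_disjoint) auto
    ultimately show ?thesis using that by (simp add: pos_def)
  qed
  have full: "row_map S B (i, j) = (pos B i, j)" if "0 \<le> i" "i < a" "0 \<le> j" "j < b'" "B \<subseteq> J" for B i j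
  proof -
    have e: "{z \<in> B. (z, j) \<notin> S} = {}" using full_row that params by auto
    have "card {z \<in> B. (z, j) \<notin> S} = 0" by (simp only: e card.empty)
    then show ?thesis using full_row[OF that(1-4)] by (simp add: row_map_def off_def)
  qed
  show "p z = z" if "z \<notin> S" for z using that by (intro pI) (auto simp: row_map_def split: prod.splits)
  then show p1: "p (i, j) = (i, j)" if "b' \<le> j" for i j
  proof (cases "(i, j) \<in> S")
    case True
    have j: "0 \<le> j" using that params by simp
    have "(a - 1, j) \<notin> S" using S_full_row[OF j] that by simp
    then have i: "i < a - 1" using True S_bounds[OF True] by (cases "i = a - 1") auto
    have "{z \<in> ?A. (z, j) \<notin> S} = insert (a - 1) {z \<in> A. (z, j) \<notin> S}" using \<open>(a - 1, j) \<notin> S\<close> by auto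
    moreover have "card (insert (a - 1) {z \<in> A. (z, j) \<notin> S}) = Suc (card {z \<in> A. (z, j) \<notin> S})"
      using fin nA by (intro card_insert_disjoint) auto
    ultimately have "off S ?A j = off S A j + 1" by (simp add: off_def)
    then show ?thesis using True posA[OF i] by (intro pI) (simp add: row_map_def)
  qed
  have a1: "a' \<le> a - 1" using x by simp
  show "p (x, j) = (a' - 1, j)" if "0 \<le> j" "j < b'" for j
  proof (rule pI)
    have "pos ?A (a' - 1) = pos A x"
      using posA[of "a' - 1"] pos_interval_set[OF x, of "a' - 1"] pos_interval_set[OF x, of x] params a1
      by (simp add: A_def)
    then show "row_map S ?A (a' - 1, j) = row_map S A (x, j)"
      using full[of "a' - 1" j ?A] full[of x j A] that A x params by simp
  qed
  show "p (i, j) = (i - 1, j)" if "0 \<le> j" "j < b'" "1 \<le> i" "i < a'" for i j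
  proof (rule pI)
    have "pos ?A (i - 1) = pos A i"
      using posA[of "i - 1"] pos_interval_set[OF x, of "i - 1"] pos_interval_set[OF x, of i] that a1
      by (simp add: A_def)
    then show "row_map S ?A (i - 1, j) = row_map S A (i, j)"
      using full[of "i - 1" j ?A] full[of i j A] that A x params by simp
  qed
  show "\<exists>i'\<ge>a'. p (i, j) = (i', j)" if h: "0 \<le> j" "j < b'" "(i, j) \<in> S" "i \<noteq> x" "i = 0 \<or> a' \<le> i" for i j
  proof -
    have i: "0 \<le> i" "i < a" using S_bounds[OF h(3)] by auto
    have A0: "A \<subseteq> {0..<a}" "?A \<subseteq> {0..<a}" using A params by auto
    have "pos A i \<in> {0..<a}" using bij_betw_pos[OF A0(1)] i by (auto simp: bij_betw_def)
    then obtain i' where i': "i' \<in> {0..<a}" "pos A i = pos ?A i'" by (rule ex_pos_eq[OF A0(2)])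
    have p: "p (i, j) = (i', j)"
      using full[of i' j ?A] full[of i j A] h i i' A by (intro pI) simp
    \<comment> \<open>After the push the full columns occupy the places \<open>x - a' + 1\<close> to
      \<open>x\<close>. Before it, these places held column \<open>x\<close> and the full columns
      other than \<open>0\<close>, all of which the hypotheses exclude.\<close>
    have "a' \<le> i'"
    proof (rule ccontr)
      assume "\<not> a' \<le> i'"
      then have lt: "i' < a'" by simp
      then have "pos ?A i' = i' + (x - a') + 1"
        using posA[of i'] pos_interval_set(1)[OF x, of i'] a1 i' by (simp add: A_def)
      moreover have "pos A i = (if i = 0 then x - a' else if x \<le> i then i else x - 1 - i)"
        using pos_interval_set[OF x, of i] h(4,5) params by (auto simp: A_def)
      ultimately show False using i' h(4,5) lt x params by (auto split: if_splits)
    qed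
    then show ?thesis using p by blast
  qed
qed

end

context diagram
begin

abbreviation kap where "kap \<equiv> kappa a' b'"

text \<open>The path goes once around a square of states: right, up, left, down. Since
  \<open>row_map\<close> ignores \<open>B\<close> and \<open>col_map\<close> ignores
  \<open>A\<close>, the way back undoes \<open>p\<close> and \<open>r\<close> in the other order and
  leaves their commutator.\<close>

lemma kappa_path:
  assumes x: "a' \<le> x" "x < a" and y: "b' \<le> y" "y < b"
  shows "path {a'..<x} {b'..<y} {a'..<x} {b'..<y} (kap x y)"
proof -
  define A where "A = {a'..<x}"
  define A1 where "A1 = insert (a - 1) A"
  define B where "B = {b'..<y}"
  define B1 where "B1 = insert (b - 1) B"
  have sub: "A \<subseteq> J" "A1 \<subseteq> J" "B \<subseteq> J'" "B1 \<subseteq> J'"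
    using x y by (auto simp: A_def A1_def B_def B1_def)
  define p where "p = inv (row_map S A1) \<circ> row_map S A"
  define r where "r = inv (col_map B1) \<circ> col_map B"
  define p' where "p' = inv (row_map (prod.swap ` S) B1) \<circ> row_map (prod.swap ` S) B"
  note P = row_rotation[OF x, folded A_def, folded A1_def, folded p_def]
  note R = diagram.row_rotation[OF swap_diagram y, folded B_def, folded B1_def, folded p'_def]
  have r: "r (i, j) = prod.swap (p' (j, i))" for i j
    unfolding r_def p'_def inv_col_map[OF sub(4)] by (simp add: col_map_def)
  have rp: "r \<circ> p = p \<circ> r \<circ> kap x y"
  proof (rule kappa_commutator)
    show "(x, j) \<in> S" if "0 \<le> j" "j < b'" for j using full_row that x params by auto
    show "(i, y) \<in> S" if "0 \<le> i" "i < a'" for i using full_col that y params by auto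
    show "(i, j) \<in> S" if "0 \<le> i" "i < a'" "0 \<le> j" "j < b'" for i j using full_row that params by auto
    show "r z = z" if "z \<notin> S" for z using that R(1)[of "prod.swap z"] by (cases z) (auto simp: r swap_image_iff)
    show "r (i, j) = (i, j)" if "a' \<le> i" for i j using R(2)[OF that, of j] by (simp add: r)
    show "r (i, y) = (i, b' - 1)" if "0 \<le> i" "i < a'" for i using R(3)[OF that] by (simp add: r)
    show "r (i, j) = (i, j - 1)" if "0 \<le> i" "i < a'" "1 \<le> j" "j < b'" for i j using R(4)[OF that] by (simp add: r)
    show "\<exists>j'\<ge>b'. r (i, j) = (i, j')" if "0 \<le> i" "i < a'" "(i, j) \<in> S" "j \<noteq> y" "j = 0 \<or> b' \<le> j" for i j
      using R(5)[OF that(1,2) _ that(4,5)] that(3) by (auto simp: r swap_image_iff)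
  qed (use P S_bounds params x y in \<open>auto simp del: split_paired_Ex\<close>)
  have mA: "(A, A1) \<in> (moves J)\<^sup>*" "(A1, A) \<in> (moves J)\<^sup>*"
    and mB: "(B, B1) \<in> (moves J')\<^sup>*" "(B1, B) \<in> (moves J')\<^sup>*"
    using moves_to_interval[OF x] moves_to_interval[OF y] by (auto simp: A_def A1_def B_def B1_def)
  have "path A B A1 B p" using path_row_moves[OF mA(1) sub(1)] unfolding p_def by blast
  moreover have "path A1 B A1 B1 r" using path_col_moves[OF mB(1) sub(3)] unfolding r_def by blast
  moreover have "path A1 B1 A B1 (inv (row_map S A) \<circ> row_map S A1)" using path_row_moves[OF mA(2) sub(2)] by blast
  moreover have "path A B1 A B (inv (col_map B) \<circ> col_map B1)" using path_col_moves[OF mB(2) sub(4)] by blast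
  ultimately have "path A B A B
      ((inv (col_map B) \<circ> col_map B1) \<circ> ((inv (row_map S A) \<circ> row_map S A1) \<circ> (r \<circ> p)))"
    by (blast intro: path_trans)
  also have "(inv (col_map B) \<circ> col_map B1) \<circ> ((inv (row_map S A) \<circ> row_map S A1) \<circ> (r \<circ> p)) = kap x y"
    unfolding rp
    using permutes_inverses[OF row_map_permutes[OF sub(1)]] permutes_inverses[OF row_map_permutes[OF sub(2)]]
      permutes_inverses[OF col_map_permutes[OF sub(3)]] permutes_inverses[OF col_map_permutes[OF sub(4)]]
    by (simp add: fun_eq_iff p_def r_def)
  finally show ?thesis by (simp add: A_def B_def)
qed

text \<open>Each loop walks from the initial state to the square, runs around it and returns.
  Walking horizontally or vertically first gives different conjugates.\<close>

lemma kappa_loops: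
  assumes x: "a' \<le> x" "x < a" and y: "b' \<le> y" "y < b"
  defines "H \<equiv> row_map S {a'..<x}" and "V \<equiv> col_map {b'..<y}"
  shows "(H \<circ> V) \<circ> kap x y \<circ> inv (H \<circ> V) \<in> loops" "(V \<circ> H) \<circ> kap x y \<circ> inv (V \<circ> H) \<in> loops"
    "bij H" "bij V"
proof -
  let ?A = "{a'..<x}" and ?B = "{b'..<y}"
  have sub: "?A \<subseteq> J" "?B \<subseteq> J'" using x y by auto
  show b: "bij H" "bij V"
    using row_map_permutes[OF sub(1)] col_map_permutes[OF sub(2)] permutes_bij unfolding H_def V_def by blast+
  note mA = moves_to_interval(1,2)[OF x] and mB = moves_to_interval(1,2)[OF y]
  have A: "path {} D ?A D (inv H)" "path ?A D {} D H" for D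
    using path_row_moves[OF mA(1), of D] path_row_moves[OF mA(2) sub(1), of D] by (simp_all add: H_def)
  have B: "path D {} D ?B (inv V)" "path D ?B D {} V" for D
    using path_col_moves[OF mB(1), of D] path_col_moves[OF mB(2) sub(2), of D] by (simp_all add: V_def)
  note K = kappa_path[OF x y]
  have "path {} {} {} {} (H \<circ> (V \<circ> (kap x y \<circ> (inv V \<circ> inv H))))"
    using path_trans[OF path_trans[OF path_trans[OF path_trans[OF A(1) B(1)] K] B(2)] A(2)] .
  then show "(H \<circ> V) \<circ> kap x y \<circ> inv (H \<circ> V) \<in> loops"
    using b by (simp add: loops_def o_inv_distrib o_assoc)
  have "path {} {} {} {} (V \<circ> (H \<circ> (kap x y \<circ> (inv H \<circ> inv V))))"
    using path_trans[OF path_trans[OF path_trans[OF path_trans[OF B(1) A(1)] K] A(2)] B(2)] .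
  then show "(V \<circ> H) \<circ> kap x y \<circ> inv (V \<circ> H) \<in> loops"
    using b by (simp add: loops_def o_inv_distrib o_assoc)
qed

lemma row_map_interval:
  assumes x: "a' \<le> x" "x < a" and S: "(i, j) \<in> S"
  shows "row_map S {a'..<x} (i, j) = (pos {a'..<x} i - off S {a'..<x} j, j)"
    and "j < b' \<Longrightarrow> off S {a'..<x} j = 0"
    and "(x - 1, j) \<in> S \<Longrightarrow> off S {a'..<x} j = 0"
    and "j = b - 1 \<Longrightarrow> off S {a'..<x} j = x - a'"
proof -
  show "row_map S {a'..<x} (i, j) = (pos {a'..<x} i - off S {a'..<x} j, j)"
    using S by (simp add: row_map_def)
  have z: "off S {a'..<x} j = 0" if "\<And>z. a' \<le> z \<Longrightarrow> z < x \<Longrightarrow> (z, j) \<in> S"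
  proof -
    have "{z \<in> {a'..<x}. (z, j) \<notin> S} = {}" using that by auto
    then have "card {z \<in> {a'..<x}. (z, j) \<notin> S} = 0" by (simp only: card.empty)
    then show ?thesis unfolding off_def by simp
  qed
  have j: "0 \<le> j" using S_bounds[OF S] by simp
  show "off S {a'..<x} j = 0" if "j < b'" using full_row that j x params by (intro z) auto
  show "off S {a'..<x} j = 0" if "(x - 1, j) \<in> S"
    using S_closed[OF that] j params by (intro z) auto
  show "off S {a'..<x} j = x - a'" if "j = b - 1"
  proof -
    have "{z \<in> {a'..<x}. (z, j) \<notin> S} = {a'..<x}" using S_full_col that params by auto
    then have "card {z \<in> {a'..<x}. (z, j) \<notin> S} = card {a'..<x}" by (simp only:)
    then show ?thesis using x unfolding off_def by simp
  qed
qed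

text \<open>This is where the shape of \<open>ring\<close> comes from. In the full rows the map
  shifts the full columns by \<open>k = x - a'\<close>, next to the fixed column \<open>x\<close>,
  whereas the tokens of row \<open>b - 1\<close> fill only the full columns and so have ranks
  \<open>0\<close> to \<open>a' - 1\<close> for every \<open>x\<close>.\<close>

lemma row_map_kappa_ring:
  assumes x: "a' \<le> x" "x < a" and b: "b' < b"
  shows "row_map S {a'..<x} \<circ> kap x (b - 1) = ring a' b' (b - 1) (x - a') \<circ> row_map S {a'..<x}"
proof (rule ext, clarify)
  fix i j :: int
  let ?H = "row_map S {a'..<x}" and ?k = "kap x (b - 1)" and ?r = "ring a' b' (b - 1) (x - a')"
  have full: "?H (i, j) = (pos {a'..<x} i, j)" if "0 \<le> i" "i < a" "0 \<le> j" "j < b'" for i j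
    using row_map_interval(1,2)[OF x full_row[OF that]] that by simp
  have F: "?H (i, j) = (i + (x - a'), j)" if "0 \<le> i" "i < a'" "0 \<le> j" "j < b'" for i j
    using full[of i j] pos_interval_set(1)[OF x, of i] that params by simp
  have Fx: "?H (x, j) = (x, j)" if "0 \<le> j" "j < b'" for j
    using full[of x j] pos_interval_set(2)[OF x, of x] that params x by simp
  have T: "?H (i, b - 1) = (i, b - 1)" if "0 \<le> i" "i < a'" for i
    using row_map_interval(1,4)[OF x, of i "b - 1"] S_full_col[OF that(1)] that pos_interval_set(1)[OF x, of i] by simp
  show "(?H \<circ> ?k) (i, j) = (?r \<circ> ?H) (i, j)"
  proof (cases "(i, j) \<in> S")
    case False
    have "?k (i, j) = (i, j)"
      using False full_row[of i j] full_col[of i j] x b params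
      unfolding kappa_def prod.case by (smt (verit))
    moreover have "?r (i, j) = (i, j)"
      using False full_row[of i j] full_col[of i j] x b params
      unfolding ring_def prod.case by (smt (verit))
    ultimately show ?thesis using False by (simp add: row_map_def)
  next
    case True
    have ij: "0 \<le> i" "i < a" "0 \<le> j" "j < b" using S_bounds[OF True] by auto
    consider "j = b - 1" | "b' \<le> j" "j < b - 1" | "j < b'" "0 \<le> i" "i < a'" | "j < b'" "i = x"
      | "j < b'" "a' \<le> i" "i \<noteq> x"
      using ij by linarith
    then show ?thesis
    proof cases
      case 1
      then have i: "i < a'" using S_full_col ij True by simp
      have H: "?H (i, j) = (i, j)" using T i ij 1 by simp
      show ?thesis
      proof (cases "i = a' - 1")
        case True
        then have "?k (i, j) = (x, b' - 1)" "?r (i, j) = (x, b' - 1)"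
          using 1 b params by (auto simp: kappa_def ring_def)
        then show ?thesis using H Fx[of "b' - 1"] params by simp
      next
        case False
        then have "?k (i, j) = (i + 1, j)" "?r (i, j) = (i + 1, j)"
          using 1 b params i ij by (auto simp: kappa_def ring_def)
        then show ?thesis using H T[of "i + 1"] 1 i ij False by simp
      qed
    next
      case 2
      then have "?k (i, j) = (i, j)" using params by (auto simp: kappa_def)
      moreover have "?r (i', j) = (i', j)" for i' using 2 params by (auto simp: ring_def)
      ultimately show ?thesis using row_map_interval(1)[OF x True] by simp
    next
      case 3
      have H: "?H (i, j) = (i + (x - a'), j)" using F 3 ij by simp
      consider "i = 0" "j < b' - 1" | "i = 0" "j = b' - 1" | "0 < i" "j = 0" | "0 < i" "0 < j" using 3 ij by linarith
      then show ?thesis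
      proof cases
        case 1
        then have "?k (i, j) = (0, j + 1)" "?r (x - a', j) = (x - a', j + 1)"
          using ij by (auto simp: kappa_def ring_def)
        then show ?thesis using H F[of 0 "j + 1"] 1 ij params by simp
      next
        case 2
        then have "?k (i, j) = (0, b - 1)" "?r (x - a', j) = (0, b - 1)"
          using ij by (auto simp: kappa_def ring_def)
        then show ?thesis using H T[of 0] 2 ij params by simp
      next
        case i0: 3
        then have "?k (i, j) = (i - 1, 0)" "?r (i + (x - a'), j) = (i - 1 + (x - a'), 0)"
          using \<open>j < b'\<close> \<open>i < a'\<close> ij b x params by (auto simp: kappa_def ring_def)
        then show ?thesis using H F[of "i - 1" 0] \<open>i < a'\<close> i0 ij params by simp
      next
        case 4
        then have "?k (i, j) = (i, j)" "?r (i + (x - a'), j) = (i + (x - a'), j)"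
          using \<open>j < b'\<close> \<open>i < a'\<close> ij b x params by (auto simp: kappa_def ring_def)
        then show ?thesis using H by simp
      qed
    next
      case 4
      have H: "?H (i, j) = (x, j)" using Fx 4 ij by simp
      show ?thesis
      proof (cases "j = 0")
        case True
        then have "?k (i, j) = (a' - 1, 0)" "?r (x, j) = (x - 1, 0)"
          using 4 b x params by (auto simp: kappa_def ring_def)
        then show ?thesis using H F[of "a' - 1" 0] params by simp
      next
        case False
        then have "?k (i, j) = (x, j - 1)" "?r (x, j) = (x, j - 1)"
          using 4 b x params ij by (auto simp: kappa_def ring_def)
        then show ?thesis using H Fx[of "j - 1"] False ij 4 by simp
      qed
    next
      case 5
      have H: "?H (i, j) = (pos {a'..<x} i, j)" using full 5 ij by simp
      have "pos {a'..<x} i < x - a' \<or> x < pos {a'..<x} i"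
        using pos_interval_set(2,3)[OF x, of i] 5 by (cases "x \<le> i") auto
      then have "?r (pos {a'..<x} i, j) = (pos {a'..<x} i, j)"
        using 5 b params by (auto simp: ring_def)
      moreover have "?k (i, j) = (i, j)" using 5 b params ij by (auto simp: kappa_def)
      ultimately show ?thesis using H by simp
    qed
  qed
qed

end

subsection \<open>Generating the alternating group\<close>

context perm_closed
begin

text \<open>If \<open>M\<close> lies within the support of \<open>c\<close>, equal size makes it the
  support. Otherwise some point of the block is fixed by \<open>c\<close>, the block is invariant,
  and the common point \<open>z\<close> draws the whole cycle in.\<close>

lemma block_absorbs:
  assumes K: "alternating_block K" and c: "c \<in> G" "single_orbit c" and M: "M \<subseteq> K"
    and card: "card M = card (moved_set c)" and fin: "finite (moved_set c)"
    and z: "z \<in> M" "z \<in> moved_set c"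
  shows "moved_set c \<subseteq> K"
proof (cases "M \<subseteq> moved_set c")
  case True
  then show ?thesis using card_subset_eq[OF fin] card M by blast
next
  case False
  then obtain p where p: "p \<in> K" "c p = p" using M by (auto simp: moved_set_def)
  then have "c ` K \<subseteq> K" using block_closed[OF K c(1) p] by blast
  then show ?thesis using c(2) z M unfolding single_orbit_def by blast
qed

lemma equi_of_conj:
  assumes "bij h" "h \<circ> (transpose p q \<circ> transpose r s) \<circ> inv h \<in> G"
  shows "equi (h p) (h q) (h r) (h s)"
  using assms(2) unfolding equi_def conj_comp[OF assms(1)] conj_transpose[OF assms(1)] .

end

context diagram
begin

lemma kap_moved:
  assumes "a' \<le> x" "b' \<le> y"
  shows "0 \<le> j \<Longrightarrow> j < b' \<Longrightarrow> (0, j) \<in> moved_set (kap x y)"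
    "0 \<le> j \<Longrightarrow> j < b' \<Longrightarrow> (x, j) \<in> moved_set (kap x y)"
    "0 \<le> i \<Longrightarrow> i < a' \<Longrightarrow> (i, 0) \<in> moved_set (kap x y)"
    "0 \<le> i \<Longrightarrow> i < a' \<Longrightarrow> (i, y) \<in> moved_set (kap x y)"
  using assms params by (auto simp: kappa_def moved_set_def)

lemma col_map_interval:
  assumes y: "b' \<le> y" "y < b" and S: "(i, j) \<in> S"
  shows "i < a' \<Longrightarrow> col_map {b'..<y} (i, j) = (i, pos {b'..<y} j)"
proof -
  assume i: "i < a'"
  have sw: "(j, i) \<in> prod.swap ` S" using S by (simp add: swap_image_iff)
  show ?thesis
    using diagram.row_map_interval(1,2)[OF swap_diagram y sw] i by (simp add: col_map_def)
qed

lemmas col_pos = diagram.pos_interval_set[OF swap_diagram]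

text \<open>Consecutive conjugates share a cell, so the block absorbs them one after the other; two orders
  of conjugation are needed because each kind of step compares well in only one of them.\<close>

lemma block_all:
  assumes K: "perm_closed.alternating_block loops K"
    and x0: "a' \<le> x0" "x0 < a" and b: "b' < b"
    and start: "(col_map {b'..<b - 1} \<circ> row_map S {a'..<x0}) ` moved_set (kap x0 (b - 1)) \<subseteq> K"
  shows "S - core0 \<subseteq> K"
proof -
  interpret L: cell_group loops by (rule cell_group_loops)
  define H where "H x = row_map S {a'..<x}" for x
  define V where "V y = col_map {b'..<y}" for y
  define E where "E x y = (H x \<circ> V y) ` moved_set (kap x y)" for x y
  define F where "F x y = (V y \<circ> H x) ` moved_set (kap x y)" for x y
  note defs = H_def V_def E_def F_def
  let ?l = "nat (2 * (a' + b') - 1)"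
  have bH: "bij (H x)" "bij (V y)" if "a' \<le> x" "x < a" "b' \<le> y" "y < b" for x y
    using kappa_loops(3,4)[OF that] by (simp_all add: defs)
  have card: "card (h ` moved_set (kap x y)) = ?l" if "bij h" "a' \<le> x" "b' \<le> y" for h :: "cell \<Rightarrow> cell" and x y
    using kappa_facts(2)[OF params(1,2) that(3,2)] card_image[OF inj_on_subset[OF bij_is_inj[OF that(1)] subset_UNIV]]
    by simp
  have absorb: "h ` moved_set (kap x y) \<subseteq> K"
    if "h \<circ> kap x y \<circ> inv h \<in> loops" "bij h" "M \<subseteq> K" "card M = ?l" "z \<in> M" "z \<in> h ` moved_set (kap x y)"
      "a' \<le> x" "b' \<le> y" for h M z x y
  proof -
    note c = card[OF that(2,7,8)]
    have "finite (h ` moved_set (kap x y))" by (rule card_ge_0_finite) (use c params in simp)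
    then show ?thesis
      using L.block_absorbs[OF K that(1) single_orbit_conj[OF that(2) kappa_facts(1)[OF params(1,2) that(8,7)]] that(3), of z]
        that c unfolding moved_set_conj[OF that(2)] by simp
  qed
  have cE: "card (E x y) = ?l" "card (F x y) = ?l" if "a' \<le> x" "x < a" "b' \<le> y" "y < b" for x y
    using card[OF bij_comp[OF bH(2)[OF that] bH(1)[OF that]]] card[OF bij_comp[OF bH(1)[OF that] bH(2)[OF that]]] that
    by (simp_all only: E_def F_def)
  have absE: "E x y \<subseteq> K" if "M \<subseteq> K" "card M = ?l" "z \<in> M" "z \<in> E x y"
      "a' \<le> x" "x < a" "b' \<le> y" "y < b" for M z x y
    unfolding E_def
    by (rule absorb[OF _ bij_comp[OF bH(2)[OF that(5-8)] bH(1)[OF that(5-8)]] that(1-3)])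
      (use that kappa_loops(1)[OF that(5-8)] in \<open>simp_all only: defs\<close>)
  have absF: "F x y \<subseteq> K" if "M \<subseteq> K" "card M = ?l" "z \<in> M" "z \<in> F x y"
      "a' \<le> x" "x < a" "b' \<le> y" "y < b" for M z x y
    unfolding F_def
    by (rule absorb[OF _ bij_comp[OF bH(1)[OF that(5-8)] bH(2)[OF that(5-8)]] that(1-3)])
      (use that kappa_loops(2)[OF that(5-8)] in \<open>simp_all only: defs\<close>)
  \<comment> \<open>A horizontal step leaves \<open>V y\<close> unchanged. In \<open>F\<close> it is
    the outer map, so it suffices that the rings share \<open>(x, 0)\<close> after \<open>H\<close>;
    in \<open>E\<close> the roles are reversed and vertical steps become easy.\<close>
  have commonF: "V y (x, 0) \<in> F x y" "V y (x, 0) \<in> F (x + 1) y"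
    if x: "a' \<le> x" "x + 1 < a" and y: "b' \<le> y" "y < b" for x y
  proof -
    have "H x (x, 0) = (x, 0)"
      using row_map_interval(1,2)[OF x(1), of x 0] full_row[of x 0] pos_interval_set(2)[OF x(1), of x] params x
      by (simp add: H_def)
    then show "V y (x, 0) \<in> F x y"
      using kap_moved(2)[OF x(1) y(1), of 0] params unfolding F_def by force
    have "H (x + 1) (a' - 1, 0) = (x, 0)"
      using row_map_interval(1,2)[of "x + 1" "a' - 1" 0] full_row[of "a' - 1" 0]
        pos_interval_set(1)[of "x + 1" "a' - 1"] params x
      by (simp add: H_def)
    then show "V y (x, 0) \<in> F (x + 1) y"
      using kap_moved(3)[of "x + 1" y "a' - 1"] x y params unfolding F_def by force
  qed
  have commonE: "H x (0, y) \<in> E x y" "H x (0, y) \<in> E x (y + 1)"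
    if x: "a' \<le> x" "x < a" and y: "b' \<le> y" "y + 1 < b" for x y
  proof -
    have "V y (0, y) = (0, y)"
      using col_map_interval[OF y(1), of 0 y] full_col[of 0 y] col_pos(2)[OF y(1), of y] params y
      by (simp add: V_def)
    then show "H x (0, y) \<in> E x y"
      using kap_moved(4)[OF x(1) y(1), of 0] params unfolding E_def by force
    have "V (y + 1) (0, b' - 1) = (0, y)"
      using col_map_interval[of "y + 1" 0 "b' - 1"] full_col[of 0 "b' - 1"]
        col_pos(1)[of "y + 1" "b' - 1"] params y
      by (simp add: V_def)
    then show "H x (0, y) \<in> E x (y + 1)"
      using kap_moved(1)[of x "y + 1" "b' - 1"] x y params unfolding E_def by force
  qed
  \<comment> \<open>At \<open>x = a'\<close> or \<open>y = b'\<close> one of the maps is the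
    identity and the two families agree. There the route from the starting ring changes between
    horizontal steps in \<open>F\<close> and vertical steps in \<open>E\<close>.\<close>
  have HE: "H a' = id" and VE: "V b' = id" by (simp_all add: H_def V_def)
  have EF: "E a' y = F a' y" "E x b' = F x b'" for x y
    by (simp_all add: E_def F_def HE VE)
  have down: "F x (b - 1) \<subseteq> K \<Longrightarrow> F a' (b - 1) \<subseteq> K" if "a' \<le> x" "x < a" for x
    using that
  proof (induction "nat (x - a')" arbitrary: x)
    case (Suc n)
    have "F (x - 1) (b - 1) \<subseteq> K"
      using absF[of "F x (b - 1)" "V (b - 1) (x - 1, 0)" "x - 1" "b - 1"] cE(2)[of x "b - 1"]
        commonF[of "x - 1" "b - 1"] Suc.prems Suc.hyps(2) b by simp
    then show ?case using Suc.hyps(1)[of "x - 1"] Suc.prems Suc.hyps(2) by simp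
  qed simp
  have "F a' (b - 1) \<subseteq> K" using down[OF x0] start by (simp add: F_def H_def V_def)
  then have 1: "E a' (b - 1) \<subseteq> K" by (simp add: EF)
  have downE: "E a' y \<subseteq> K \<Longrightarrow> E a' b' \<subseteq> K" if "b' \<le> y" "y < b" for y
    using that
  proof (induction "nat (y - b')" arbitrary: y)
    case (Suc n)
    have "E a' (y - 1) \<subseteq> K"
      using absE[of "E a' y" "H a' (0, y - 1)" a' "y - 1"] cE(1)[of a' y]
        commonE[of a' "y - 1"] Suc.prems Suc.hyps(2) x0 by simp
    then show ?case using Suc.hyps(1)[of "y - 1"] Suc.prems Suc.hyps(2) by simp
  qed simp
  have start0: "F a' b' \<subseteq> K" using downE[of "b - 1"] 1 b by (simp add: EF)
  have up: "F x b' \<subseteq> K" if "a' \<le> x" "x < a" for x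
    using that
  proof (induction "nat (x - a')" arbitrary: x)
    case 0
    then show ?case using start0 by (simp add: antisym)
  next
    case (Suc n)
    have "F (x - 1) b' \<subseteq> K" using Suc.hyps(1)[of "x - 1"] Suc.prems Suc.hyps(2) by simp
    then show ?case
      using absF[of "F (x - 1) b'" "V b' (x - 1, 0)" x b'] cE(2)[of "x - 1" b']
        commonF[of "x - 1" b'] Suc.prems Suc.hyps(2) b by simp
  qed
  have all: "E x y \<subseteq> K" if "a' \<le> x" "x < a" "b' \<le> y" "y < b" for x y
    using that(3,4)
  proof (induction "nat (y - b')" arbitrary: y)
    case 0
    then have "y = b'" by simp
    then show ?case using up[OF that(1,2)] EF by simp
  next
    case (Suc n)
    have "E x (y - 1) \<subseteq> K" using Suc.hyps(1)[of "y - 1"] Suc.prems Suc.hyps(2) by simp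
    then show ?case
      using absE[of "E x (y - 1)" "H x (0, y - 1)" x y] cE(1)[of x "y - 1"]
        commonE[of x "y - 1"] Suc.prems Suc.hyps(2) that by simp
  qed
  show ?thesis
  proof
    fix t assume t: "t \<in> S - core0"
    obtain i q where iq: "t = (i, q)" by (cases t)
    have S: "(i, q) \<in> S" using t iq by simp
    have bd: "0 \<le> i" "i < a" "0 \<le> q" "q < b" using S_bounds[OF S] by auto
    have nc: "\<not> (a - a' \<le> i \<and> i < a' \<and> b - b' \<le> q \<and> q < b')" using t iq by (auto simp: core0_def)
    have ab: "a' < a" using x0 by simp
    consider "q < b'" "a' \<le> i" | "q < b'" "i < a'" "i < a - a'" | "b' \<le> q" "i < a'"
      | "q < b'" "i < a'" "q < b - b'" | "b' \<le> q" "a' \<le> i"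
      using nc bd by linarith
    then have "\<exists>x y. a' \<le> x \<and> x < a \<and> b' \<le> y \<and> y < b \<and> (i, q) \<in> E x y"
    proof cases
      case 1
      have "H i (i, q) = (i, q)"
        using row_map_interval(1,2)[OF 1(2) bd(2) S] 1 pos_interval_set(2)[OF 1(2) bd(2), of i] by (simp add: H_def)
      then have "(i, q) \<in> E i b'" using kap_moved(2)[OF 1(2), of b' q] 1 bd unfolding E_def VE by force
      then show ?thesis using 1 bd b by auto
    next
      case 2
      \<comment> \<open>Moving the \<open>i\<close> columns from \<open>a'\<close> to
        \<open>a' + i - 1\<close> puts the first full column in place \<open>i\<close>.\<close>
      have x: "a' \<le> a' + i" "a' + i < a" using 2 bd by auto
      have "H (a' + i) (0, q) = (i, q)"
        using row_map_interval(1,2)[OF x, of 0 q] full_row[of 0 q] pos_interval_set(1)[OF x, of 0] 2 bd params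
        by (simp add: H_def)
      then have "(i, q) \<in> E (a' + i) b'" using kap_moved(1)[OF x(1), of b' q] 2 bd unfolding E_def VE by force
      then show ?thesis using x b by (intro exI[of _ "a' + i"] exI[of _ b']) auto
    next
      case 3
      have "V q (i, q) = (i, q)"
        using col_map_interval[OF 3(1) bd(4) S] 3 col_pos(2)[OF 3(1) bd(4), of q] by (simp add: V_def)
      then have "(i, q) \<in> E a' q" using kap_moved(4)[of a' q i] 3 bd unfolding E_def HE by force
      then show ?thesis using 3 bd ab by auto
    next
      case 4
      have y: "b' \<le> b' + q" "b' + q < b" using 4 bd by auto
      have "V (b' + q) (i, 0) = (i, q)"
        using col_map_interval[OF y, of i 0] full_col[of i 0] col_pos(1)[OF y, of 0] 4 bd params
        by (simp add: V_def)
      then have "(i, q) \<in> E a' (b' + q)" using kap_moved(3)[of a' "b' + q" i] y 4 bd unfolding E_def HE by force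
      then show ?thesis using y ab by (intro exI[of _ a'] exI[of _ "b' + q"]) auto
    next
      case 5
      \<comment> \<open>Cells outside all full lines: with \<open>x = i + 1\<close> the last full
        column comes to place \<open>i\<close>, and row \<open>q\<close> has no offset because it
        reaches column \<open>i\<close>. The last column does not meet row \<open>q\<close>, so
        \<open>i + 1\<close> is still a column.\<close>
      have "(a - 1, q) \<notin> S" using S_full_row[OF bd(3)] 5 by simp
      then have i: "i + 1 < a" using S bd by (cases "i = a - 1") auto
      have x: "a' \<le> i + 1" using 5 by simp
      have T: "(a' - 1, q) \<in> S" using full_col[of "a' - 1" q] bd params by simp
      have "V q (a' - 1, q) = (a' - 1, q)"
        using col_map_interval[OF 5(1) bd(4) T] col_pos(2)[OF 5(1) bd(4), of q] by (simp add: V_def)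
      moreover have "H (i + 1) (a' - 1, q) = (i, q)"
        using row_map_interval(1,3)[OF x i T] S pos_interval_set(1)[OF x i, of "a' - 1"] params by (simp add: H_def)
      ultimately have "(H (i + 1) \<circ> V q) (a' - 1, q) = (i, q)" by simp
      then have "(i, q) \<in> E (i + 1) q" using kap_moved(4)[OF x 5(1), of "a' - 1"] params unfolding E_def by force
      then show ?thesis using x i 5 bd by (intro exI[of _ "i + 1"] exI[of _ q]) auto
    qed
    then show "t \<in> K" using all iq by blast
  qed
qed

text \<open>With all rows but the last moved down, row \<open>b - 1\<close> is next to the full rows. It has exactly \<open>a'\<close>
  tokens, so the conjugates of \<open>kappa\<close> are rings sharing these tokens whatever the diagram is.\<close>

lemma alternates_noncore:
  assumes nonfull: "2 \<le> a - a'" "b' < b" and cond: "2 \<le> b' \<or> a' = 1 \<or> 4 \<le> a - a'"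
  shows "perm_closed.alternates_on loops (S - core0)"
proof -
  interpret L: cell_group loops by (rule cell_group_loops)
  define V where "V = col_map {b'..<b - 1}"
  have sub: "{b'..<b - 1} \<subseteq> J'" by auto
  have permV: "V permutes S" unfolding V_def by (rule col_map_permutes[OF sub])
  have bV: "bij V" using permV permutes_bij by blast
  \<comment> \<open>The loop group in coordinates in which the cycles of interest are literally
    \<open>ring a' b' (b - 1) k\<close>.\<close>
  define G where "G = {g. V \<circ> g \<circ> inv V \<in> loops}"
  have G: "cell_group G"
  proof
    show "bij f" if "f \<in> G" for f
    proof -
      have "bij (V \<circ> f \<circ> inv V)" using that L.bij_mem by (simp add: G_def)
      then have "bij (inv V \<circ> (V \<circ> f \<circ> inv V) \<circ> V)"
        by (rule bij_comp[OF bV bij_comp[OF _ bij_imp_bij_inv[OF bV]]])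
      moreover have "inv V \<circ> (V \<circ> f \<circ> inv V) \<circ> V = f" using bV by (simp add: fun_eq_iff bij_is_inj)
      ultimately show ?thesis by (simp only:)
    qed note bG = this
    show "f \<circ> g \<in> G" if "f \<in> G" "g \<in> G" for f g
      using that L.comp_mem[of "V \<circ> f \<circ> inv V" "V \<circ> g \<circ> inv V"] L.conj_comp[OF bV, of f g] by (simp add: G_def)
    show "inv f \<in> G" if "f \<in> G" for f
    proof -
      have "inv (V \<circ> f \<circ> inv V) = V \<circ> inv f \<circ> inv V"
        using bV bG[OF that] by (simp add: o_inv_distrib bij_comp bij_imp_bij_inv inv_inv_eq o_assoc)
      then show ?thesis using that L.inv_mem[of "V \<circ> f \<circ> inv V"] by (simp add: G_def)
    qed
    have "V \<circ> inv V = id" using bij_is_surj[OF bV] surj_iff by blast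
    then show "id \<in> G" using L.id_mem by (simp add: G_def)
  qed
  have ring: "V \<circ> ring a' b' (b - 1) k \<circ> inv V = (V \<circ> row_map S {a'..<a' + k}) \<circ> kap (a' + k) (b - 1) \<circ> inv (V \<circ> row_map S {a'..<a' + k})"
    if k: "0 \<le> k" "k < a - a'" for k
  proof -
    have x: "a' \<le> a' + k" "a' + k < a" using k by auto
    let ?H = "row_map S {a'..<a' + k}"
    have y: "b' \<le> b - 1" "b - 1 < b" using nonfull by auto
    have bH: "bij ?H" using kappa_loops(3)[OF x y] .
    have "?H \<circ> kap (a' + k) (b - 1) \<circ> inv ?H = ring a' b' (b - 1) k \<circ> ?H \<circ> inv ?H"
      using row_map_kappa_ring[OF x nonfull(2)] by simp
    also have "\<dots> = ring a' b' (b - 1) k" using bH by (simp add: fun_eq_iff bij_is_surj surj_f_inv_f)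
    finally have "V \<circ> ring a' b' (b - 1) k \<circ> inv V = V \<circ> (?H \<circ> kap (a' + k) (b - 1) \<circ> inv ?H) \<circ> inv V"
      by (simp only:)
    then show ?thesis using bH bV by (simp add: o_inv_distrib o_assoc)
  qed
  have ringG: "ring a' b' (b - 1) k \<in> G" if k: "0 \<le> k" "k < a - a'" for k
    using ring[OF k] kappa_loops(2)[of "a' + k" "b - 1"] k nonfull by (simp add: G_def V_def)
  obtain p q r k where d: "distinct [p, q, r]" and e: "perm_closed.equi G p q q r" and k: "0 \<le> k" "k < a - a'"
    and s: "\<exists>s\<in>{p, q, r}. ring a' b' (b - 1) k s \<noteq> s" "\<exists>s\<in>{p, q, r}. ring a' b' (b - 1) k s = s"
    using cell_group.ex_three_cycle[OF G, of a' b' "b - 1" "a - a'"] params nonfull cond ringG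
    by (metis zle_diff1_eq)
  have "V \<circ> (transpose p q \<circ> transpose q r) \<circ> inv V \<in> loops"
    using e perm_closed.equi_def[OF cell_group.axioms[OF G]] by (simp add: G_def)
  then have e': "L.equi (V p) (V q) (V q) (V r)" by (rule L.equi_of_conj[OF bV])
  have d': "distinct [V p, V q, V r]" using d bV by (simp add: bij_is_inj inj_eq)
  have alt: "L.alternates_on {V p, V q, V r}" by (rule L.alternates_on_triple[OF d' e'])
  have c3: "card {V p, V q, V r} \<ge> 3" using d' by simp
  let ?c = "V \<circ> ring a' b' (b - 1) k \<circ> inv V"
  have cL: "?c \<in> loops" using ringG[OF k] by (simp add: G_def)
  \<comment> \<open>Adding the three points to \<open>S\<close> gives a finite invariant set
    containing them without checking that they are cells of the diagram: loops fix everything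
    outside \<open>S\<close>.\<close>
  define X where "X = S \<union> {V p, V q, V r}"
  have "finite X" using finite_S by (simp add: X_def)
  moreover have "g ` X \<subseteq> X" if "g \<in> loops" for g
  proof -
    have "g permutes X" by (rule permutes_subset[OF loops_permutes[OF that]]) (auto simp: X_def)
    then show ?thesis using permutes_image by blast
  qed
  ultimately obtain K where K: "{V p, V q, V r} \<subseteq> K" "K \<subseteq> X" "L.alternating_block K"
    using L.ex_alternating_block[of X "{V p, V q, V r}"] alt c3 by (metis X_def Un_upper2)
  have y: "b' \<le> b - 1" using nonfull by simp
  obtain s' where s': "s' \<in> {p, q, r}" "ring a' b' (b - 1) k s' = s'" using s by blast
  obtain s'' where s'': "s'' \<in> {p, q, r}" "ring a' b' (b - 1) k s'' \<noteq> s''" using s by blast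
  have "?c (V s') = V s'" "V s' \<in> K" using s' bV K by (auto simp: bij_is_inj)
  then have "?c ` K \<subseteq> K" using L.block_closed[OF K(3) cL] by blast
  moreover have "V s'' \<in> K" "V s'' \<in> moved_set ?c"
    using s'' bV K by (auto simp: bij_is_inj moved_set_def inj_eq)
  moreover have "single_orbit ?c" using bV by (intro single_orbit_conj single_orbit_ring params y)
  ultimately have moved: "moved_set ?c \<subseteq> K" unfolding single_orbit_def by blast
  have "(V \<circ> row_map S {a'..<a' + k}) ` moved_set (kap (a' + k) (b - 1)) \<subseteq> K"
  proof -
    have x: "a' \<le> a' + k" "a' + k < a" "b - 1 < b" using k by auto
    show ?thesis
      using moved moved_set_conj[OF bij_comp[OF kappa_loops(3,4)[OF x(1,2) y x(3)]]] unfolding ring[OF k]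
      unfolding V_def by (simp only:)
  qed
  then have "S - core0 \<subseteq> K"
    using block_all[OF K(3), of "a' + k"] k nonfull by (simp add: V_def)
  then show ?thesis using K(3) unfolding L.alternating_block_def L.alternates_on_def by blast
qed

end

subsection \<open>Transposed diagrams\<close>

fun flip :: "direction \<Rightarrow> direction" where
  "flip Left = Down" | "flip Right = Up" | "flip Down = Left" | "flip Up = Right"

lemma swap_swap_image: "prod.swap ` prod.swap ` S = S"
  by (simp add: image_comp)

context diagram
begin

lemma step_swap:
  assumes v: "valid (A, B, \<pi>)"
  shows "diagram.step (prod.swap ` S) b a b' a' (flip d) (B, A, prod.swap \<circ> \<pi> \<circ> prod.swap) =
    (case step d (A, B, \<pi>) of (A', B', \<pi>') \<Rightarrow> (B', A', prod.swap \<circ> \<pi>' \<circ> prod.swap))"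
proof -
  interpret T: diagram "prod.swap ` S" b a b' a' by (rule swap_diagram)
  have sub: "A \<subseteq> J" "B \<subseteq> J'" using v by auto
  have sub': "drop_max A \<subseteq> J" "drop_max B \<subseteq> J'" "add_max J A \<subseteq> J"
    "add_max J' B \<subseteq> J'"
    using drop_max_subset add_max_subset add_max_subset' sub by blast+
  have row: "T.col_map X = prod.swap \<circ> row_map S X \<circ> prod.swap" for X
    by (simp only: T.col_map_def swap_swap_image)
  have irow: "inv (T.col_map X) = prod.swap \<circ> inv (row_map S X) \<circ> prod.swap" if "X \<subseteq> J" for X
    using T.inv_col_map[OF that] by (simp only: swap_swap_image)
  show ?thesis
  proof (cases d)
    case Left
    show ?thesis unfolding Left flip.simps T.step.simps step.simps irow[OF sub'(1)] prod.case
      unfolding row by (simp add: fun_eq_iff)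
  next
    case Right
    show ?thesis unfolding Right flip.simps T.step.simps step.simps irow[OF sub'(3)] prod.case
      unfolding row by (simp add: fun_eq_iff)
  next
    case Down
    show ?thesis unfolding Down flip.simps T.step.simps step.simps inv_col_map[OF sub'(2)] prod.case
      unfolding col_map_def by (simp add: fun_eq_iff)
  next
    case Up
    show ?thesis unfolding Up flip.simps T.step.simps step.simps inv_col_map[OF sub'(4)] prod.case
      unfolding col_map_def by (simp add: fun_eq_iff)
  qed
qed

lemma fold_step_swap:
  assumes "valid (A, B, \<pi>)"
  shows "fold (diagram.step (prod.swap ` S) b a b' a') (map flip ds) (B, A, prod.swap \<circ> \<pi> \<circ> prod.swap) =
    (case fold step ds (A, B, \<pi>) of (A', B', \<pi>') \<Rightarrow> (B', A', prod.swap \<circ> \<pi>' \<circ> prod.swap))"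
  using assms
proof (induction ds arbitrary: A B \<pi>)
  case (Cons d ds)
  obtain A' B' \<pi>' where s: "step d (A, B, \<pi>) = (A', B', \<pi>')" by (metis prod_cases3)
  have "valid (A', B', \<pi>')" using valid_step[OF Cons.prems, of d] s by simp
  from Cons.IH[OF this] show ?case
    using step_swap[OF Cons.prems, of d] by (simp only: list.map fold_simps s prod.case)
qed simp

lemma loops_swap: "\<pi> \<in> loops \<Longrightarrow> prod.swap \<circ> \<pi> \<circ> prod.swap \<in> diagram.loops (prod.swap ` S) b a b' a'"
proof -
  assume "\<pi> \<in> loops"
  then obtain ds where "fold step ds ({}, {}, id) = ({}, {}, \<pi>)" by (auto simp: loops_def path_def)
  moreover have "valid ({}, {}, id)" by (simp add: permutes_id)
  moreover have e: "prod.swap \<circ> id \<circ> prod.swap = (id :: cell \<Rightarrow> cell)" by (simp add: fun_eq_iff)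
  ultimately have "fold (diagram.step (prod.swap ` S) b a b' a') (map flip ds) ({}, {}, id) =
    ({}, {}, prod.swap \<circ> \<pi> \<circ> prod.swap)"
    using fold_step_swap[of "{}" "{}" id ds] by (simp only: prod.case e)
  then show ?thesis
    unfolding diagram.loops_def[OF swap_diagram] diagram.path_def[OF swap_diagram] by blast
qed

lemma alternates_noncore':
  assumes nonfull: "2 \<le> b - b'" "a' < a" and cond: "2 \<le> a' \<or> b' = 1 \<or> 4 \<le> b - b'"
  shows "perm_closed.alternates_on loops (S - core0)"
proof -
  interpret L: cell_group loops by (rule cell_group_loops)
  interpret T: diagram "prod.swap ` S" b a b' a' by (rule swap_diagram)
  interpret LT: cell_group T.loops by (rule T.cell_group_loops)
  have alt: "LT.alternates_on (prod.swap ` S - T.core0)" by (rule T.alternates_noncore[OF assms])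
  show ?thesis unfolding L.alternates_on_def
  proof (intro ballI impI)
    fix p q r s
    assume *: "p \<in> S - core0" "q \<in> S - core0" "r \<in> S - core0" "s \<in> S - core0" "p \<noteq> q" "r \<noteq> s"
    have mem: "prod.swap z \<in> prod.swap ` S - T.core0" if "z \<in> S - core0" for z
      using that by (cases z) (auto simp: swap_image_iff core0_def T.core0_def)
    have ne: "prod.swap p \<noteq> prod.swap q" "prod.swap r \<noteq> prod.swap s" using * by (metis swap_swap)+
    have "LT.equi (prod.swap p) (prod.swap q) (prod.swap r) (prod.swap s)"
      by (rule LT.alternates_onD[OF alt]) (use * mem ne in auto)
    then have "transpose (prod.swap p) (prod.swap q) \<circ> transpose (prod.swap r) (prod.swap s) \<in> T.loops"
      by (simp only: LT.equi_def)
    from T.loops_swap[OF this]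
    have "prod.swap \<circ> (transpose (prod.swap p) (prod.swap q) \<circ> transpose (prod.swap r) (prod.swap s)) \<circ> prod.swap \<in> loops"
      by (simp only: swap_swap_image)
    also have "prod.swap \<circ> (transpose (prod.swap p) (prod.swap q) \<circ> transpose (prod.swap r) (prod.swap s)) \<circ> prod.swap
      = transpose p q \<circ> transpose r s"
    proof -
      have "prod.swap \<circ> transpose (prod.swap u) (prod.swap v) \<circ> prod.swap = transpose u v" for u v :: cell
        by (cases u; cases v) (auto simp: fun_eq_iff transpose_def)
      from this[of p q] this[of r s] show ?thesis
        by (metis (no_types, opaque_lifting) comp_assoc swap_comp_swap(1))
    qed
    finally show "L.equi p q r s" by (simp only: L.equi_def)
  qed
qed

text \<open>With two rows of which one is full, there are few tokens. Against the size hypothesis,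
  which reads \<open>2 * (a' + 2) \<le> card S\<close> here, this forces
  \<open>4 \<le> a - a'\<close>.\<close>

lemma card_S_le:
  assumes "b = 2" "b' = 1"
  shows "int (card S) \<le> a + a'"
proof -
  have "S \<subseteq> {0..<a} \<times> {0} \<union> {0..<a'} \<times> {1}"
  proof
    fix c assume "c \<in> S"
    then obtain i j where c: "c = (i, j)" and s: "(i, j) \<in> S" by (cases c) auto
    have bounds: "0 \<le> i" "i < a" "0 \<le> j" "j < 2" using S_bounds[OF s] assms by auto
    have "i < a'" if "j = 1" using S_full_col[of i] s that assms bounds by simp
    moreover have "j = 0 \<or> j = 1" using bounds by linarith
    ultimately show "c \<in> {0..<a} \<times> {0} \<union> {0..<a'} \<times> {1}" using c bounds by auto
  qed
  then have "card S \<le> card ({0..<a} \<times> {0 :: int} \<union> {0..<a'} \<times> {1 :: int})" by (intro card_mono) auto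
  also have "\<dots> \<le> card ({0..<a} \<times> {0 :: int}) + card ({0..<a'} \<times> {1 :: int})" by (rule card_Un_le)
  finally show ?thesis using params by (simp add: card_cartesian_product)
qed

lemma card_swap_S: "card (prod.swap ` S) = card S"
  by (intro card_image) (auto simp: inj_on_def)

lemma loops_eq_alternating:
  assumes n: "2 * (a' + b' + 1) \<le> int (card S)" and ab: "1 < (a - a') * (b - b')"
  shows "loops = alternating_group_on (S - core0)"
proof -
  interpret L: cell_group loops by (rule cell_group_loops)
  have pos: "1 \<le> a - a'" "1 \<le> b - b'"
  proof -
    have "(a - a') * (b - b') \<noteq> 0" using ab by auto
    then show "1 \<le> a - a'" "1 \<le> b - b'" using params by auto
  qed
  have "L.alternates_on (S - core0)"
  proof (cases "2 \<le> a - a' \<and> (2 \<le> b' \<or> a' = 1 \<or> 4 \<le> a - a')")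
    case True
    then show ?thesis using pos by (intro alternates_noncore) auto
  next
    case False
    have "2 \<le> b - b' \<and> (2 \<le> a' \<or> b' = 1 \<or> 4 \<le> b - b')"
    proof (cases "2 \<le> a - a'")
      case True
      \<comment> \<open>With one full row and too few non-full columns for the four rings, the
        transposed argument applies, as two full columns give it rings of height at least two. It
        needs two non-full rows; these are lacking only for \<open>b = 2\<close>, which the size
        hypothesis excludes.\<close>
      then have *: "b' = 1" "2 \<le> a'" "a - a' < 4" using False params by auto
      have "b \<noteq> 2"
      proof
        assume "b = 2"
        then have "int (card S) \<le> a + a'" using * by (intro card_S_le) auto
        then show False using * n by simp
      qed
      then show ?thesis using * pos by auto
    next
      case 1: False
      then have a: "a - a' = 1" using pos by simp
      then have b2: "2 \<le> b - b'" using ab by simp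
      have "2 \<le> a' \<or> b' = 1 \<or> 4 \<le> b - b'"
      proof (rule ccontr)
        assume "\<not> ?thesis"
        then have *: "a' = 1" "a = 2" "2 \<le> b'" "b - b' < 4" using a params by auto
        then have "int (card S) \<le> b + b'"
          using diagram.card_S_le[OF swap_diagram] card_swap_S by simp
        then show False using * n by simp
      qed
      then show ?thesis using b2 by simp
    qed
    then show ?thesis using pos by (intro alternates_noncore') auto
  qed
  then have "alternating_group_on (S - core0) \<subseteq> loops"
    using finite_S by (intro L.alternating_group_subset) auto
  then show ?thesis using loops_subset by blast
qed

end

section \<open>Stability under pushes and full lines\<close>

lemma boxed_translate_0:
  assumes E: "boxed a b E" and u: "translate u (dom E) \<subseteq> {0..<a} \<times> {0..<b}"
  shows "u = 0"
proof -
  obtain y0 y1 x0 x1 where *: "(0, y0) \<in> dom E" "(a - 1, y1) \<in> dom E" "(x0, 0) \<in> dom E" "(x1, b - 1) \<in> dom E"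
    using E unfolding boxed_def by blast
  have t: "p + u \<in> {0..<a} \<times> {0..<b}" if "p \<in> dom E" for p
    using u that by (auto simp: translate_def)
  show ?thesis using t[OF *(1)] t[OF *(2)] t[OF *(3)] t[OF *(4)]
    by (cases u) (auto simp: zero_prod_def)
qed

lemma translate_translate: "translate v (translate w X) = translate (v + w) X"
  by (auto simp: translate_def image_image algebra_simps)

text \<open>A cell beyond a gap that is still occupied after the push received its token from its
  right neighbour. If the occupied set is unchanged, the row would continue to the right forever,
  beyond the box.\<close>

lemma push_left_stable_imp_closed:
  assumes E: "boxed a b E" and st: "dom (push_left (shifted u E)) = translate v (dom (shifted u E))"
    and x: "(x, y) \<in> dom E" "0 \<le> x'" "x' \<le> x"
  shows "(x', y) \<in> dom E"
proof -
  have sub: "dom (shift_left E) \<subseteq> {0..<a} \<times> {0..<b}"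
  proof
    fix c assume "c \<in> dom (shift_left E)"
    then obtain i j l where c: "c = (i, j)" and l: "shift_left E (i, j) = Some l" by (cases c) auto
    have "(i, j) \<in> {0..<a} \<times> {0..<b}"
    proof (rule ccontr)
      assume n: "\<not> ?thesis"
      then have "E (i, j) = None" using boxed_out[OF E, of i j] by auto
      moreover have "0 \<le> i \<Longrightarrow> E (i + 1, j) = None" using n boxed_out[OF E, of "i + 1" j] by auto
      ultimately show False using l by (auto simp: shift_left_def split: if_splits)
    qed
    then show "c \<in> {0..<a} \<times> {0..<b}" by (simp only: c)
  qed
  have eq: "dom (shift_left E) = translate (v + u) (dom E)"
    using st by (simp add: push_left_shifted[OF E] dom_shifted translate_translate)
  then have "v + u = 0" using boxed_translate_0[OF E] sub by simp
  then have eq: "dom (shift_left E) = dom E" using eq by (simp add: translate_def)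
  show ?thesis
  proof (rule ccontr)
    assume gap: "(x', y) \<notin> dom E"
    have "(x + int n, y) \<in> dom E" for n
    proof (induction n)
      case (Suc n)
      then have "shift_left E (x + int n, y) \<noteq> None" using eq by blast
      moreover have "\<not> (\<forall>i\<in>{0..x + int n}. E (i, y) \<noteq> None)" using gap x(2,3) by force
      ultimately have "E (x + int n + 1, y) \<noteq> None" by (simp only: shift_left_def prod.case if_False not_False_eq_True)
      then show ?case by (auto simp: algebra_simps)
    qed (use x in simp)
    then have "E (x + int (nat a), y) \<noteq> None" by blast
    moreover have "a \<le> x + int (nat a)" using x(2,3) by simp
    ultimately show False using boxed_out[OF E, of "x + int (nat a)" y] by simp
  qed
qed

lemma initial_segment:
  assumes "finite X" and "\<And>x. x \<in> X \<Longrightarrow> 0 \<le> x" and "\<And>x x'. x \<in> X \<Longrightarrow> 0 \<le> x' \<Longrightarrow> x' \<le> x \<Longrightarrow> x' \<in> X"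
  shows "X = {0..<int (card X)}"
proof (cases "X = {}")
  case False
  have m: "Max X \<in> X" using assms(1) False by (rule Max_in)
  have e: "X = {0..Max X}"
  proof (intro equalityI subsetI)
    fix x assume "x \<in> X"
    then show "x \<in> {0..Max X}" using assms(2) Max_ge[OF assms(1)] by simp
  next
    fix x assume "x \<in> {0..Max X}"
    then show "x \<in> X" using assms(3)[OF m] by simp
  qed
  define k where "k = Max X"
  have "X = {0..k}" "0 \<le> k" using e assms(2)[OF m] by (simp_all add: k_def)
  then show ?thesis by auto
qed simp

text \<open>Links the number of full columns, counted in the original coordinates, to the top row of
  the normalized shape: by closure both describe the same initial segment. Rows follow by
  transposition.\<close>

lemma full_lines:
  fixes S :: "cell set"
  assumes bounds: "\<And>x y. (x, y) \<in> S \<Longrightarrow> 0 \<le> x \<and> x \<le> M - m \<and> 0 \<le> y \<and> y \<le> M' - m'" and "m' \<le> M'"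
    and closed: "\<And>x y x' y'. (x, y) \<in> S \<Longrightarrow> 0 \<le> x' \<Longrightarrow> x' \<le> x \<Longrightarrow> 0 \<le> y' \<Longrightarrow> y' \<le> y \<Longrightarrow> (x', y') \<in> S"
  shows "{x. (x, M' - m') \<in> S} = {0..<int (card {x \<in> {m..M}. \<forall>y\<in>{m'..M'}. (x - m, y - m') \<in> S})}"
proof -
  let ?X = "{x. (x, M' - m') \<in> S}" and ?Y = "{x \<in> {m..M}. \<forall>y\<in>{m'..M'}. (x - m, y - m') \<in> S}"
  have "?Y = (\<lambda>x. x + m) ` ?X"
  proof (intro equalityI subsetI)
    fix x assume "x \<in> ?Y"
    then show "x \<in> (\<lambda>x. x + m) ` ?X" using assms(2) by (intro image_eqI[of _ _ "x - m"]) auto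
  next
    fix x assume "x \<in> (\<lambda>x. x + m) ` ?X"
    then obtain z where z: "x = z + m" "(z, M' - m') \<in> S" by auto
    show "x \<in> ?Y" using bounds[OF z(2)] closed[OF z(2), of z] by (auto simp: z(1))
  qed
  then have "card ?Y = card ?X" by (simp add: card_image inj_on_def)
  moreover have "?X = {0..<int (card ?X)}"
  proof (rule initial_segment)
    show "finite ?X" by (rule finite_subset[of _ "{0..M - m}"]) (use bounds in auto)
    show "0 \<le> x" if "x \<in> ?X" for x using bounds that by blast
    show "x' \<in> ?X" if "x \<in> ?X" "0 \<le> x'" "x' \<le> x" for x x' using closed bounds that by blast
  qed
  ultimately show ?thesis by (simp only:)
qed

lemma place_empty: "place a b {} {} E = E" if "dom E \<subseteq> {0..<a} \<times> {0..<b}"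
proof (rule ext, clarify)
  fix p q :: int
  have inv: "inv_into {0..<c} (pos {}) r = r" if "r \<in> {0..<c}" for r c :: int
    by (rule inv_into_f_eq) (use that in \<open>auto simp: inj_on_def\<close>)
  show "place a b {} {} E (p, q) = E (p, q)"
  proof (cases "p \<in> {0..<a} \<and> q \<in> {0..<b}")
    case True
    then show ?thesis by (simp add: place_def inv)
  next
    case False
    then have "(p, q) \<notin> dom E" using that by auto
    then show ?thesis using False by (auto simp: place_def)
  qed
qed

subsection \<open>Canonical configurations\<close>

definition conj_translate :: "cell \<Rightarrow> (cell \<Rightarrow> cell) \<Rightarrow> cell \<Rightarrow> cell" where
  "conj_translate v \<pi> = (\<lambda>p. \<pi> (p - v) + v)"

lemma conj_translate_inverse: "conj_translate v (conj_translate (- v) \<pi>) = \<pi>"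
  by (simp add: conj_translate_def)

lemma conj_translate_permutes: "conj_translate v \<pi> permutes translate v X" if "\<pi> permutes X"
proof (rule bij_imp_permutes)
  have "bij_betw (\<lambda>p. p + v) X (translate v X)"
    by (auto simp: bij_betw_def translate_def inj_on_def)
  moreover have "bij_betw (\<lambda>p. p - v) (translate v X) X"
    by (auto simp: bij_betw_def translate_def inj_on_def image_image)
  ultimately have "bij_betw ((\<lambda>p. p + v) \<circ> (\<pi> \<circ> (\<lambda>p. p - v))) (translate v X) (translate v X)"
    using permutes_imp_bij[OF that] by (blast intro: bij_betw_trans)
  then show "bij_betw (conj_translate v \<pi>) (translate v X) (translate v X)"
    by (simp add: conj_translate_def comp_def)
  fix p assume p: "p \<notin> translate v X"
  have "p - v \<notin> X"
  proof
    assume "p - v \<in> X"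
    then have "p - v + v \<in> translate v X" unfolding translate_def by (rule imageI)
    then show False using p by simp
  qed
  then show "conj_translate v \<pi> p = p" using permutes_not_in[OF that] by (simp add: conj_translate_def)
qed

text \<open>Parity survives because this is transport of a permutation along an injective
  map.\<close>

lemma conj_translate_alternating:
  assumes "finite X" "\<pi> \<in> alternating_group_on X"
  shows "conj_translate v \<pi> \<in> alternating_group_on (translate v X)"
proof -
  have p: "\<pi> permutes X" "evenperm \<pi>" using assms by (auto simp: alternating_group_on_def)
  have q: "conj_translate v \<pi> permutes translate v X" by (rule conj_translate_permutes[OF p(1)])
  have inj: "inj_on (\<lambda>p. p + v) X" by (simp add: inj_on_def)
  have "map_permutation X (\<lambda>p. p + v) \<pi> = conj_translate v \<pi>"
  proof
    fix z
    show "map_permutation X (\<lambda>p. p + v) \<pi> z = conj_translate v \<pi> z"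
    proof (cases "z \<in> translate v X")
      case True
      then obtain w where w: "w \<in> X" "z = w + v" by (auto simp: translate_def)
      have "inv_into X (\<lambda>p. p + v) (w + v) = w" using inv_into_f_f[OF inj w(1)] by simp
      with w show ?thesis by (simp add: map_permutation_def restrict_id_def conj_translate_def inj)
    next
      case False
      then show ?thesis using permutes_not_in[OF q False]
        by (simp add: map_permutation_def restrict_id_def translate_def)
    qed
  qed
  then show ?thesis using evenperm_map_permutation[OF inj p(1) assms(1)] p(2) q
    by (simp add: alternating_group_on_def)
qed

lemma conj_translate_alternating_group:
  assumes "finite X"
  shows "conj_translate v ` alternating_group_on X = alternating_group_on (translate v X)"
proof (intro equalityI subsetI)
  fix \<pi> assume "\<pi> \<in> alternating_group_on (translate v X)"
  moreover have "finite (translate v X)" using assms by (simp add: translate_def)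
  ultimately have "conj_translate (- v) \<pi> \<in> alternating_group_on (translate (- v) (translate v X))"
    by (intro conj_translate_alternating)
  moreover have "translate (- v) (translate v X) = X" by (simp add: translate_translate) (simp add: translate_def)
  ultimately show "\<pi> \<in> conj_translate v ` alternating_group_on X"
    by (intro image_eqI[of _ _ "conj_translate (- v) \<pi>"]) (simp_all add: conj_translate_inverse)
qed (use conj_translate_alternating[OF assms] in blast)

context diagram
begin

text \<open>If a column was moved, the leftmost place holds the non-full column
  \<open>Max A\<close>, whereas column \<open>0\<close> of the diagram is full. So the original
  shape determines the state, and sequences that restore the shape are closed.\<close>

lemma place_dom_eq_S:
  assumes A: "A \<subseteq> J" and B: "B \<subseteq> J'" and f: "dom f = S"
    and eq: "dom (place a b A B f) = S"
  shows "A = {}"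
proof (rule ccontr)
  assume ne: "A \<noteq> {}"
  have A0: "A \<subseteq> {0..<a}" and B0: "B \<subseteq> {0..<b}" using A B params by auto
  have fin: "finite A" using A finite_subset by blast
  define z where "z = Max A"
  have z: "z \<in> A" using Max_in[OF fin ne] by (simp add: z_def)
  then have zb: "a' \<le> z" "z < a" "0 \<le> z" using A params by auto
  have "{x \<in> A. z < x} = {}" using Max_ge[OF fin] by (force simp: z_def)
  then have "card {x \<in> A. z < x} = 0" by (simp only: card.empty)
  then have pz: "pos A z = 0" using z by (simp add: pos_def)
  have b: "b - 1 \<in> {0..<b}" using S_bounds[OF S_corner(2)] by auto
  have "pos B (b - 1) \<in> {0..<b}" using bij_betw_pos[OF B0] b by (auto simp: bij_betw_def)
  then have "(0, pos B (b - 1)) \<in> S" using full_col[of 0 "pos B (b - 1)"] params by auto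
  then have "place a b A B f (pos A z, pos B (b - 1)) \<noteq> None" using eq pz by auto
  then have "f (z, b - 1) \<noteq> None" using place_pos[OF A0 B0, of z "b - 1" f] zb b by simp
  then have "(z, b - 1) \<in> S" using f by blast
  then show False using S_full_col[of z] zb by simp
qed

lemma push_group_shifted:
  assumes E: "dom E = S" and inj: "inj_on E S"
  shows "push_group (shifted v0 E) = conj_translate v0 ` loops"
proof -
  let ?C = "shifted v0 E"
  have dC: "dom ?C = translate v0 S" by (simp add: dom_shifted E)
  have re: "realize E ({}, {}, id) = E" using place_empty[of E a b] S_subset E by simp
  have v0: "valid ({}, {}, id)" by (simp add: permutes_id)
  have bE: "boxed a b E" using boxed_place[of "{}" "{}" E] re E by simp
  show ?thesis
  proof (intro equalityI subsetI)
    fix \<pi> assume "\<pi> \<in> push_group ?C"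
    then obtain ds v where \<pi>: "\<pi> permutes dom ?C"
      and d: "dom (fold push ds ?C) = translate v (dom ?C)"
      and val: "\<And>p. p \<in> dom ?C \<Longrightarrow> fold push ds ?C (\<pi> p + v) = ?C p"
      unfolding push_group_def by blast
    obtain w where w: "fold push ds ?C = shifted w (realize E (fold step ds ({}, {}, id)))"
      using fold_push_realize[OF E v0, of ds v0] re by auto
    obtain A B \<rho> where s: "fold step ds ({}, {}, id) = (A, B, \<rho>)" by (metis prod_cases3)
    have "valid (A, B, \<rho>)" using valid_fold_step[OF v0, of ds] s by simp
    then have AB: "A \<subseteq> J" "B \<subseteq> J'" "\<rho> permutes S" by auto
    define g where "g = E \<circ> inv \<rho>"
    have g: "dom g = S" unfolding g_def by (intro dom_comp_permutes E permutes_inv AB)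
    define D where "D = place a b A B g"
    have bD: "boxed a b D" unfolding D_def by (rule boxed_place[OF AB(1,2) g])
    have C: "fold push ds ?C = shifted w D" by (simp add: w s D_def g_def)
    have "translate w (dom D) = translate (v + v0) S"
      using d by (simp add: C dom_shifted dC translate_translate E)
    then have "translate (- w) (translate w (dom D)) = translate (- w) (translate (v + v0) S)" by simp
    then have dD: "dom D = translate (v + v0 - w) S"
      by (simp add: translate_translate) (simp add: translate_def)
    have "translate (v + v0 - w) (dom E) \<subseteq> {0..<a} \<times> {0..<b}"
      using bD unfolding boxed_def dD E by blast
    \<comment> \<open>Both shapes have their bounding box at the origin, so the translation in the
      definition of the push group is forced.\<close>
    from boxed_translate_0[OF bE this] have wv: "w = v + v0" by simp
    then have dD: "dom D = S" using dD by (simp add: translate_def)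
    have "A = {}" using place_dom_eq_S[OF AB(1,2) g] dD by (simp add: D_def)
    moreover have "B = {}"
    proof (rule diagram.place_dom_eq_S[OF swap_diagram AB(2,1)])
      show "dom (g \<circ> prod.swap) = prod.swap ` S"
        using g by (auto simp: dom_def swap_image_iff set_eq_iff)
      have "dom (D \<circ> prod.swap) = prod.swap ` S"
        using dD by (auto simp: dom_def swap_image_iff set_eq_iff)
      then show "dom (place b a B A (g \<circ> prod.swap)) = prod.swap ` S"
        by (simp add: D_def place_swap)
    qed
    ultimately have "fold step ds ({}, {}, id) = ({}, {}, \<rho>)" using s by simp
    then have "\<rho> \<in> loops" by (auto simp: loops_def path_def)
    moreover have "\<pi> = conj_translate v0 \<rho>"
    proof
      fix p
      have Dg: "D = g" unfolding D_def \<open>A = {}\<close> \<open>B = {}\<close> by (rule place_empty) (use g S_subset in simp)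
      show "\<pi> p = conj_translate v0 \<rho> p"
      proof (cases "p \<in> dom ?C")
        case True
        then have pS: "p - v0 \<in> S" by (auto simp: dC translate_def)
        have "\<pi> p \<in> dom ?C" using permutes_in_image[OF \<pi>] True by blast
        then have "\<pi> p - v0 \<in> S" by (auto simp: dC translate_def)
        then have q: "inv \<rho> (\<pi> p - v0) \<in> S" using permutes_in_image[OF permutes_inv[OF AB(3)]] by blast
        have "shifted w D (\<pi> p + v) = ?C p" using val[OF True] by (simp add: C)
        then have "E (inv \<rho> (\<pi> p - v0)) = E (p - v0)"
          by (simp add: shifted_def wv Dg g_def)
        \<comment> \<open>Distinct labels identify tokens, which recovers the permutation from the
          final labelling.\<close>
        then have "inv \<rho> (\<pi> p - v0) = p - v0" using inj_onD[OF inj _ q pS] by blast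
        then have "\<pi> p - v0 = \<rho> (p - v0)" using permutes_inverses(1)[OF AB(3)] by metis
        then have "\<pi> p - v0 + v0 = \<rho> (p - v0) + v0" by simp
        then show ?thesis by (simp add: conj_translate_def)
      next
        case False
        then have "p \<notin> translate v0 S" by (simp add: dC)
        then show ?thesis
          using permutes_not_in[OF \<pi> False] permutes_not_in[OF conj_translate_permutes[OF AB(3)]] by metis
      qed
    qed
    ultimately show "\<pi> \<in> conj_translate v0 ` loops" by blast
  next
    fix \<pi> assume "\<pi> \<in> conj_translate v0 ` loops"
    then obtain \<rho> where \<rho>: "\<rho> \<in> loops" "\<pi> = conj_translate v0 \<rho>" by blast
    have perm: "\<rho> permutes S" by (rule loops_permutes[OF \<rho>(1)])
    obtain ds where ds: "fold step ds ({}, {}, id) = ({}, {}, \<rho>)" using \<rho>(1) by (auto simp: loops_def path_def)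
    obtain w where w: "fold push ds ?C = shifted w (realize E (fold step ds ({}, {}, id)))"
      using fold_push_realize[OF E v0, of ds v0] re by auto
    have g: "dom (E \<circ> inv \<rho>) = S" by (intro dom_comp_permutes E permutes_inv perm)
    have "realize E ({}, {}, \<rho>) = E \<circ> inv \<rho>" using place_empty[of "E \<circ> inv \<rho>" a b] S_subset g by simp
    then have C: "fold push ds ?C = shifted w (E \<circ> inv \<rho>)" using w ds by simp
    have "dom (fold push ds ?C) = translate (w - v0) (dom ?C)"
      unfolding C dom_shifted g E by (simp add: translate_translate)
    moreover have "fold push ds ?C (\<pi> p + (w - v0)) = ?C p" for p
    proof -
      have "\<pi> p + (w - v0) - w = \<rho> (p - v0)" by (simp add: \<rho>(2) conj_translate_def)
      then have "shifted w (E \<circ> inv \<rho>) (\<pi> p + (w - v0)) = E (p - v0)"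
        unfolding shifted_def using permutes_inverses(2)[OF perm] by simp
      then show ?thesis unfolding C by (simp add: shifted_def)
    qed
    moreover have "\<pi> permutes dom ?C" unfolding dC \<rho>(2) by (rule conj_translate_permutes[OF perm])
    ultimately show "\<pi> \<in> push_group ?C" unfolding push_group_def by blast
  qed
qed

end

theorem theorem4:
  fixes C :: "'l config" and n a b a' b' a'' b'' :: nat
  assumes "labelled_config C"
    and "canonical C"
    and "n = card (dom C)"
    and "a = num_cols C" and "b = num_rows C"
    and "a' = full_cols C" and "b' = full_rows C"
    and "a'' = a - a'" and "b'' = b - b'"
    and "real n / 2 \<ge> real (a' + b' + 1)"
    and "a'' * b'' > 1"
  shows "push_group C = alternating_group_on (noncore_tokens C)"
proof -
  have n: "2 * (a' + b' + 1) \<le> n" using assms(10) by simp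
  have fin: "finite (dom C)" and inj: "inj_on C (dom C)" using assms(1) by (auto simp: labelled_config_def)
  have ne: "dom C \<noteq> {}" using n assms(3) by auto
  define mx where "mx = Min (fst ` dom C)"
  define my where "my = Min (snd ` dom C)"
  define Mx where "Mx = Max (fst ` dom C)"
  define My where "My = Max (snd ` dom C)"
  define v0 where "v0 = (mx, my)"
  define E where "E = normalize C"
  define S where "S = dom E"
  have C: "C = shifted v0 E" by (simp add: E_def normalize_def shifted_def v0_def mx_def my_def)
  have dC: "dom C = translate v0 S" by (simp add: S_def dom_shifted[symmetric] C[symmetric])
  have S_iff: "(x, y) \<in> S \<longleftrightarrow> (x + mx, y + my) \<in> dom C" for x y
    by (auto simp: S_def E_def normalize_def mx_def my_def)
  have bounds: "mx \<le> x" "x \<le> Mx" "my \<le> y" "y \<le> My" if "(x, y) \<in> dom C" for x y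
  proof -
    have "x \<in> fst ` dom C" "y \<in> snd ` dom C" using that by (force intro: rev_image_eqI)+
    then show "mx \<le> x" "x \<le> Mx" "my \<le> y" "y \<le> My" using fin by (simp_all add: mx_def Mx_def my_def My_def)
  qed
  have ex: "\<exists>y. (mx, y) \<in> dom C" "\<exists>y. (Mx, y) \<in> dom C" "\<exists>x. (x, my) \<in> dom C" "\<exists>x. (x, My) \<in> dom C"
  proof -
    have "mx \<in> fst ` dom C" "Mx \<in> fst ` dom C" "my \<in> snd ` dom C" "My \<in> snd ` dom C"
      using fin ne by (simp_all add: mx_def Mx_def my_def My_def)
    then show "\<exists>y. (mx, y) \<in> dom C" "\<exists>y. (Mx, y) \<in> dom C" "\<exists>x. (x, my) \<in> dom C" "\<exists>x. (x, My) \<in> dom C"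
      by (auto simp: image_iff dom_def)
  qed
  have M: "mx \<le> Mx" "my \<le> My" using bounds ex by (meson order_trans)+
  have a: "int a = Mx - mx + 1" using M by (simp add: assms(4) num_cols_def box_cols_def mx_def Mx_def)
  have b: "int b = My - my + 1" using M by (simp add: assms(5) num_rows_def box_rows_def my_def My_def)
  have boxed: "boxed (int a) (int b) E"
    unfolding boxed_def S_def[symmetric]
  proof (intro conjI)
    show "S \<subseteq> {0..<int a} \<times> {0..<int b}"
    proof
      fix p assume "p \<in> S"
      then show "p \<in> {0..<int a} \<times> {0..<int b}"
        using bounds[of "fst p + mx" "snd p + my"] a b by (cases p) (auto simp: S_iff)
    qed
    show "\<exists>y. (0, y) \<in> S"
      using ex(1) by (metis S_iff add_0 diff_add_cancel)
    show "\<exists>y. (int a - 1, y) \<in> S"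
      using ex(2) a by (metis S_iff add_diff_cancel_right' diff_add_cancel)
    show "\<exists>x. (x, 0) \<in> S"
      using ex(3) by (metis S_iff add_0 diff_add_cancel)
    show "\<exists>x. (x, int b - 1) \<in> S"
      using ex(4) b by (metis S_iff add_diff_cancel_right' diff_add_cancel)
  qed
  have closed_row: "(x', y) \<in> S" if "(x, y) \<in> S" "0 \<le> x'" "x' \<le> x" for x x' y
  proof -
    obtain v where "dom (push_left C) = translate v (dom C)"
      using assms(2) by (auto simp: canonical_def)
    then show ?thesis
      using push_left_stable_imp_closed[OF boxed, of v0 v x y x'] that unfolding C[symmetric] S_def by blast
  qed
  have boxed': "boxed (int b) (int a) (E \<circ> prod.swap)"
  proof -
    have "dom (E \<circ> prod.swap) = prod.swap ` dom E" by (auto simp: dom_def swap_image_iff set_eq_iff)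
    then show ?thesis using boxed by (auto simp: boxed_def swap_image_iff)
  qed
  have closed_col: "(x, y') \<in> S" if "(x, y) \<in> S" "0 \<le> y'" "y' \<le> y" for x y y'
  proof -
    obtain v where v: "dom (push_left (C \<circ> prod.swap) \<circ> prod.swap) = translate v (dom C)"
      using assms(2) by (auto simp: canonical_def)
    have sw: "dom (f \<circ> prod.swap) = prod.swap ` dom f" for f :: "'l config"
      by (auto simp: dom_def swap_image_iff set_eq_iff)
    have "prod.swap ` dom (push_left (C \<circ> prod.swap)) = translate v (dom C)" using v by (simp add: sw)
    then have "prod.swap ` prod.swap ` dom (push_left (C \<circ> prod.swap)) = prod.swap ` translate v (dom C)" by simp
    also have "prod.swap ` translate v (dom C) = translate (prod.swap v) (dom (C \<circ> prod.swap))"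
      by (cases v) (auto simp: sw translate_def image_image intro!: image_cong)
    finally have "dom (push_left (C \<circ> prod.swap)) = translate (prod.swap v) (dom (C \<circ> prod.swap))"
      by (simp only: swap_swap_image)
    moreover have "C \<circ> prod.swap = shifted (prod.swap v0) (E \<circ> prod.swap)"
      unfolding C by (cases v0) (auto simp: shifted_def fun_eq_iff)
    ultimately have "(y', x) \<in> dom (E \<circ> prod.swap)"
      using push_left_stable_imp_closed[OF boxed', of "prod.swap v0" "prod.swap v" y x y'] that
      by (simp add: S_def sw swap_image_iff)
    then show ?thesis by (simp add: S_def sw swap_image_iff)
  qed
  have closed: "(x', y') \<in> S" if "(x, y) \<in> S" "0 \<le> x'" "x' \<le> x" "0 \<le> y'" "y' \<le> y" for x y x' y'
    using closed_row[OF closed_col[OF that(1,4,5)] that(2,3)] .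
  have Ssub: "(x, y) \<in> S \<Longrightarrow> 0 \<le> x \<and> x < int a \<and> 0 \<le> y \<and> y < int b" for x y
    using boxed by (auto simp: boxed_def S_def)
  have ab: "1 \<le> int a" "1 \<le> int b" using a b M by simp_all
  have dom_iff: "(x, y) \<in> dom C \<longleftrightarrow> (x - mx, y - my) \<in> S" for x y by (simp add: S_iff)
  have cols: "{x. (x, int b - 1) \<in> S} = {0..<int a'}"
  proof -
    have "{x. (x, My - my) \<in> S} = {0..<int (card {x \<in> {mx..Mx}. \<forall>y\<in>{my..My}. (x - mx, y - my) \<in> S})}"
    proof (rule full_lines)
      show "0 \<le> x \<and> x \<le> Mx - mx \<and> 0 \<le> y \<and> y \<le> My - my" if "(x, y) \<in> S" for x y
        using Ssub[OF that] a b by linarith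
    qed (fact M(2), fact closed)
    then show ?thesis
      by (simp add: b assms(6) full_cols_def box_cols_def box_rows_def dom_iff
          flip: mx_def Mx_def my_def My_def)
  qed
  have rows: "{y. (int a - 1, y) \<in> S} = {0..<int b'}"
  proof -
    have "{y. (y, Mx - mx) \<in> prod.swap ` S} =
      {0..<int (card {y \<in> {my..My}. \<forall>x\<in>{mx..Mx}. (y - my, x - mx) \<in> prod.swap ` S})}"
    proof (rule full_lines)
      show "0 \<le> y \<and> y \<le> My - my \<and> 0 \<le> x \<and> x \<le> Mx - mx" if "(y, x) \<in> prod.swap ` S" for x y
        using Ssub[of x y] that a b unfolding swap_image_iff by linarith
      show "(y', x') \<in> prod.swap ` S"
        if "(y, x) \<in> prod.swap ` S" "0 \<le> y'" "y' \<le> y" "0 \<le> x'" "x' \<le> x" for x y x' y'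
        using closed that unfolding swap_image_iff by blast
    qed (fact M(1))
    then show ?thesis
      by (simp add: a assms(7) full_rows_def box_cols_def box_rows_def dom_iff swap_image_iff
          flip: mx_def Mx_def my_def My_def)
  qed
  interpret D: diagram S "int a" "int b" "int a'" "int b'"
  proof
    show "S \<subseteq> {0..<int a} \<times> {0..<int b}" using Ssub by auto
    show "(x, y) \<in> S \<Longrightarrow> 0 \<le> x' \<Longrightarrow> x' \<le> x \<Longrightarrow> 0 \<le> y' \<Longrightarrow> y' \<le> y \<Longrightarrow> (x', y') \<in> S" for x y x' y'
      by (rule closed)
    obtain y where "(int a - 1, y) \<in> S" using boxed by (auto simp: boxed_def S_def)
    then show "(int a - 1, 0) \<in> S" using closed_col Ssub by blast
    obtain x where "(x, int b - 1) \<in> S" using boxed by (auto simp: boxed_def S_def)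
    then show "(0, int b - 1) \<in> S" using closed_row Ssub by blast
    show "(x, int b - 1) \<in> S \<longleftrightarrow> x < int a'" if "0 \<le> x" for x
      using cols that by (auto simp: set_eq_iff)
    show "(int a - 1, y) \<in> S \<longleftrightarrow> y < int b'" if "0 \<le> y" for y
      using rows that by (auto simp: set_eq_iff)
  qed
  have le: "a' \<le> a" "b' \<le> b" using D.params by simp_all
  have "n = card S"
    unfolding assms(3) dC translate_def by (intro card_image) (simp add: inj_on_def)
  then have "2 * (int a' + int b' + 1) \<le> int (card S)" using n by simp
  moreover have "1 < (int a - int a') * (int b - int b')"
  proof -
    have "(int a - int a') * (int b - int b') = int (a'' * b'')" using le assms(8,9) by (simp add: of_nat_diff)
    then show ?thesis using assms(11) by linarith
  qed
  ultimately have loops: "D.loops = alternating_group_on (S - D.core0)" by (rule D.loops_eq_alternating)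
  have injE: "inj_on E S"
  proof (rule inj_onI)
    fix p q assume pq: "p \<in> S" "q \<in> S" "E p = E q"
    then have "C (p + v0) = C (q + v0)" by (simp add: C shifted_def)
    moreover have "p + v0 \<in> dom C" "q + v0 \<in> dom C" using pq by (auto simp: dC translate_def)
    ultimately have "p + v0 = q + v0" using inj by (meson inj_onD)
    then show "p = q" by simp
  qed
  have "push_group C = conj_translate v0 ` alternating_group_on (S - D.core0)"
    using D.push_group_shifted[OF S_def[symmetric] injE, of v0] by (simp add: C[symmetric] loops)
  also have "\<dots> = alternating_group_on (translate v0 (S - D.core0))"
    by (rule conj_translate_alternating_group) (use D.finite_S in simp)
  also have "translate v0 (S - D.core0) = noncore_tokens C"
  proof -
    have nf: "int (nonfull_cols C) = int a - int a'" "int (nonfull_rows C) = int b - int b'"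
      using le by (simp_all add: nonfull_cols_def nonfull_rows_def assms(4-7) of_nat_diff)
    have core: "(x, y) \<in> core C \<longleftrightarrow> (x - mx, y - my) \<in> D.core0" for x y
    proof (cases "full_cols C > nonfull_cols C \<and> full_rows C > nonfull_rows C")
      case True
      then have "(x, y) \<in> core C \<longleftrightarrow> mx + (int a - int a') \<le> x \<and> x \<le> Mx - (int a - int a') \<and>
        my + (int b - int b') \<le> y \<and> y \<le> My - (int b - int b')"
        by (auto simp: core_def nf mx_def my_def Mx_def My_def)
      also have "\<dots> \<longleftrightarrow> (x - mx, y - my) \<in> D.core0" unfolding D.core0_def using a b by auto
      finally show ?thesis .
    next
      case False
      \<comment> \<open>In this case \<open>core\<close> is empty by convention, and
        \<open>core0\<close> because one of its intervals is.\<close>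
      then have "int a' \<le> int a - int a' \<or> int b' \<le> int b - int b'"
        using nf assms(6,7) by linarith
      then show ?thesis using False by (auto simp: core_def D.core0_def)
    qed
    show ?thesis
    proof (intro set_eqI)
      fix p :: cell
      obtain x y where p: "p = (x, y)" by (cases p)
      have "p \<in> translate v0 (S - D.core0) \<longleftrightarrow> (x - mx, y - my) \<in> S - D.core0"
      proof
        assume "p \<in> translate v0 (S - D.core0)"
        then show "(x - mx, y - my) \<in> S - D.core0" by (auto simp: translate_def p v0_def)
      next
        assume "(x - mx, y - my) \<in> S - D.core0"
        then show "p \<in> translate v0 (S - D.core0)"
          unfolding translate_def by (rule rev_image_eqI) (simp add: p v0_def)
      qed
      also have "\<dots> \<longleftrightarrow> p \<in> noncore_tokens C" by (simp add: noncore_tokens_def p S_iff core)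
      finally show "p \<in> translate v0 (S - D.core0) \<longleftrightarrow> p \<in> noncore_tokens C" .
    qed
  qed
  finally show ?thesis .
qed

end
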